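(* Assume that $X$ and $Y$ are independent. Set $$P_n=\sqrt n\,\mathrm{vec}\Big(\big(\widehat p_{k,l}-\widehat p_k\widehat q_l\big)_{k,l=1}^{K-1}\Big),\qquad \Sigma_n=\mathrm{Var}(P_n\mid X_1,\ldots,X_n),\qquad W_n=\frac1n\sum_{i=1}^n1\{N(N(i))=i\}.$$ (i) Suppose that one of the following holds: (a) for almost all $u\in(0,1)$, $f(X_{N(1)},u)\to f(X_1,u)$ in probability as $n\to\infty$; (b) for all $k=1,\ldots,K$ the mapping $x\mapsto Q_k(x)$ is $P_X$-almost everywhere continuous. Then, for all $k_1,l_1,k_2,l_2\in\{1,\ldots,K-1\}$, $$\begin{aligned}\Sigma_n((k_1,l_1),(k_2,l_2))={}&p_{k_1}p_{l_1}p_{k_2}p_{l_2}(1+W_n)\\&-p_{k_1}p_{l_1}p_{l_2}\big(1\{k_1=k_2\}+W_n1\{l_1=k_2\}\big)\\&-p_{k_1}p_{l_1}p_{k_2}\big(1\{l_1=l_2\}+W_n1\{k_1=l_2\}\big)\\&+p_{k_1}p_{l_1}\big(1\{k_1=k_2,l_1=l_2\}+W_n1\{k_1=l_2,l_1=k_2\}\big)+o_P(1).\end{aligned}$$ (ii) Suppose that $L_n=o_P(n^{1/4})$ and that there is some $b>0$ with $P(W_n\le 1-b)\to1$ as $n\to\infty$. Then for large enough $n$ the matrix $\Sigma_n$ is invertible, and $$\mathcal{I}_n^0:=P_n'\Sigma_n^{-1}P_n\to\chi^2((K-1)^2)\quad\text{in distribution as }n\to\infty.$$ If $\widehat\Sigma_n$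 denotes the empirical analogue of $\Sigma_n$, with the $p_k$ replaced by their estimators $\widehat p_k$, then also $$\mathcal{I}_n:=P_n'\widehat\Sigma_n^{-1}P_n\to\chi^2((K-1)^2)\quad\text{in distribution as }n\to\infty.$$
   Context: $(\mathcal{H},d)$ is a separable metric space, $X$ is an $\mathcal{H}$-valued random variable with law $P_X$, and $Y$ is categorical with levels $\{1,\ldots,K\}$, $K\ge2$, $p_k=P(Y=k)>0$ for all $k$. $Q_k(x)=P(Y=k\mid X=x)$ and $f(x,u)=\min\{k\in\{1,\ldots,K\}:\sum_{j=1}^kQ_j(x)>u\}$. Let $X_i$ be i.i.d. copies of $X$, $U_i$ i.i.d. uniform on $(0,1)$ and independent of the $X_i$, and $Y_i=f(X_i,U_i)$, so that $(X_1,Y_1),\ldots,(X_n,Y_n)$ is an i.i.d. sample from the law of $(X,Y)$. $N(i)=N_n(i)\in\{1,\ldots,n\}\setminus\{i\}$ is the index of the nearest neighbour of $X_i$ among the other $X_j$, $1\le j\le n$, $j\ne i$, with respect to $d$. It is assumed that $d(X_1,X_2)$ has a continuous distribution, so that nearest neighbours are almost surely unique. $L_n=\max_{1\le i\le n}\#\{j\le n:N(j)=i\}$. Further $$\widehat p_{k,l}=\frac1n\sum_{i=1}^n1\{Y_i=k,Y_{N(i)}=l\},\quad \widehat p_k=\sum_{l=1}^K\widehat p_{k,l},\quad \widehat q_l=\sum_{k=1}^K\widehat p_{k,l}.$$ $\mathrm{vec}$ stacks the columns of a matrix into a vector; the entries of $P_n$ are indexed by pairs $(k,l)$ and those of $\Sigma_n$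 by pairs of pairs. $\widehat\Sigma_n$ is the matrix given by the explicit formula in (i) without the $o_P(1)$ term and with each $p_k$ replaced by $\widehat p_k$. $\chi^2(m)$ is the chi-squared distribution with $m$ degrees of freedom.
   Formalization: "For large enough n the matrix Σ_n is invertible" is read as: the probability that Σ_n is invertible tends to 1, since for K ≥ 3 and even n, W_n = 1 (hence Σ_n singular) can have positive probability; the quadratic forms are set to 0 when the matrix is singular. *)

theory Defs
  imports
    "HOL-Probability.Probability"
    "Jordan_Normal_Form.Gauss_Jordan_Elimination"
begin

section \<open>Probabilistic notions\<close>

text \<open>
  The library's \<open>indep_var\<close> requires both random variables to have the same type, hence this
  version for arbitrary measurable spaces: the generated sigma-algebras are independent.
\<close>

definition indep_rv ::
  "'w measure \<Rightarrow> 'a measure \<Rightarrow> ('w \<Rightarrow> 'a) \<Rightarrow> 'b measure \<Rightarrow> ('w \<Rightarrow> 'b) \<Rightarrow> bool" where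
  "indep_rv M A V B Z \<longleftrightarrow>
     V \<in> measurable M A \<and> Z \<in> measurable M B \<and>
     prob_space.indep_set M {V -` S \<inter> space M | S. S \<in> sets A} {Z -` S \<inter> space M | S. S \<in> sets B}"

definition small_o_P :: "'w measure \<Rightarrow> (nat \<Rightarrow> 'w \<Rightarrow> real) \<Rightarrow> (nat \<Rightarrow> real) \<Rightarrow> bool" where
  "small_o_P M R a \<longleftrightarrow>
     (\<forall>\<epsilon>>0. (\<lambda>n. measure M {\<omega> \<in> space M. \<bar>R n \<omega>\<bar> > \<epsilon> * a n}) \<longlonglongrightarrow> 0)"

text \<open>The law of the sum of the squares of \<open>m\<close> independent standard normal variables.\<close>

definition chi_squared :: "nat \<Rightarrow> real measure" where
  "chi_squared m =
     distr (PiM {..<m} (\<lambda>_. density lborel std_normal_density)) borel (\<lambda>z. \<Sum>i<m. (z i)\<^sup>2)"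

definition cond_cov :: "'w measure \<Rightarrow> 'w measure \<Rightarrow> ('w \<Rightarrow> real) \<Rightarrow> ('w \<Rightarrow> real) \<Rightarrow> 'w \<Rightarrow> real" where
  "cond_cov M F V Z =
     real_cond_exp M F (\<lambda>\<omega>. (V \<omega> - real_cond_exp M F V \<omega>) * (Z \<omega> - real_cond_exp M F Z \<omega>))"

definition sigma_first :: "'w measure \<Rightarrow> (nat \<Rightarrow> 'w \<Rightarrow> 'h::topological_space) \<Rightarrow> nat \<Rightarrow> 'w measure" where
  "sigma_first M X n =
     vimage_algebra (space M) (\<lambda>\<omega>. \<lambda>i\<in>{1..n}. X i \<omega>) (PiM {1..n} (\<lambda>_. borel))"


section \<open>Matrices\<close>

text \<open>
  \<open>vec_stack\<close> stacks the columns. Library matrices are indexed from 0, so entry \<open>(k, l)\<close>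
  (counted from 1) of a \<open>(K - 1) \<times> (K - 1)\<close> matrix goes to position \<open>pair_index K k l\<close>.
\<close>

definition vec_stack :: "'a mat \<Rightarrow> 'a Matrix.vec" where
  "vec_stack A =
     Matrix.vec (dim_row A * dim_col A) (\<lambda>r. A $$ (r mod dim_row A, r div dim_row A))"

definition pair_index :: "nat \<Rightarrow> nat \<Rightarrow> nat \<Rightarrow> nat" where
  "pair_index K k l = (l - 1) * (K - 1) + (k - 1)"

text \<open>The value of \<open>v' A\<^sup>-\<^sup>1 v\<close>, with the convention 0 for a singular matrix \<open>A\<close>.\<close>

definition inv_quad_form :: "real mat \<Rightarrow> real Matrix.vec \<Rightarrow> real" where
  "inv_quad_form A v =
     (case mat_inverse A of Some B \<Rightarrow> scalar_prod v (B *\<^sub>v v) | None \<Rightarrow> 0)"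


section \<open>Nearest neighbour statistics\<close>

definition level_fun :: "nat \<Rightarrow> (nat \<Rightarrow> 'h \<Rightarrow> real) \<Rightarrow> 'h \<Rightarrow> real \<Rightarrow> nat" where
  "level_fun K Q x u = Min {k \<in> {1..K}. (\<Sum>j=1..k. Q j x) > u}"

text \<open>
  In the statistics below, \<open>x\<close> and \<open>y\<close> are the observed sequences, of which only the entries
  \<open>1, \<dots>, n\<close> are used. Ties between nearest neighbours are broken in favour of the smallest index;
  for \<open>n \<ge> 2\<close> the set of minimisers is nonempty.
\<close>

definition nn :: "nat \<Rightarrow> (nat \<Rightarrow> 'h::metric_space) \<Rightarrow> nat \<Rightarrow> nat" where
  "nn n x i = (LEAST j. is_arg_min (\<lambda>j. dist (x i) (x j)) (\<lambda>j. j \<in> {1..n} - {i}) j)"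

definition max_indeg :: "nat \<Rightarrow> (nat \<Rightarrow> 'h::metric_space) \<Rightarrow> nat" where
  "max_indeg n x = Max ((\<lambda>i. card {j \<in> {1..n}. nn n x j = i}) ` {1..n})"

definition W_stat :: "nat \<Rightarrow> (nat \<Rightarrow> 'h::metric_space) \<Rightarrow> real" where
  "W_stat n x = 1 / real n * (\<Sum>i=1..n. of_bool (nn n x (nn n x i) = i))"

definition pair_freq :: "nat \<Rightarrow> (nat \<Rightarrow> 'h::metric_space) \<Rightarrow> (nat \<Rightarrow> nat) \<Rightarrow> nat \<Rightarrow> nat \<Rightarrow> real" where
  "pair_freq n x y k l = 1 / real n * (\<Sum>i=1..n. of_bool (y i = k \<and> y (nn n x i) = l))"

definition p_hat :: "nat \<Rightarrow> nat \<Rightarrow> (nat \<Rightarrow> 'h::metric_space) \<Rightarrow> (nat \<Rightarrow> nat) \<Rightarrow> nat \<Rightarrow> real" where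
  "p_hat K n x y k = (\<Sum>l=1..K. pair_freq n x y k l)"

definition q_hat :: "nat \<Rightarrow> nat \<Rightarrow> (nat \<Rightarrow> 'h::metric_space) \<Rightarrow> (nat \<Rightarrow> nat) \<Rightarrow> nat \<Rightarrow> real" where
  "q_hat K n x y l = (\<Sum>k=1..K. pair_freq n x y k l)"

definition P_vec :: "nat \<Rightarrow> nat \<Rightarrow> (nat \<Rightarrow> 'h::metric_space) \<Rightarrow> (nat \<Rightarrow> nat) \<Rightarrow> real Matrix.vec" where
  "P_vec K n x y =
     sqrt (real n) \<cdot>\<^sub>v
       vec_stack (Matrix.mat (K - 1) (K - 1) (\<lambda>(i, j).
         pair_freq n x y (i + 1) (j + 1) - p_hat K n x y (i + 1) * q_hat K n x y (j + 1)))"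

definition Sigma_mat ::
  "'w measure \<Rightarrow> nat \<Rightarrow> (nat \<Rightarrow> 'w \<Rightarrow> 'h::metric_space) \<Rightarrow> (nat \<Rightarrow> 'w \<Rightarrow> nat) \<Rightarrow> nat \<Rightarrow> 'w \<Rightarrow> real mat" where
  "Sigma_mat M K X Y n \<omega> =
     Matrix.mat ((K - 1)\<^sup>2) ((K - 1)\<^sup>2) (\<lambda>(r, s).
       cond_cov M (sigma_first M X n)
         (\<lambda>\<omega>. vec_index (P_vec K n (\<lambda>i. X i \<omega>) (\<lambda>i. Y i \<omega>)) r)
         (\<lambda>\<omega>. vec_index (P_vec K n (\<lambda>i. X i \<omega>) (\<lambda>i. Y i \<omega>)) s) \<omega>)"

definition Sigma_formula :: "(nat \<Rightarrow> real) \<Rightarrow> real \<Rightarrow> nat \<Rightarrow> nat \<Rightarrow> nat \<Rightarrow> nat \<Rightarrow> real" where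
  "Sigma_formula p W k1 l1 k2 l2 =
       p k1 * p l1 * p k2 * p l2 * (1 + W)
     - p k1 * p l1 * p l2 * (of_bool (k1 = k2) + W * of_bool (l1 = k2))
     - p k1 * p l1 * p k2 * (of_bool (l1 = l2) + W * of_bool (k1 = l2))
     + p k1 * p l1 * (of_bool (k1 = k2 \<and> l1 = l2) + W * of_bool (k1 = l2 \<and> l1 = k2))"

text \<open>Position \<open>r\<close> corresponds to the pair \<open>(r mod (K - 1) + 1, r div (K - 1) + 1)\<close>.\<close>

definition Sigma_hat :: "nat \<Rightarrow> nat \<Rightarrow> (nat \<Rightarrow> 'h::metric_space) \<Rightarrow> (nat \<Rightarrow> nat) \<Rightarrow> real mat" where
  "Sigma_hat K n x y =
     Matrix.mat ((K - 1)\<^sup>2) ((K - 1)\<^sup>2) (\<lambda>(r, s).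
       Sigma_formula (p_hat K n x y) (W_stat n x)
         (r mod (K - 1) + 1) (r div (K - 1) + 1) (s mod (K - 1) + 1) (s div (K - 1) + 1))"

lemma pair_index_inverse:
  assumes "k \<in> {1..K - 1}" "l \<in> {1..K - 1}"
  shows "pair_index K k l < (K - 1)\<^sup>2"
    and "pair_index K k l mod (K - 1) + 1 = k"
    and "pair_index K k l div (K - 1) + 1 = l"
proof -
  obtain k' where k: "k = Suc k'" "k' < K - 1"
    using assms(1) by (cases k) auto
  obtain l' where l: "l = Suc l'" "Suc l' \<le> K - 1"
    using assms(2) by (cases l) auto
  have eq: "pair_index K k l = l' * (K - 1) + k'"
    by (simp add: pair_index_def k l)
  have "Suc l' * (K - 1) \<le> (K - 1) * (K - 1)"
    using l(2) by (rule mult_le_mono1)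
  then show "pair_index K k l < (K - 1)\<^sup>2"
    using k(2) unfolding eq power2_eq_square mult_Suc by linarith
  show "pair_index K k l mod (K - 1) + 1 = k"
    unfolding eq using k by simp
  show "pair_index K k l div (K - 1) + 1 = l"
    unfolding eq using k l by simp
qed

lemma P_vec_index:
  assumes "k \<in> {1..K - 1}" "l \<in> {1..K - 1}"
  shows "vec_index (P_vec K n x y) (pair_index K k l) =
           sqrt (real n) * (pair_freq n x y k l - p_hat K n x y k * q_hat K n x y l)"
proof -
  have lt: "pair_index K k l mod (K - 1) < K - 1" "pair_index K k l div (K - 1) < K - 1"
    using pair_index_inverse(2,3)[OF assms] assms by auto
  show ?thesis
    using pair_index_inverse[OF assms] lt
    by (simp add: P_vec_def vec_stack_def power2_eq_square)
qed

end

theory Submission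
  imports Defs "Jordan_Normal_Form.Determinant"
begin

text \<open>
  Since \<open>X\<close> and \<open>Y\<close> are independent, \<open>Q k = p k\<close> almost everywhere, so the labels \<open>Ys i\<close> are almost
  surely functions of the \<open>Us i\<close> alone: i.i.d. with law \<open>p\<close> and independent of the nearest neighbour
  graph \<open>N\<close>. Conditionally on the graph, with \<open>a k\<close> the centred indicator of level \<open>k\<close>,
  \<open>P n = S - R\<close> where \<open>S k l\<close> is the sum of the \<open>a k (Y i) * a l (Y (N i))\<close> divided by \<open>sqrt n\<close>, and
  \<open>R\<close> is the product of two centred averages. The covariance matrix of \<open>S\<close> is exactly
  \<open>Sigma_formula p W\<close>, and \<open>R\<close> is negligible in mean square because in a separable space two
  observations rarely share their nearest neighbour.

  The covariance form is diagonalised explicitly, by tensors of a Helmert basis symmetrised with weights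
  \<open>1 / sqrt (1 + W)\<close> and \<open>1 / sqrt (1 - W)\<close>; this turns \<open>S\<close> into a vector \<open>Z\<close> with identity covariance.
  Stein's method on the graph shows that the characteristic functions of the linear combinations of \<open>Z\<close>
  are close to the Gaussian ones when the degrees are \<open>o(n\<^sup>1\<^sup>/\<^sup>4)\<close>. Averaging over a Gaussian
  direction gives the Laplace transform of \<open>\<bar>Z\<bar>\<^sup>2\<close>, hence the chi-squared limit, which passes to
  the two quadratic forms by perturbation of the inverse matrix.
\<close>

section \<open>Averages over independent labels\<close>

text \<open>The proportion \<open>W_stat\<close> is random and is not assumed to converge, so
  \<open>P_vec\<close> need not have a limiting law; only its normalised length does. Everything is
  therefore estimated on a fixed graph, with bounds that see it only through the proportion of
  mutual edges, the largest in-degree and the number of shared neighbours, and is averaged over the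
  graph at the end. The explicit square root keeps these bounds uniform: its entries are controlled
  by \<open>b\<close> and \<open>p\<close>, since \<open>1 - W\<close> is the only eigenvalue that
  can degenerate. The exponent 1/4 comes from the Stein error, of order
  \<open>D\<^sup>2 / sqrt n\<close> for stars of at most \<open>D\<close> edges. Only the scalar
  \<open>\<bar>Z\<bar>\<^sup>2\<close> has to converge, so a Gaussian average of one-dimensional
  characteristic functions replaces a multivariate limit theorem. In a general separable space
  in-degrees may be unbounded; that \<open>R\<close> is negligible is deduced from the mean number
  of pairs with a common neighbour, which a finite cover by small balls controls. Labels take
  finitely many values, so conditional expectations given the observations are finite weighted
  sums.\<close>

locale finite_law =
  fixes K :: nat and p :: "nat \<Rightarrow> real"
  assumes p_nonneg: "k \<in> {1..K} \<Longrightarrow> 0 \<le> p k"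
    and sum_p: "(\<Sum>k=1..K. p k) = 1"
begin

text \<open>The functions are extensional, so an assignment of levels to \<open>V\<close> is
  represented exactly once and the set is finite for finite \<open>V\<close>.\<close>

definition labellings :: "nat set \<Rightarrow> (nat \<Rightarrow> nat) set" where
  "labellings V = PiE V (\<lambda>_. {1..K})"

definition wt :: "nat set \<Rightarrow> (nat \<Rightarrow> nat) \<Rightarrow> real" where
  "wt V y = (\<Prod>i\<in>V. p (y i))"

text \<open>The expectation under i.i.d. labels of law \<open>p\<close>, as a finite sum. The value
  type is any real normed field because real moments and complex characteristic functions are both
  averaged.\<close>

definition Ex :: "nat set \<Rightarrow> ((nat \<Rightarrow> nat) \<Rightarrow> 'a::real_normed_field) \<Rightarrow> 'a" where
  "Ex V f = (\<Sum>y\<in>labellings V. wt V y *\<^sub>R f y)"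

lemma finite_labellings: "finite V \<Longrightarrow> finite (labellings V)"
  by (simp add: labellings_def finite_PiE)

lemma labellings_range: "y \<in> labellings V \<Longrightarrow> i \<in> V \<Longrightarrow> y i \<in> {1..K}"
  by (auto simp: labellings_def PiE_iff)

lemma wt_nonneg: "y \<in> labellings V \<Longrightarrow> 0 \<le> wt V y"
  unfolding wt_def by (intro prod_nonneg ballI p_nonneg) (auto dest: labellings_range)

lemma sum_wt: "finite V \<Longrightarrow> (\<Sum>y\<in>labellings V. wt V y) = 1"
  unfolding labellings_def wt_def by (subst prod_sum_PiE[symmetric]) (simp_all only: sum_p finite_atLeastAtMost prod.neutral_const)

lemma Ex_const [simp]: "finite V \<Longrightarrow> Ex V (\<lambda>_. c) = c"
  by (simp add: Ex_def scaleR_left.sum[symmetric] sum_wt)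

lemma Ex_cong: "(\<And>y. y \<in> labellings V \<Longrightarrow> f y = g y) \<Longrightarrow> Ex V f = Ex V g"
  unfolding Ex_def by (rule sum.cong) auto

lemma Ex_add: "Ex V (\<lambda>y. f y + g y) = Ex V f + Ex V g"
  by (simp add: Ex_def scaleR_add_right sum.distrib)

lemma Ex_diff: "Ex V (\<lambda>y. f y - g y) = Ex V f - Ex V g"
  by (simp add: Ex_def scaleR_diff_right sum_subtractf)

lemma Ex_mult_left: "Ex V (\<lambda>y. c * f y) = c * Ex V f"
  by (simp add: Ex_def sum_distrib_left)

lemma Ex_mult_right: "Ex V (\<lambda>y. f y * c) = Ex V f * c"
  by (simp add: Ex_def sum_distrib_right)

lemma Ex_sum: "Ex V (\<lambda>y. \<Sum>i\<in>I. f i y) = (\<Sum>i\<in>I. Ex V (f i))"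
  unfolding Ex_def scaleR_sum_right by (rule sum.swap)

lemma Ex_norm_le:
  fixes f :: "(nat \<Rightarrow> nat) \<Rightarrow> 'a::real_normed_field"
  assumes "\<And>y. y \<in> labellings V \<Longrightarrow> norm (f y) \<le> g y"
  shows "norm (Ex V f) \<le> Ex V g"
proof -
  have "norm (Ex V f) \<le> (\<Sum>y\<in>labellings V. norm (wt V y *\<^sub>R f y))"
    unfolding Ex_def by (rule norm_sum)
  also have "\<dots> \<le> Ex V g"
    unfolding Ex_def using assms by (intro sum_mono) (simp add: wt_nonneg mult_left_mono)
  finally show ?thesis .
qed

lemma Ex_mono:
  fixes f :: "(nat \<Rightarrow> nat) \<Rightarrow> real"
  assumes "\<And>y. y \<in> labellings V \<Longrightarrow> f y \<le> g y"
  shows "Ex V f \<le> Ex V g"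
  unfolding Ex_def using assms by (intro sum_mono) (simp add: wt_nonneg mult_left_mono)

lemma Ex_nonneg:
  fixes f :: "(nat \<Rightarrow> nat) \<Rightarrow> real"
  assumes "\<And>y. y \<in> labellings V \<Longrightarrow> 0 \<le> f y"
  shows "0 \<le> Ex V f"
  unfolding Ex_def using assms by (intro sum_nonneg) (simp add: wt_nonneg)

lemma Ex_norm_le_const:
  fixes f :: "(nat \<Rightarrow> nat) \<Rightarrow> 'a::real_normed_field"
  assumes "finite V" "\<And>y. y \<in> labellings V \<Longrightarrow> norm (f y) \<le> c"
  shows "norm (Ex V f) \<le> c"
  using Ex_norm_le[of V f "\<lambda>_. c"] assms by simp

lemma Ex_of_real: "Ex V (\<lambda>y. of_real (f y)) = of_real (Ex V f)"
  by (simp add: Ex_def scaleR_conv_of_real)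

text \<open>A labelling of a disjoint union is the same as the pair of its restrictions, and
  \<open>wt\<close> factors accordingly.\<close>

lemma Ex_Fubini:
  assumes fin: "finite S" "finite T" and disj: "S \<inter> T = {}"
  shows "Ex (S \<union> T) f = Ex S (\<lambda>y. Ex T (\<lambda>z. f (\<lambda>i. if i \<in> S then y i else z i)))"
proof -
  let ?m = "\<lambda>(y, z) i. if i \<in> S then y i else z i :: nat"
  have bij: "bij_betw ?m (labellings S \<times> labellings T) (labellings (S \<union> T))"
  proof (rule bij_betw_byWitness[where f' = "\<lambda>y. (restrict y S, restrict y T)"])
    show "\<forall>a\<in>labellings S \<times> labellings T. (restrict (?m a) S, restrict (?m a) T) = a"
      using disj by (auto simp: labellings_def PiE_iff extensional_def fun_eq_iff)
    show "\<forall>a\<in>labellings (S \<union> T). ?m (restrict a S, restrict a T) = a"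
      by (auto simp: labellings_def PiE_iff extensional_def fun_eq_iff)
    show "?m ` (labellings S \<times> labellings T) \<subseteq> labellings (S \<union> T)"
    proof (clarify)
      fix y z assume a: "y \<in> labellings S" "z \<in> labellings T"
      show "(\<lambda>i. if i \<in> S then y i else z i) \<in> labellings (S \<union> T)"
        using a unfolding labellings_def PiE_iff extensional_def by auto
    qed
    show "(\<lambda>y. (restrict y S, restrict y T)) ` labellings (S \<union> T) \<subseteq> labellings S \<times> labellings T"
      by (auto simp: labellings_def)
  qed
  have w: "wt (S \<union> T) (?m (y, z)) = wt S y * wt T z" for y z
  proof -
    have "wt (S \<union> T) (?m (y, z)) = (\<Prod>i\<in>S. p (?m (y, z) i)) * (\<Prod>i\<in>T. p (?m (y, z) i))"
      unfolding wt_def by (rule prod.union_disjoint) (use fin disj in auto)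
    also have "(\<Prod>i\<in>S. p (?m (y, z) i)) = wt S y"
      unfolding wt_def by (intro prod.cong) auto
    also have "(\<Prod>i\<in>T. p (?m (y, z) i)) = wt T z"
      unfolding wt_def using disj by (intro prod.cong) auto
    finally show ?thesis .
  qed
  have "Ex (S \<union> T) f = (\<Sum>a\<in>labellings S \<times> labellings T. wt (S \<union> T) (?m a) *\<^sub>R f (?m a))"
    unfolding Ex_def by (rule sum.reindex_bij_betw[OF bij, symmetric])
  also have "\<dots> = (\<Sum>(y, z)\<in>labellings S \<times> labellings T.
      wt S y *\<^sub>R wt T z *\<^sub>R f (\<lambda>i. if i \<in> S then y i else z i))"
    using w by (intro sum.cong) (auto)
  also have "\<dots> = (\<Sum>y\<in>labellings S. \<Sum>z\<in>labellings T.
      wt S y *\<^sub>R wt T z *\<^sub>R f (\<lambda>i. if i \<in> S then y i else z i))"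
    by (rule sum.cartesian_product[symmetric])
  finally show ?thesis
    by (simp add: Ex_def scaleR_sum_right)
qed

text \<open>Takes the place of measurability with respect to the labels in \<open>S\<close>. It
  quantifies over all functions, not only labellings, so it makes no reference to \<open>V\<close>
  and \<open>S\<close> may be an infinite complement such as \<open>- {i}\<close>.\<close>

definition depends_on :: "nat set \<Rightarrow> ((nat \<Rightarrow> nat) \<Rightarrow> 'b) \<Rightarrow> bool" where
  "depends_on S f \<longleftrightarrow> (\<forall>y z. (\<forall>i\<in>S. y i = z i) \<longrightarrow> f y = f z)"

lemma depends_onI:
  assumes "\<And>y z. (\<And>i. i \<in> S \<Longrightarrow> y i = z i) \<Longrightarrow> f y = f z"
  shows "depends_on S f"
  unfolding depends_on_def by (intro allI impI assms) blast

lemma depends_onD: "depends_on S f \<Longrightarrow> (\<And>i. i \<in> S \<Longrightarrow> y i = z i) \<Longrightarrow> f y = f z"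
  unfolding depends_on_def by blast

lemma depends_on_comp: "depends_on S f \<Longrightarrow> depends_on S (\<lambda>y. h (f y))"
  by (rule depends_onI, rule arg_cong[where f = h], rule depends_onD)

lemma depends_on_apply: "i \<in> S \<Longrightarrow> depends_on S (\<lambda>y. h (y i))"
  by (auto simp: depends_on_def)

lemma depends_on_apply2: "i \<in> S \<Longrightarrow> j \<in> S \<Longrightarrow> depends_on S (\<lambda>y. h (y i) (y j))"
  by (auto simp: depends_on_def)

lemma depends_on_mult: "depends_on S f \<Longrightarrow> depends_on S g \<Longrightarrow> depends_on S (\<lambda>y. f y * g y)"
  unfolding depends_on_def by metis

lemma depends_on_sum: "(\<And>i. i \<in> I \<Longrightarrow> depends_on S (f i)) \<Longrightarrow> depends_on S (\<lambda>y. \<Sum>i\<in>I. f i y)"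
  unfolding depends_on_def by (intro allI impI sum.cong refl) blast

lemma Ex_indep:
  assumes fin: "finite V" and disj: "S \<inter> T = {}"
    and f: "depends_on S f" and g: "depends_on T g"
  shows "Ex V (\<lambda>y. f y * g y) = Ex V f * Ex V g"
proof -
  have V: "V = (V \<inter> S) \<union> (V - S)" by auto
  note F = Ex_Fubini[of "V \<inter> S" "V - S", folded V]
  have "Ex V h = Ex (V \<inter> S) (\<lambda>y. Ex (V - S) (\<lambda>z. h (\<lambda>i. if i \<in> V \<inter> S then y i else z i)))"
    for h :: "(nat \<Rightarrow> nat) \<Rightarrow> 'a"
    using fin by (subst F) auto
  note F = this
  \<comment> \<open>\<open>S\<close> may reach outside \<open>V\<close>; there every
    \<open>z\<close> has the value \<open>undefined\<close>, so \<open>f\<close> sees nothing of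
    \<open>z\<close> and becomes a function \<open>f'\<close> of the first block.\<close>
  have out: "z i = undefined" if "z \<in> labellings (V - S)" "i \<in> S" for z i
    using that by (auto simp: labellings_def PiE_iff extensional_def)
  define f' where "f' y = f (\<lambda>i. if i \<in> V \<inter> S then y i else undefined)" for y
  define g' where "g' z = g z" for z
  have f': "f (\<lambda>i. if i \<in> V \<inter> S then y i else z i) = f' y" if "z \<in> labellings (V - S)" for y z
    unfolding f'_def by (rule depends_onD[OF f]) (use out that in auto)
  have g': "g (\<lambda>i. if i \<in> V \<inter> S then y i else z i) = g' z" for y z
    unfolding g'_def by (rule depends_onD[OF g]) (use disj in auto)
  have "Ex V (\<lambda>y. f y * g y) = Ex (V \<inter> S) (\<lambda>y. Ex (V - S) (\<lambda>z. f' y * g' z))"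
    by (subst F, intro Ex_cong) (simp only: f' g')
  also have "\<dots> = Ex (V \<inter> S) f' * Ex (V - S) g'"
    by (simp add: Ex_mult_left Ex_mult_right)
  also have "Ex (V \<inter> S) f' = Ex (V \<inter> S) (\<lambda>y. Ex (V - S) (\<lambda>z. f' y))"
    using fin by simp
  also have "\<dots> = Ex V f"
    by (subst F, intro Ex_cong) (simp only: f')
  also have "Ex (V - S) g' = Ex (V \<inter> S) (\<lambda>y. Ex (V - S) (\<lambda>z. g' z))"
    using fin by simp
  also have "\<dots> = Ex V g"
    by (subst F, intro Ex_cong) (simp only: g')
  finally show ?thesis .
qed

lemma Ex_single:
  fixes h :: "nat \<Rightarrow> 'a::real_normed_field"
  assumes "finite V" "i \<in> V"
  shows "Ex V (\<lambda>y. h (y i)) = (\<Sum>k=1..K. p k *\<^sub>R h k)"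
proof -
  have V: "V = {i} \<union> (V - {i})" using assms by auto
  have "Ex V (\<lambda>y. h (y i)) = Ex {i} (\<lambda>y. h (y i))"
    by (subst V, subst Ex_Fubini) (use assms in auto)
  also have "\<dots> = (\<Sum>y\<in>labellings {i}. p (y i) *\<^sub>R h (y i))"
    by (simp add: Ex_def wt_def)
  also have "\<dots> = (\<Sum>k=1..K. p k *\<^sub>R h k)"
    by (rule sum.reindex_bij_witness[of _ "\<lambda>k. \<lambda>j\<in>{i}. k" "\<lambda>y. y i"])
       (auto simp: labellings_def PiE_iff extensional_def fun_eq_iff)
  finally show ?thesis .
qed

text \<open>Fixing the value \<open>b\<close> of the second label leaves the centred function
  \<open>\<lambda>a. \<phi> a b\<close> of the label of \<open>i\<close> alone. The remaining factor
  does not involve that label because \<open>j \<noteq> i\<close>, and independence produces a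
  vanishing factor.\<close>

lemma Ex_centred:
  assumes fin: "finite V" and i: "i \<in> V" and j: "j \<noteq> i" "j \<in> V"
    and g: "depends_on (- {i}) (g :: (nat \<Rightarrow> nat) \<Rightarrow> 'a::real_normed_field)"
    and cent: "\<And>b. b \<in> {1..K} \<Longrightarrow> (\<Sum>a=1..K. p a *\<^sub>R \<phi> a b) = 0"
  shows "Ex V (\<lambda>y. \<phi> (y i) (y j) * g y) = 0"
proof -
  have "Ex V (\<lambda>y. \<phi> (y i) (y j) * g y)
      = Ex V (\<lambda>y. \<Sum>b=1..K. \<phi> (y i) b * (of_bool (y j = b) * g y))"
  proof (intro Ex_cong)
    fix y assume "y \<in> labellings V"
    then have "y j \<in> {1..K}" using j by (auto dest: labellings_range)
    then have "(\<Sum>b=1..K. if y j = b then \<phi> (y i) b * g y else 0) = \<phi> (y i) (y j) * g y"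
      by simp
    moreover have "\<phi> (y i) b * (of_bool (y j = b) * g y) = (if y j = b then \<phi> (y i) b * g y else 0)" for b
      by simp
    ultimately show "\<phi> (y i) (y j) * g y = (\<Sum>b=1..K. \<phi> (y i) b * (of_bool (y j = b) * g y))"
      by simp
  qed
  also have "\<dots> = (\<Sum>b=1..K. Ex V (\<lambda>y. \<phi> (y i) b * (of_bool (y j = b) * g y)))"
    by (rule Ex_sum)
  also have "\<dots> = (\<Sum>b=1..K. Ex V (\<lambda>y. \<phi> (y i) b) * Ex V (\<lambda>y. of_bool (y j = b) * g y))"
    using j by (intro sum.cong refl Ex_indep[where S = "{i}" and T = "- {i}"] fin depends_on_mult g
        depends_on_apply) auto
  also have "\<dots> = 0"
    by (intro sum.neutral ballI) (simp only: Ex_single[OF fin i, of "\<lambda>a. \<phi> a _"] cent mult_zero_left)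
  finally show ?thesis .
qed

lemma Ex_centred1:
  assumes fin: "finite V" and i: "i \<in> V"
    and g: "depends_on (- {i}) (g :: (nat \<Rightarrow> nat) \<Rightarrow> 'a::real_normed_field)"
    and cent: "(\<Sum>a=1..K. p a *\<^sub>R h a) = 0"
  shows "Ex V (\<lambda>y. h (y i) * g y) = 0"
proof -
  have "Ex V (\<lambda>y. h (y i) * g y) = Ex V (\<lambda>y. h (y i)) * Ex V g"
    by (intro Ex_indep[where S = "{i}" and T = "- {i}"] fin g depends_on_apply) auto
  then show ?thesis
    by (simp only: Ex_single[OF fin i] cent mult_zero_left)
qed

end

section \<open>Quadratic label statistics of a digraph\<close>

lemma cis_minus_one_bound: "cmod (cis x - 1) \<le> \<bar>x\<bar>"
  using iexp_approx1[of x 0] by (simp add: cis_conv_exp)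

lemma cis_diff_bound: "cmod (cis a - cis b) \<le> \<bar>a - b\<bar>"
proof -
  have "cis a - cis b = cis b * (cis (a - b) - 1)"
    by (simp add: algebra_simps cis_mult)
  then show ?thesis
    using cis_minus_one_bound[of "a - b"] by (simp add: norm_mult)
qed

lemma cis_second_order_bound: "cmod (cis x - 1 - \<i> * x) \<le> x\<^sup>2 / 2"
  using iexp_approx1[of x 1] by (simp add: cis_conv_exp power2_eq_square algebra_simps)

text \<open>Expanding around the full sum \<open>T\<close>, not around \<open>T - \<eta>\<close>,
  leaves \<open>cis (t * T)\<close> in the linear term; from this factor the characteristic function
  itself is recovered.\<close>

lemma cis_Taylor_bound:
  "cmod (cis (t * T) - cis (t * (T - \<eta>)) - \<i> * t * (\<eta> * cis (t * T))) \<le> (t * \<eta>)\<^sup>2 / 2"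
proof -
  have *: "cis (t * (T - \<eta>)) = cis (t * T) * cis (- (t * \<eta>))"
    by (simp add: cis_mult algebra_simps)
  have "cis (t * T) - cis (t * (T - \<eta>)) - \<i> * t * (\<eta> * cis (t * T))
      = - cis (t * T) * (cis (- (t * \<eta>)) - 1 - \<i> * of_real (- (t * \<eta>)))"
    unfolding * by (simp add: algebra_simps)
  then have "cmod (cis (t * T) - cis (t * (T - \<eta>)) - \<i> * t * (\<eta> * cis (t * T)))
      = cmod (cis (- (t * \<eta>)) - 1 - \<i> * of_real (- (t * \<eta>)))"
    by (simp add: norm_mult)
  also have "\<dots> \<le> (- (t * \<eta>))\<^sup>2 / 2"
    by (rule cis_second_order_bound)
  finally show ?thesis by simp
qed

lemma has_vector_derivative_cis_mult:
  "((\<lambda>t. cis (t * a)) has_vector_derivative (\<i> * a * cis (t * a))) (at t within A)"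
proof -
  have "((\<lambda>z. exp (\<i> * (z * of_real a))) has_field_derivative (\<i> * a * exp (\<i> * (of_real t * of_real a)))) (at (of_real t))"
    by (auto intro!: derivative_eq_intros)
  from has_vector_derivative_real_field[OF this, of A] show ?thesis
    unfolding cis_conv_exp by simp
qed

section \<open>Degenerate kernels and their covariance on a fixed graph\<close>

lemma (in finite_law) Ex_two:
  fixes \<phi> :: "nat \<Rightarrow> nat \<Rightarrow> real"
  assumes "finite V" "i \<in> V" "j \<in> V" "i \<noteq> j"
  shows "Ex V (\<lambda>y. \<phi> (y i) (y j)) = (\<Sum>a=1..K. \<Sum>b=1..K. p a * p b * \<phi> a b)"
proof -
  have "Ex V (\<lambda>y. \<phi> (y i) (y j)) = Ex V (\<lambda>y. \<Sum>b=1..K. \<phi> (y i) b * of_bool (y j = b))"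
  proof (intro Ex_cong)
    fix y assume "y \<in> labellings V"
    then have "y j \<in> {1..K}" using assms by (auto dest: labellings_range)
    then have "(\<Sum>b=1..K. if y j = b then \<phi> (y i) b else 0) = \<phi> (y i) (y j)"
      by simp
    moreover have "\<phi> (y i) b * of_bool (y j = b) = (if y j = b then \<phi> (y i) b else 0)" for b
      by simp
    ultimately show "\<phi> (y i) (y j) = (\<Sum>b=1..K. \<phi> (y i) b * of_bool (y j = b))"
      by simp
  qed
  also have "\<dots> = (\<Sum>b=1..K. Ex V (\<lambda>y. \<phi> (y i) b) * Ex V (\<lambda>y. of_bool (y j = b)))"
    unfolding Ex_sum
    by (intro sum.cong refl Ex_indep[where S = "{i}" and T = "{j}"] assms(1) depends_on_apply)
      (use assms in auto)
  also have "\<dots> = (\<Sum>b=1..K. (\<Sum>a=1..K. p a * \<phi> a b) * p b)"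
  proof (intro sum.cong refl)
    fix b assume b: "b \<in> {1..K}"
    have "Ex V (\<lambda>y. of_bool (y j = b)) = (\<Sum>k=1..K. if k = b then p k else 0)"
      unfolding Ex_single[OF assms(1,3), of "\<lambda>k. of_bool (k = b)"] by (intro sum.cong) auto
    then have "Ex V (\<lambda>y. of_bool (y j = b)) = p b" using b by simp
    then show "Ex V (\<lambda>y. \<phi> (y i) b) * Ex V (\<lambda>y. of_bool (y j = b)) = (\<Sum>a=1..K. p a * \<phi> a b) * p b"
      using Ex_single[OF assms(1,2), of "\<lambda>a. \<phi> a b"] by simp
  qed
  also have "\<dots> = (\<Sum>a=1..K. \<Sum>b=1..K. p a * p b * \<phi> a b)"
    unfolding sum_distrib_right by (subst sum.swap) (simp add: mult_ac)
  finally show ?thesis .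
qed

text \<open>Both one-label conditional means vanish, as for a degenerate kernel of a U-statistic.
  This makes edges uncorrelated unless they join the same two vertices.\<close>

definition (in finite_law) degenerate :: "(nat \<Rightarrow> nat \<Rightarrow> real) \<Rightarrow> bool" where
  "degenerate \<phi> \<longleftrightarrow> (\<forall>b\<in>{1..K}. (\<Sum>a=1..K. p a * \<phi> a b) = 0) \<and> (\<forall>a\<in>{1..K}. (\<Sum>b=1..K. p b * \<phi> a b) = 0)"

text \<open>The covariance of two edge sums with degenerate kernels on a graph in which a proportion
  \<open>w\<close> of the edges is reciprocated; the transposed term comes from those edges.\<close>

definition (in finite_law) form :: "real \<Rightarrow> (nat \<Rightarrow> nat \<Rightarrow> real) \<Rightarrow> (nat \<Rightarrow> nat \<Rightarrow> real) \<Rightarrow> real" where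
  "form w \<phi> \<theta> = (\<Sum>a=1..K. \<Sum>b=1..K. p a * p b * (\<phi> a b * (\<theta> a b + w * \<theta> b a)))"

locale label_graph = finite_law +
  fixes n :: nat and N :: "nat \<Rightarrow> nat"
  assumes n_pos: "0 < n"
    and N_in: "i \<in> {1..n} \<Longrightarrow> N i \<in> {1..n}"
    and N_ne: "i \<in> {1..n} \<Longrightarrow> N i \<noteq> i"
begin

abbreviation "V \<equiv> {1..n}"

definition edge :: "(nat \<Rightarrow> nat \<Rightarrow> real) \<Rightarrow> nat \<Rightarrow> (nat \<Rightarrow> nat) \<Rightarrow> real" where
  "edge \<phi> i y = \<phi> (y i) (y (N i))"

definition edge_sum :: "(nat \<Rightarrow> nat \<Rightarrow> real) \<Rightarrow> (nat \<Rightarrow> nat) \<Rightarrow> real" where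
  "edge_sum \<phi> y = (\<Sum>i\<in>V. edge \<phi> i y) / sqrt (real n)"

definition mutual :: real where
  "mutual = 1 / real n * (\<Sum>i=1..n. of_bool (N (N i) = i))"

lemma mutual_nonneg: "0 \<le> mutual" and mutual_le_1: "mutual \<le> 1"
proof -
  show "0 \<le> mutual" by (auto simp: mutual_def intro!: sum_nonneg)
  have "(\<Sum>i=1..n. of_bool (N (N i) = i) :: real) \<le> (\<Sum>i=1..n. 1)"
    by (intro sum_mono) auto
  then show "mutual \<le> 1" using n_pos by (simp add: mutual_def field_simps)
qed

lemma depends_on_edge: "i \<in> S \<Longrightarrow> N i \<in> S \<Longrightarrow> depends_on S (edge \<phi> i)"
  unfolding edge_def by (rule depends_on_apply2)

lemma Ex_edge_source:
  fixes g :: "(nat \<Rightarrow> nat) \<Rightarrow> 'a::real_normed_field"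
  assumes "degenerate \<phi>" "i \<in> V" "depends_on (- {i}) g"
  shows "Ex V (\<lambda>y. of_real (edge \<phi> i y) * g y) = 0"
  unfolding edge_def
proof (rule Ex_centred[where \<phi> = "\<lambda>a b. of_real (\<phi> a b)"])
  fix b assume "b \<in> {1..K}"
  then have "of_real (\<Sum>a=1..K. p a * \<phi> a b) = (0 :: 'a)"
    using assms(1) unfolding degenerate_def by (metis of_real_0)
  then show "(\<Sum>a=1..K. p a *\<^sub>R of_real (\<phi> a b)) = (0 :: 'a)"
    by (simp add: scaleR_conv_of_real)
qed (use assms N_in N_ne in auto)

text \<open>If two distinct edges are not the reverse of each other, one of them has a source that
  the other does not touch, and averaging over its label gives zero. Reverse edges see the same two
  labels in opposite order, hence the transposed kernel.\<close>

lemma Ex_edge_edge: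
  assumes \<phi>: "degenerate \<phi>" and \<theta>: "degenerate \<theta>" and i: "i \<in> V" and j: "j \<in> V"
  shows "Ex V (\<lambda>y. edge \<phi> i y * edge \<theta> j y) =
    of_bool (j = i) * (\<Sum>a=1..K. \<Sum>b=1..K. p a * p b * (\<phi> a b * \<theta> a b))
    + of_bool (j = N i \<and> N (N i) = i) * (\<Sum>a=1..K. \<Sum>b=1..K. p a * p b * (\<phi> a b * \<theta> b a))"
proof (cases "j = i")
  case True
  have "Ex V (\<lambda>y. edge \<phi> i y * edge \<theta> i y) = (\<Sum>a=1..K. \<Sum>b=1..K. p a * p b * (\<phi> a b * \<theta> a b))"
    unfolding edge_def by (rule Ex_two) (use i N_in[of i] N_ne[of i] in auto)
  then show ?thesis using True N_ne[OF i] by simp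
next
  case False
  consider "N j \<noteq> i" | "N j = i" "N i \<noteq> j" | "N j = i" "N i = j" by blast
  then show ?thesis
  proof cases
    case 1
    have "Ex V (\<lambda>y. edge \<phi> i y * edge \<theta> j y) = 0"
      using Ex_edge_source[OF \<phi> i, of "edge \<theta> j"] depends_on_edge[of j "- {i}" \<theta>] False 1 by simp
    then show ?thesis using 1 False by auto
  next
    case 2
    have "Ex V (\<lambda>y. edge \<theta> j y * edge \<phi> i y) = 0"
      using Ex_edge_source[OF \<theta> j, of "edge \<phi> i"] depends_on_edge[of i "- {j}" \<phi>] False 2 by simp
    then show ?thesis using 2 False by (auto simp: mult.commute)
  next
    case 3
    have "Ex V (\<lambda>y. edge \<phi> i y * edge \<theta> j y) = Ex V (\<lambda>y. \<phi> (y i) (y j) * \<theta> (y j) (y i))"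
      unfolding edge_def using 3 by simp
    also have "\<dots> = (\<Sum>a=1..K. \<Sum>b=1..K. p a * p b * (\<phi> a b * \<theta> b a))"
      by (rule Ex_two[where \<phi> = "\<lambda>a b. \<phi> a b * \<theta> b a"]) (use i j False in auto)
    finally show ?thesis using 3 False by simp
  qed
qed

text \<open>Apart from itself, an edge is correlated only with its reverse, whose source can only be
  \<open>N i\<close>. The identity is exact on every graph.\<close>

lemma Ex_edge_sum_mult:
  assumes \<phi>: "degenerate \<phi>" and \<theta>: "degenerate \<theta>"
  shows "Ex V (\<lambda>y. edge_sum \<phi> y * edge_sum \<theta> y) = form mutual \<phi> \<theta>"
proof -
  define m1 where "m1 = (\<Sum>a=1..K. \<Sum>b=1..K. p a * p b * (\<phi> a b * \<theta> a b))"
  define m2 where "m2 = (\<Sum>a=1..K. \<Sum>b=1..K. p a * p b * (\<phi> a b * \<theta> b a))"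
  have "edge_sum \<phi> y * edge_sum \<theta> y = (\<Sum>i\<in>V. \<Sum>j\<in>V. edge \<phi> i y * edge \<theta> j y) * (1 / n)" for y
    unfolding edge_sum_def by (simp add: sum_product)
  then have "Ex V (\<lambda>y. edge_sum \<phi> y * edge_sum \<theta> y)
      = (\<Sum>i\<in>V. \<Sum>j\<in>V. Ex V (\<lambda>y. edge \<phi> i y * edge \<theta> j y)) * (1 / n)"
    by (simp only: Ex_mult_right Ex_sum)
  also have "(\<Sum>i\<in>V. \<Sum>j\<in>V. Ex V (\<lambda>y. edge \<phi> i y * edge \<theta> j y))
      = (\<Sum>i\<in>V. m1 + of_bool (N (N i) = i) * m2)"
  proof (intro sum.cong refl)
    fix i assume i: "i \<in> V"
    have "(\<Sum>j\<in>V. Ex V (\<lambda>y. edge \<phi> i y * edge \<theta> j y))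
        = (\<Sum>j\<in>V. (if j = i then m1 else 0) + (if j = N i then of_bool (N (N i) = i) * m2 else 0))"
    proof (intro sum.cong refl)
      fix j assume j: "j \<in> V"
      show "Ex V (\<lambda>y. edge \<phi> i y * edge \<theta> j y)
          = (if j = i then m1 else 0) + (if j = N i then of_bool (N (N i) = i) * m2 else 0)"
        unfolding Ex_edge_edge[OF \<phi> \<theta> i j] m1_def[symmetric] m2_def[symmetric] by auto
    qed
    then show "(\<Sum>j\<in>V. Ex V (\<lambda>y. edge \<phi> i y * edge \<theta> j y)) = m1 + of_bool (N (N i) = i) * m2"
      using i N_in[OF i] by (simp add: sum.distrib)
  qed
  also have "\<dots> * (1 / n) = m1 + mutual * m2"
    using n_pos by (simp add: sum.distrib mutual_def sum_distrib_right[symmetric] field_simps)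
  also have "\<dots> = form mutual \<phi> \<theta>"
    by (simp add: m1_def m2_def form_def sum_distrib_left sum.distrib[symmetric] algebra_simps)
  finally show ?thesis .
qed

text \<open>An edge is named by its source, so these are the edges whose contribution involves the
  label of \<open>i\<close>.\<close>

definition star :: "nat \<Rightarrow> nat set" where
  "star i = {j \<in> V. j = i \<or> N j = i}"

end

section \<open>Normal approximation for a single degenerate kernel\<close>

locale normal_approx = label_graph +
  fixes \<phi> :: "nat \<Rightarrow> nat \<Rightarrow> real" and B :: real and D :: nat
  assumes deg: "degenerate \<phi>"
    and bound: "a \<in> {1..K} \<Longrightarrow> b \<in> {1..K} \<Longrightarrow> \<bar>\<phi> a b\<bar> \<le> B"
    and star_card: "i \<in> V \<Longrightarrow> card (star i) \<le> D"
begin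

definition "c = B / sqrt n"
definition "x i y = edge \<phi> i y / sqrt n"
definition "T y = (\<Sum>i\<in>V. x i y)"
definition "\<eta> i y = (\<Sum>j\<in>star i. x j y)"
definition "\<psi> t = Ex V (\<lambda>y. cis (t * T y))"

text \<open>
  Stein's method for the characteristic function \<open>\<psi>\<close>: the summands outside \<open>star i\<close> do not involve
  the label of \<open>i\<close>, over which \<open>x i\<close> averages to zero, so \<open>\<psi>' t = - t * Var T * \<psi> t\<close> up to a
  small error. The covariance term \<open>x i * x j\<close> is decoupled from \<open>cis (t * T)\<close> by deleting the at most
  \<open>3 * D\<close> summands that touch \<open>i\<close>, \<open>j\<close> or \<open>N i\<close>.
\<close>

lemma T_eq: "T y = edge_sum \<phi> y"
  by (simp add: T_def x_def edge_sum_def sum_divide_distrib)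

lemma x_bound: "y \<in> labellings V \<Longrightarrow> i \<in> V \<Longrightarrow> \<bar>x i y\<bar> \<le> c"
  using bound[of "y i" "y (N i)"] labellings_range[of y V] N_in[of i]
  by (simp add: x_def c_def edge_def divide_right_mono)

lemma B_nonneg: "0 \<le> B"
proof -
  have "K \<noteq> 0" using sum_p by (cases "K = 0") auto
  then show ?thesis using bound[of 1 1] by (auto intro: order_trans[OF abs_ge_zero])
qed

lemma c_nonneg: "0 \<le> c"
  using B_nonneg by (simp add: c_def)

lemma depends_on_x: "i \<in> S \<Longrightarrow> N i \<in> S \<Longrightarrow> depends_on S (x i)"
  unfolding x_def by (rule depends_on_comp[OF depends_on_edge])

lemma sum_x_bound:
  assumes "y \<in> labellings V" "A \<subseteq> V" "card A \<le> m"
  shows "\<bar>\<Sum>i\<in>A. x i y\<bar> \<le> real m * c"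
proof -
  have "\<bar>\<Sum>i\<in>A. x i y\<bar> \<le> (\<Sum>i\<in>A. c)"
    using assms by (intro order_trans[OF sum_abs] sum_mono x_bound) auto
  also have "\<dots> \<le> real m * c"
    using assms c_nonneg by (simp add: mult_right_mono)
  finally show ?thesis .
qed

lemma star_subset: "star i \<subseteq> V"
  by (auto simp: star_def)

lemma \<eta>_bound: "y \<in> labellings V \<Longrightarrow> i \<in> V \<Longrightarrow> \<bar>\<eta> i y\<bar> \<le> real D * c"
  unfolding \<eta>_def by (intro sum_x_bound star_subset star_card)

lemma T_minus: "A \<subseteq> V \<Longrightarrow> T y - (\<Sum>j\<in>A. x j y) = (\<Sum>j\<in>V - A. x j y)"
  unfolding T_def by (subst sum_diff) auto

lemma Ex_x_remote: "i \<in> V \<Longrightarrow> Ex V (\<lambda>y. of_real (x i y) * cis (t * (T y - \<eta> i y))) = 0"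
proof -
  assume i: "i \<in> V"
  have "depends_on (- {i}) (\<lambda>y. \<Sum>j\<in>V - star i. x j y)"
    by (intro depends_on_sum depends_on_x) (auto simp: star_def)
  then have "depends_on (- {i}) (\<lambda>y. T y - \<eta> i y)"
    unfolding \<eta>_def T_minus[OF star_subset] .
  then have d: "depends_on (- {i}) (\<lambda>y. cis (t * (T y - \<eta> i y)) / of_real (sqrt n))"
    by (rule depends_on_comp)
  show ?thesis
    using Ex_edge_source[OF deg i d] by (simp add: x_def)
qed

lemma Ex_local_product:
  assumes i: "i \<in> V" and j: "j \<in> star i" and t: "0 \<le> t"
  shows "cmod (Ex V (\<lambda>y. of_real (x i y * x j y) * cis (t * T y)) - of_real (Ex V (\<lambda>y. x i y * x j y)) * \<psi> t)
    \<le> 6 * real D * c ^ 3 * t"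
proof -
  \<comment> \<open>\<open>N j\<close> is absent because \<open>j \<in> star i\<close> makes it
    equal to \<open>N i\<close> or to \<open>i\<close>.\<close>
  define S where "S = {i, j, N i}"
  define A where "A = {m \<in> V. m \<in> S \<or> N m \<in> S}"
  have jV: "j \<in> V" using j by (auto simp: star_def)
  have SV: "S \<subseteq> V" using i jV N_in by (auto simp: S_def)
  have AV: "A \<subseteq> V" by (auto simp: A_def)
  have "A = (\<Union>s\<in>S. star s)"
    using SV by (auto simp: A_def star_def)
  then have "card A \<le> (\<Sum>s\<in>S. card (star s))"
    using card_UN_le[of S star] by (simp add: S_def)
  also have "\<dots> \<le> (\<Sum>s\<in>S. D)"
    using SV by (intro sum_mono star_card) auto
  also have "\<dots> \<le> 3 * D"
    using card_insert_le_m1[of 3 "{j, N i}" i] card_insert_le_m1[of 2 "{N i}" j] by (simp add: S_def)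
  finally have cA: "card A \<le> 3 * D" .
  define R where "R y = T y - (\<Sum>m\<in>A. x m y)" for y
  have R: "\<bar>T y - R y\<bar> \<le> 3 * real D * c" if "y \<in> labellings V" for y
    using sum_x_bound[OF that AV cA] by (simp add: R_def)
  have dR: "depends_on (- S) (\<lambda>y. cis (t * R y))"
    unfolding R_def T_minus[OF AV]
    by (intro depends_on_comp[where h = "\<lambda>r. cis (t * r)"] depends_on_sum depends_on_x) (auto simp: A_def)
  have dxx: "depends_on S (\<lambda>y. of_real (x i y * x j y) :: complex)"
    by (intro depends_on_comp[where h = of_real] depends_on_mult depends_on_x)
      (use j in \<open>auto simp: S_def star_def\<close>)
  have ind: "Ex V (\<lambda>y. of_real (x i y * x j y) * cis (t * R y))
      = of_real (Ex V (\<lambda>y. x i y * x j y)) * Ex V (\<lambda>y. cis (t * R y))"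
    using Ex_indep[OF _ _ dxx dR, of V] unfolding Ex_of_real by auto
  have cR: "cmod (cis (t * T y) - cis (t * R y)) \<le> 3 * real D * c * t" if "y \<in> labellings V" for y
  proof -
    have "cmod (cis (t * T y) - cis (t * R y)) \<le> \<bar>t * T y - t * R y\<bar>"
      by (rule cis_diff_bound)
    also have "\<dots> = t * \<bar>T y - R y\<bar>"
      using t by (simp add: abs_mult right_diff_distrib[symmetric])
    also have "\<dots> \<le> t * (3 * real D * c)"
      by (rule mult_left_mono[OF R[OF that] t])
    finally show ?thesis by (simp add: mult_ac)
  qed
  have xx: "\<bar>x i y * x j y\<bar> \<le> c\<^sup>2" if "y \<in> labellings V" for y
    using mult_mono[OF x_bound[OF that i] x_bound[OF that jV]] c_nonneg
    by (simp add: abs_mult power2_eq_square)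
  have c3: "c ^ 3 = c\<^sup>2 * c" by (simp add: power3_eq_cube power2_eq_square)
  \<comment> \<open>Replacing \<open>T\<close> by \<open>R\<close> is paid for twice, once inside
    the joint average and once after factorisation, on the way back to \<open>\<psi> t\<close>;
    hence 6 as two times 3.\<close>
  have 1: "cmod (Ex V (\<lambda>y. of_real (x i y * x j y) * cis (t * T y))
        - Ex V (\<lambda>y. of_real (x i y * x j y) * cis (t * R y))) \<le> c\<^sup>2 * (3 * real D * c * t)"
    unfolding Ex_diff[symmetric] right_diff_distrib[symmetric]
    by (rule Ex_norm_le_const) (auto simp: norm_mult abs_mult[symmetric] xx cR intro!: mult_mono)
  have 2: "cmod (of_real (Ex V (\<lambda>y. x i y * x j y)) * (Ex V (\<lambda>y. cis (t * R y)) - \<psi> t))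
      \<le> c\<^sup>2 * (3 * real D * c * t)"
    unfolding norm_mult
  proof (intro mult_mono)
    show "cmod (of_real (Ex V (\<lambda>y. x i y * x j y))) \<le> c\<^sup>2"
      using Ex_norm_le_const[of V "\<lambda>y. x i y * x j y" "c\<^sup>2"] xx by simp
    show "cmod (Ex V (\<lambda>y. cis (t * R y)) - \<psi> t) \<le> 3 * real D * c * t"
      unfolding \<psi>_def Ex_diff[symmetric]
      by (rule Ex_norm_le_const) (auto simp: norm_minus_commute[of "cis (t * R _)"] cR)
  qed auto
  have "cmod (Ex V (\<lambda>y. of_real (x i y * x j y) * cis (t * T y)) - of_real (Ex V (\<lambda>y. x i y * x j y)) * \<psi> t)
    \<le> c\<^sup>2 * (3 * real D * c * t) + c\<^sup>2 * (3 * real D * c * t)"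
    using norm_triangle_mono[OF 1 2] unfolding ind by (simp add: right_diff_distrib)
  then show ?thesis by (simp add: c3 algebra_simps)
qed

text \<open>Pairs outside the stars are uncorrelated: a reverse of the edge from \<open>i\<close>
  points back to \<open>i\<close> and so already belongs to \<open>star i\<close>.\<close>

lemma variance: "(\<Sum>i\<in>V. \<Sum>j\<in>star i. Ex V (\<lambda>y. x i y * x j y)) = Ex V (\<lambda>y. (T y)\<^sup>2)"
proof -
  have z: "Ex V (\<lambda>y. x i y * x j y) = 0" if "i \<in> V" "j \<in> V - star i" for i j
  proof -
    have "Ex V (\<lambda>y. x i y * x j y) = Ex V (\<lambda>y. edge \<phi> i y * edge \<phi> j y) * (1 / n)"
      unfolding Ex_mult_right[symmetric] by (simp add: x_def)
    then show ?thesis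
      using that Ex_edge_edge[OF deg deg, of i j] by (auto simp: star_def)
  qed
  have "Ex V (\<lambda>y. (T y)\<^sup>2) = (\<Sum>i\<in>V. \<Sum>j\<in>V. Ex V (\<lambda>y. x i y * x j y))"
    unfolding T_def power2_eq_square sum_product Ex_sum ..
  also have "\<dots> = (\<Sum>i\<in>V. \<Sum>j\<in>star i. Ex V (\<lambda>y. x i y * x j y))"
    using z star_subset by (intro sum.cong refl sum.mono_neutral_right) auto
  finally show ?thesis ..
qed

text \<open>The first average is the derivative of \<open>\<psi>\<close>, so this bounds the defect
  in the Gaussian differential equation. Each vertex contributes \<open>1/2\<close> from the Taylor
  remainder and 6 from decoupling, rounded up to 7.\<close>

lemma Stein_identity_error:
  assumes t: "0 \<le> t"
  shows "cmod (Ex V (\<lambda>y. \<i> * T y * cis (t * T y)) + t * Ex V (\<lambda>y. (T y)\<^sup>2) * \<psi> t)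
    \<le> 7 * real n * (real D)\<^sup>2 * c ^ 3 * t\<^sup>2"
proof -
  let ?v = "\<lambda>i j. Ex V (\<lambda>y. x i y * x j y)"
  have c3: "c ^ 3 = c\<^sup>2 * c" by (simp add: power3_eq_cube power2_eq_square)
  have one: "cmod (Ex V (\<lambda>y. of_real (x i y) * cis (t * T y)) - \<i> * t * (\<Sum>j\<in>star i. of_real (?v i j)) * \<psi> t)
      \<le> 7 * (real D)\<^sup>2 * c ^ 3 * t\<^sup>2" if i: "i \<in> V" for i
  proof -
    have b: "cmod (of_real (x i y) * (cis (t * T y) - cis (t * (T y - \<eta> i y)) - \<i> * t * (\<eta> i y * cis (t * T y))))
        \<le> c * ((t * (real D * c))\<^sup>2 / 2)" if y: "y \<in> labellings V" for y
    proof -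
      have "(t * \<eta> i y)\<^sup>2 \<le> (t * (real D * c))\<^sup>2"
      proof (subst power2_abs[symmetric], rule power_mono)
        show "\<bar>t * \<eta> i y\<bar> \<le> t * (real D * c)"
          using mult_left_mono[OF \<eta>_bound[OF y i] t] t by (simp add: abs_mult)
      qed simp
      then have "cmod (cis (t * T y) - cis (t * (T y - \<eta> i y)) - \<i> * t * (\<eta> i y * cis (t * T y)))
          \<le> (t * (real D * c))\<^sup>2 / 2"
        using cis_Taylor_bound[of t "T y" "\<eta> i y"] by linarith
      then show ?thesis
        unfolding norm_mult using x_bound[OF y i] by (intro mult_mono) auto
    qed
    have "Ex V (\<lambda>y. of_real (x i y) * cis (t * T y)) - \<i> * t * Ex V (\<lambda>y. of_real (x i y * \<eta> i y) * cis (t * T y))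
      = Ex V (\<lambda>y. of_real (x i y) * cis (t * T y)) - Ex V (\<lambda>y. of_real (x i y) * cis (t * (T y - \<eta> i y)))
        - Ex V (\<lambda>y. \<i> * t * (of_real (x i y * \<eta> i y) * cis (t * T y)))"
      unfolding Ex_x_remote[OF i] Ex_mult_left by simp
    also have "\<dots> = Ex V (\<lambda>y. of_real (x i y) * (cis (t * T y) - cis (t * (T y - \<eta> i y)) - \<i> * t * (\<eta> i y * cis (t * T y))))"
      unfolding Ex_diff[symmetric] by (intro Ex_cong) (simp add: algebra_simps)
    finally have 1: "cmod (Ex V (\<lambda>y. of_real (x i y) * cis (t * T y)) - \<i> * t * Ex V (\<lambda>y. of_real (x i y * \<eta> i y) * cis (t * T y)))
      \<le> c * ((t * (real D * c))\<^sup>2 / 2)"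
      using Ex_norm_le_const[OF _ b] by simp
    have "Ex V (\<lambda>y. of_real (x i y * \<eta> i y) * cis (t * T y))
        = (\<Sum>j\<in>star i. Ex V (\<lambda>y. of_real (x i y * x j y) * cis (t * T y)))"
      unfolding \<eta>_def Ex_sum[symmetric] by (simp add: sum_distrib_left sum_distrib_right)
    then have "cmod (Ex V (\<lambda>y. of_real (x i y * \<eta> i y) * cis (t * T y)) - (\<Sum>j\<in>star i. of_real (?v i j)) * \<psi> t)
        = cmod (\<Sum>j\<in>star i. Ex V (\<lambda>y. of_real (x i y * x j y) * cis (t * T y)) - of_real (?v i j) * \<psi> t)"
      by (simp add: sum_subtractf sum_distrib_right)
    also have "\<dots> \<le> (\<Sum>j\<in>star i. 6 * real D * c ^ 3 * t)"
      by (intro order_trans[OF norm_sum] sum_mono Ex_local_product i t)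
    also have "\<dots> \<le> real D * (6 * real D * c ^ 3 * t)"
      using star_card[OF i] c_nonneg t by (simp add: mult_right_mono)
    finally have 2: "cmod (Ex V (\<lambda>y. of_real (x i y * \<eta> i y) * cis (t * T y)) - (\<Sum>j\<in>star i. of_real (?v i j)) * \<psi> t)
        \<le> real D * (6 * real D * c ^ 3 * t)" .
    have 3: "cmod (\<i> * t * (Ex V (\<lambda>y. of_real (x i y * \<eta> i y) * cis (t * T y)) - (\<Sum>j\<in>star i. of_real (?v i j)) * \<psi> t))
        \<le> t * (real D * (6 * real D * c ^ 3 * t))"
      using mult_left_mono[OF 2 t] t by (simp add: norm_mult)
    have "cmod (Ex V (\<lambda>y. of_real (x i y) * cis (t * T y)) - \<i> * t * (\<Sum>j\<in>star i. of_real (?v i j)) * \<psi> t)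
      \<le> c * ((t * (real D * c))\<^sup>2 / 2) + t * (real D * (6 * real D * c ^ 3 * t))"
      using norm_triangle_mono[OF 1 3] by (simp add: right_diff_distrib mult.assoc)
    also have "\<dots> = (1/2 + 6) * ((real D)\<^sup>2 * c ^ 3 * t\<^sup>2)"
      by (simp add: c3 power2_eq_square algebra_simps)
    also have "\<dots> \<le> 7 * ((real D)\<^sup>2 * c ^ 3 * t\<^sup>2)"
      using c_nonneg by (intro mult_right_mono) auto
    finally show ?thesis by (simp add: mult_ac)
  qed
  have "Ex V (\<lambda>y. \<i> * T y * cis (t * T y)) + t * Ex V (\<lambda>y. (T y)\<^sup>2) * \<psi> t
      = \<i> * (\<Sum>i\<in>V. Ex V (\<lambda>y. of_real (x i y) * cis (t * T y)) - \<i> * t * (\<Sum>j\<in>star i. of_real (?v i j)) * \<psi> t)"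
  proof -
    have "Ex V (\<lambda>y. \<i> * T y * cis (t * T y)) = \<i> * (\<Sum>i\<in>V. Ex V (\<lambda>y. of_real (x i y) * cis (t * T y)))"
      unfolding Ex_sum[symmetric] Ex_mult_left[symmetric] T_def
      by (simp add: sum_distrib_left sum_distrib_right mult.assoc)
    moreover have "of_real (Ex V (\<lambda>y. (T y)\<^sup>2)) = (\<Sum>i\<in>V. \<Sum>j\<in>star i. (of_real (?v i j) :: complex))"
      unfolding variance[symmetric] by simp
    ultimately show ?thesis
      by (simp add: sum_subtractf sum_distrib_left[symmetric] sum_distrib_right[symmetric] algebra_simps
          flip: of_real_sum)
  qed
  then have "cmod (Ex V (\<lambda>y. \<i> * T y * cis (t * T y)) + t * Ex V (\<lambda>y. (T y)\<^sup>2) * \<psi> t)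
      = cmod (\<Sum>i\<in>V. Ex V (\<lambda>y. of_real (x i y) * cis (t * T y)) - \<i> * t * (\<Sum>j\<in>star i. of_real (?v i j)) * \<psi> t)"
    by (simp add: norm_mult)
  also have "\<dots> \<le> (\<Sum>i\<in>V. 7 * (real D)\<^sup>2 * c ^ 3 * t\<^sup>2)"
    by (intro order_trans[OF norm_sum] sum_mono one)
  finally show ?thesis by (simp add: mult_ac)
qed

lemma \<psi>_derivative:
  "(\<psi> has_vector_derivative Ex V (\<lambda>y. \<i> * T y * cis (t * T y))) (at t within A)"
  unfolding \<psi>_def[abs_def] Ex_def scaleR_conv_of_real
  by (intro has_vector_derivative_sum has_vector_derivative_mult_right has_vector_derivative_cis_mult)

text \<open>The integrating factor \<open>exp (s * t\<^sup>2 / 2)\<close> turns the approximate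
  differential equation into a small derivative of \<open>h\<close>, and the mean value inequality
  on \<open>[0, 1]\<close> bounds \<open>h 1 - h 0\<close>. The growth of the factor cancels when it
  is removed, so the variance does not enter the error. Evaluation at 1 suffices because a frequency
  can be absorbed into the kernel.\<close>

theorem char_fun_bound:
  "cmod (Ex V (\<lambda>y. cis (edge_sum \<phi> y)) - exp (- Ex V (\<lambda>y. (edge_sum \<phi> y)\<^sup>2) / 2))
    \<le> 7 * B ^ 3 * (real D)\<^sup>2 / sqrt n"
proof -
  define s where "s = Ex V (\<lambda>y. (T y)\<^sup>2)"
  define C where "C = 7 * real n * (real D)\<^sup>2 * c ^ 3"
  have s0: "0 \<le> s" unfolding s_def by (rule Ex_nonneg) simp
  have C0: "0 \<le> C" using c_nonneg by (simp add: C_def)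
  define h where "h t = \<psi> t * of_real (exp (s * t\<^sup>2 / 2))" for t
  define h' where "h' t = (Ex V (\<lambda>y. \<i> * T y * cis (t * T y)) + t * s * \<psi> t) * of_real (exp (s * t\<^sup>2 / 2))" for t
  have dh: "(h has_vector_derivative h' t) (at t within A)" for t A
  proof -
    have "((\<lambda>t. exp (s * t\<^sup>2 / 2)) has_real_derivative exp (s * t\<^sup>2 / 2) * (s * t)) (at t within A)"
      by (auto intro!: derivative_eq_intros)
    then have "((\<lambda>t. of_real (exp (s * t\<^sup>2 / 2)) :: complex) has_vector_derivative of_real (exp (s * t\<^sup>2 / 2) * (s * t))) (at t within A)"
      by (intro has_vector_derivative_of_real) (simp add: has_real_derivative_iff_has_vector_derivative)
    from has_vector_derivative_mult[OF \<psi>_derivative this]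
    show ?thesis unfolding h_def[abs_def] h'_def by (simp add: algebra_simps)
  qed
  have "\<exists>t\<in>{0<..<1}. norm (h 1 - h 0) \<le> norm ((1 - 0) *\<^sub>R h' t)"
  proof (rule mvt_general)
    show "continuous_on {0..1} h"
      using dh by (auto simp: continuous_on_eq_continuous_within intro!: has_vector_derivative_continuous)
    show "(h has_derivative (\<lambda>u. u *\<^sub>R h' t)) (at t)" for t
      using dh[of t UNIV] by (simp add: has_vector_derivative_def)
  qed simp
  then obtain t where t: "0 < t" "t < 1" and le: "norm (h 1 - h 0) \<le> norm (h' t)"
    by auto
  have "norm (h' t) \<le> C * exp (s / 2)"
    unfolding h'_def norm_mult
  proof (intro mult_mono)
    have "t\<^sup>2 \<le> 1" using t by (simp add: power_le_one)
    then show "cmod (of_real (exp (s * t\<^sup>2 / 2))) \<le> exp (s / 2)"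
      using mult_left_mono[of "t\<^sup>2" 1 s] s0 by simp
    have "cmod (Ex V (\<lambda>y. \<i> * T y * cis (t * T y)) + t * s * \<psi> t) \<le> C * t\<^sup>2"
      unfolding C_def s_def using Stein_identity_error[of t] t by simp
    also have "\<dots> \<le> C"
      using mult_left_mono[OF \<open>t\<^sup>2 \<le> 1\<close> C0] by simp
    finally show "cmod (Ex V (\<lambda>y. \<i> * T y * cis (t * T y)) + t * s * \<psi> t) \<le> C" .
  qed (use C0 in auto)
  with le have "norm (h 1 - h 0) \<le> C * exp (s / 2)" by simp
  then have "norm (h 1 - h 0) * exp (- s / 2) \<le> C * exp (s / 2) * exp (- s / 2)"
    by (rule mult_right_mono) simp
  also have "\<dots> = C" by (simp add: exp_minus)
  also have "norm (h 1 - h 0) * exp (- s / 2) = cmod ((h 1 - h 0) * of_real (exp (- s / 2)))"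
    by (simp add: norm_mult)
  also have "(h 1 - h 0) * of_real (exp (- s / 2)) = \<psi> 1 - of_real (exp (- s / 2))"
    by (simp add: h_def \<psi>_def left_diff_distrib exp_minus)
  finally have "cmod (\<psi> 1 - of_real (exp (- s / 2))) \<le> C" .
  moreover have "C = 7 * B ^ 3 * (real D)\<^sup>2 / sqrt n"
    using n_pos by (simp add: C_def c_def power3_eq_cube field_simps)
  ultimately show ?thesis
    by (simp add: \<psi>_def s_def T_eq)
qed

end

section \<open>Algebra of the covariance form\<close>

lemma (in finite_law) form_cong:
  assumes "\<And>a b. a \<in> {1..K} \<Longrightarrow> b \<in> {1..K} \<Longrightarrow> \<phi> a b = \<phi>' a b"
    and "\<And>a b. a \<in> {1..K} \<Longrightarrow> b \<in> {1..K} \<Longrightarrow> \<theta> a b = \<theta>' a b"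
  shows "form w \<phi> \<theta> = form w \<phi>' \<theta>'"
  unfolding form_def by (intro sum.cong refl) (simp add: assms)

lemma (in finite_law) form_sum_left:
  "form w (\<lambda>a b. \<Sum>r\<in>I. c r * \<phi> r a b) \<theta> = (\<Sum>r\<in>I. c r * form w (\<phi> r) \<theta>)"
proof -
  have "form w (\<lambda>a b. \<Sum>r\<in>I. c r * \<phi> r a b) \<theta>
      = (\<Sum>a=1..K. \<Sum>b=1..K. \<Sum>r\<in>I. c r * (p a * p b * (\<phi> r a b * (\<theta> a b + w * \<theta> b a))))"
    unfolding form_def by (simp add: sum_distrib_left sum_distrib_right mult_ac)
  also have "\<dots> = (\<Sum>r\<in>I. \<Sum>a=1..K. \<Sum>b=1..K. c r * (p a * p b * (\<phi> r a b * (\<theta> a b + w * \<theta> b a))))"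
    by (subst sum.swap[of _ I], subst sum.swap[of _ I]) (rule refl)
  finally show ?thesis by (simp add: form_def sum_distrib_left)
qed

lemma (in finite_law) form_sym: "form w \<phi> \<theta> = form w \<theta> \<phi>"
proof -
  have "(\<Sum>a=1..K. \<Sum>b=1..K. p a * p b * (\<phi> a b * \<theta> b a)) = (\<Sum>b=1..K. \<Sum>a=1..K. p a * p b * (\<phi> a b * \<theta> b a))"
    by (rule sum.swap)
  also have "\<dots> = (\<Sum>a=1..K. \<Sum>b=1..K. p a * p b * (\<theta> a b * \<phi> b a))"
    by (simp add: mult_ac)
  finally have *: "(\<Sum>a=1..K. \<Sum>b=1..K. p a * p b * (\<phi> a b * \<theta> b a)) = \<dots>" .
  have "form w \<phi> \<theta> = (\<Sum>a=1..K. \<Sum>b=1..K. p a * p b * (\<phi> a b * \<theta> a b)) + w * (\<Sum>a=1..K. \<Sum>b=1..K. p a * p b * (\<phi> a b * \<theta> b a))"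
    for \<phi> \<theta>
    by (simp add: form_def sum_distrib_left sum.distrib[symmetric] algebra_simps)
  then show ?thesis using * by (simp add: mult_ac)
qed

lemma (in finite_law) form_sum_right:
  "form w \<theta> (\<lambda>a b. \<Sum>r\<in>I. c r * \<phi> r a b) = (\<Sum>r\<in>I. c r * form w \<theta> (\<phi> r))"
  by (simp add: form_sym[of w \<theta>] form_sum_left)

text \<open>For product kernels the form splits into one-label moments, straight and crossed; this
  is the reason for working with tensors of centred functions.\<close>

lemma (in finite_law) form_product:
  "form w (\<lambda>a b. f a * g b) (\<lambda>a b. f' a * g' b) =
    (\<Sum>a=1..K. p a * (f a * f' a)) * (\<Sum>a=1..K. p a * (g a * g' a))
    + w * ((\<Sum>a=1..K. p a * (f a * g' a)) * (\<Sum>a=1..K. p a * (g a * f' a)))"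
  unfolding form_def sum_product
  by (simp add: sum_distrib_left sum.distrib[symmetric] algebra_simps)

lemma (in finite_law) degenerate_product:
  assumes "(\<Sum>a=1..K. p a * f a) = 0" "(\<Sum>a=1..K. p a * g a) = 0"
  shows "degenerate (\<lambda>a b. f a * g b)"
proof -
  have "(\<Sum>a=1..K. p a * (f a * g b)) = (\<Sum>a=1..K. p a * f a) * g b" for b
    by (simp add: sum_distrib_left mult_ac)
  moreover have "(\<Sum>b=1..K. p b * (f a * g b)) = f a * (\<Sum>b=1..K. p b * g b)" for a
    by (simp add: sum_distrib_left mult_ac)
  ultimately show ?thesis unfolding degenerate_def using assms by simp
qed

lemma (in finite_law) degenerate_sum:
  assumes "\<And>r. r \<in> I \<Longrightarrow> degenerate (\<phi> r)"
  shows "degenerate (\<lambda>a b. \<Sum>r\<in>I. c r * \<phi> r a b)"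
proof -
  have "(\<Sum>a=1..K. p a * (\<Sum>r\<in>I. c r * \<phi> r a b)) = (\<Sum>r\<in>I. c r * (\<Sum>a=1..K. p a * \<phi> r a b))" for b
    unfolding sum_distrib_left by (subst sum.swap) (simp add: mult_ac)
  moreover have "(\<Sum>b=1..K. p b * (\<Sum>r\<in>I. c r * \<phi> r a b)) = (\<Sum>r\<in>I. c r * (\<Sum>b=1..K. p b * \<phi> r a b))" for a
    unfolding sum_distrib_left by (subst sum.swap) (simp add: mult_ac)
  ultimately show ?thesis
    using assms unfolding degenerate_def by simp
qed

section \<open>Centred indicators\<close>

context finite_law
begin

definition cind :: "nat \<Rightarrow> nat \<Rightarrow> real" where
  "cind k x = of_bool (x = k) - p k"

definition cind2 :: "nat \<Rightarrow> nat \<Rightarrow> nat \<Rightarrow> nat \<Rightarrow> real" where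
  "cind2 k l a b = cind k a * cind l b"

lemma sum_p_of_bool: "k \<in> {1..K} \<Longrightarrow> (\<Sum>a=1..K. p a * (of_bool (a = k) * f a)) = p k * f k"
proof -
  assume k: "k \<in> {1..K}"
  have "(\<Sum>a=1..K. p a * (of_bool (a = k) * f a)) = (\<Sum>a=1..K. if a = k then p a * f a else 0)"
    by (intro sum.cong) auto
  then show ?thesis using k by simp
qed

lemma sum_p_cind: "k \<in> {1..K} \<Longrightarrow> (\<Sum>a=1..K. p a * cind k a) = 0"
  using sum_p_of_bool[of k "\<lambda>_. 1"] sum_p
  by (simp add: cind_def right_diff_distrib sum_subtractf sum_distrib_right[symmetric])

lemma sum_p_cind_cind:
  assumes "k \<in> {1..K}" "l \<in> {1..K}"
  shows "(\<Sum>a=1..K. p a * (cind k a * cind l a)) = p k * (of_bool (k = l) - p l)"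
proof -
  have "(\<Sum>a=1..K. p a * (cind k a * cind l a))
      = (\<Sum>a=1..K. p a * (of_bool (a = k) * cind l a)) - p k * (\<Sum>a=1..K. p a * cind l a)"
    by (simp add: cind_def[of k] algebra_simps sum_subtractf sum_distrib_left)
  also have "\<dots> = p k * cind l k"
    by (subst sum_p_of_bool) (use assms in \<open>auto simp: sum_p_cind simp del: One_nat_def\<close>)
  finally show ?thesis by (simp add: cind_def)
qed

lemma p_le_1: "k \<in> {1..K} \<Longrightarrow> p k \<le> 1"
  using member_le_sum[of k "{1..K}" p] sum_p p_nonneg by auto

lemma cind_bound: "k \<in> {1..K} \<Longrightarrow> \<bar>cind k a\<bar> \<le> 1"
  using p_le_1[of k] p_nonneg[of k] by (auto simp: cind_def)

lemma cind2_bound: "k \<in> {1..K} \<Longrightarrow> l \<in> {1..K} \<Longrightarrow> \<bar>cind2 k l a b\<bar> \<le> 1"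
  unfolding cind2_def abs_mult by (intro mult_le_one cind_bound) auto

lemma degenerate_cind2: "k \<in> {1..K} \<Longrightarrow> l \<in> {1..K} \<Longrightarrow> degenerate (cind2 k l)"
  unfolding cind2_def[abs_def] by (intro degenerate_product sum_p_cind)

text \<open>Each factor is the multinomial covariance \<open>p k * (of_bool (k = l) - p l)\<close>.
  Multiplying out the straight and crossed products gives the explicit matrix, with no error
  term.\<close>

lemma form_cind2:
  assumes "k1 \<in> {1..K}" "l1 \<in> {1..K}" "k2 \<in> {1..K}" "l2 \<in> {1..K}"
  shows "form w (cind2 k1 l1) (cind2 k2 l2) = Sigma_formula p w k1 l1 k2 l2"
proof -
  have "form w (cind2 k1 l1) (cind2 k2 l2) =
      p k1 * (of_bool (k1 = k2) - p k2) * (p l1 * (of_bool (l1 = l2) - p l2))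
      + w * (p k1 * (of_bool (k1 = l2) - p l2) * (p l1 * (of_bool (l1 = k2) - p k2)))"
    unfolding cind2_def[abs_def] form_product using assms by (simp only: sum_p_cind_cind)
  then show ?thesis
    by (simp only: Sigma_formula_def of_bool_conj) (simp add: algebra_simps)
qed

end

section \<open>The centred pair frequencies\<close>

context label_graph
begin

definition pfreq :: "nat \<Rightarrow> nat \<Rightarrow> (nat \<Rightarrow> nat) \<Rightarrow> real" where
  "pfreq k l y = 1 / real n * (\<Sum>i=1..n. of_bool (y i = k \<and> y (N i) = l))"

definition pdev :: "nat \<Rightarrow> nat \<Rightarrow> (nat \<Rightarrow> nat) \<Rightarrow> real" where
  "pdev k l y = sqrt (real n) * (pfreq k l y - (\<Sum>m=1..K. pfreq k m y) * (\<Sum>m=1..K. pfreq m l y))"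

text \<open>This is \<open>sqrt n\<close> times the product of the two centred marginal frequencies,
  the correction that separates \<open>pdev\<close> from an edge sum.\<close>

definition remainder :: "nat \<Rightarrow> nat \<Rightarrow> (nat \<Rightarrow> nat) \<Rightarrow> real" where
  "remainder k l y = (\<Sum>i\<in>V. cind k (y i)) * (\<Sum>i\<in>V. cind l (y (N i))) / (n * sqrt n)"

text \<open>The diagonal is included, so this is the sum of the squared in-degrees.\<close>

definition collisions :: real where
  "collisions = (\<Sum>i\<in>V. \<Sum>j\<in>V. of_bool (N i = N j))"

lemma sum_pfreq_right:
  assumes "y \<in> labellings V"
  shows "(\<Sum>m=1..K. pfreq k m y) = 1 / n * (\<Sum>i\<in>V. of_bool (y i = k))"
proof -
  have "(\<Sum>m=1..K. pfreq k m y) = 1 / n * (\<Sum>i\<in>V. \<Sum>m=1..K. of_bool (y i = k \<and> y (N i) = m))"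
    unfolding pfreq_def sum_distrib_left[symmetric] by (subst sum.swap) rule
  also have "(\<Sum>i\<in>V. \<Sum>m=1..K. of_bool (y i = k \<and> y (N i) = m)) = (\<Sum>i\<in>V. (of_bool (y i = k) :: real))"
  proof (intro sum.cong refl)
    fix i assume "i \<in> V"
    then have "y (N i) \<in> {1..K}" using labellings_range[OF assms N_in] by simp
    moreover have "(\<Sum>m=1..K. of_bool (y i = k \<and> y (N i) = m)) = (\<Sum>m=1..K. if y (N i) = m then of_bool (y i = k) else (0::real))"
      by (intro sum.cong) auto
    ultimately show "(\<Sum>m=1..K. of_bool (y i = k \<and> y (N i) = m)) = (of_bool (y i = k) :: real)" by simp
  qed
  finally show ?thesis .
qed

lemma sum_pfreq_left:
  assumes "y \<in> labellings V"
  shows "(\<Sum>m=1..K. pfreq m l y) = 1 / n * (\<Sum>i\<in>V. of_bool (y (N i) = l))"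
proof -
  have "(\<Sum>m=1..K. pfreq m l y) = 1 / n * (\<Sum>i\<in>V. \<Sum>m=1..K. of_bool (y i = m \<and> y (N i) = l))"
    unfolding pfreq_def sum_distrib_left[symmetric] by (subst sum.swap) rule
  also have "(\<Sum>i\<in>V. \<Sum>m=1..K. of_bool (y i = m \<and> y (N i) = l)) = (\<Sum>i\<in>V. (of_bool (y (N i) = l) :: real))"
  proof (intro sum.cong refl)
    fix i assume "i \<in> V"
    then have "y i \<in> {1..K}" using labellings_range[OF assms] by simp
    moreover have "(\<Sum>m=1..K. of_bool (y i = m \<and> y (N i) = l)) = (\<Sum>m=1..K. if y i = m then of_bool (y (N i) = l) else (0::real))"
      by (intro sum.cong) auto
    ultimately show "(\<Sum>m=1..K. of_bool (y i = m \<and> y (N i) = l)) = (of_bool (y (N i) = l) :: real)" by simp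
  qed
  finally show ?thesis .
qed

text \<open>When the joint frequency and the product of its marginals are centred, the terms linear
  in the marginals cancel. What is left is the degenerate part and the product of the centred
  marginals.\<close>

lemma pdev_eq:
  assumes "y \<in> labellings V"
  shows "pdev k l y = edge_sum (cind2 k l) y - remainder k l y"
proof -
  let ?n = "real n"
  define f where "f = (\<Sum>i\<in>V. of_bool (y i = k) :: real)"
  define g where "g = (\<Sum>i\<in>V. of_bool (y (N i) = l) :: real)"
  define h where "h = (\<Sum>i\<in>V. of_bool (y i = k \<and> y (N i) = l) :: real)"
  have n: "?n > 0" using n_pos by simp
  have s: "sqrt ?n * sqrt ?n = ?n" by simp
  have s': "?n / sqrt ?n = sqrt ?n" using n by (simp add: real_div_sqrt)
  have "(\<Sum>i\<in>V. edge (cind2 k l) i y) = h - p l * f - p k * g + ?n * (p k * p l)"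
    unfolding f_def g_def h_def edge_def cind2_def cind_def
    by (simp add: algebra_simps sum_subtractf sum.distrib sum_distrib_left of_bool_conj)
  moreover have "(\<Sum>i\<in>V. cind k (y i)) = f - ?n * p k" "(\<Sum>i\<in>V. cind l (y (N i))) = g - ?n * p l"
    by (simp_all add: f_def g_def cind_def sum_subtractf)
  moreover have "pdev k l y = sqrt ?n * (h / ?n - f / ?n * (g / ?n))"
    unfolding pdev_def sum_pfreq_left[OF assms] sum_pfreq_right[OF assms] by (simp add: pfreq_def f_def g_def h_def)
  moreover have "sqrt ?n * (h / ?n - f / ?n * (g / ?n)) =
      (h - p l * f - p k * g + ?n * (p k * p l)) / sqrt ?n - (f - ?n * p k) * (g - ?n * p l) / (?n * sqrt ?n)"
  proof -
    have "(h - p l * f - p k * g + ?n * (p k * p l)) / sqrt ?n - (f - ?n * p k) * (g - ?n * p l) / (?n * sqrt ?n)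
        = (?n * (h - p l * f - p k * g + ?n * (p k * p l)) - (f - ?n * p k) * (g - ?n * p l)) / (?n * sqrt ?n)"
      using n by (simp add: field_simps)
    also have "\<dots> = (?n * h - f * g) / (?n * sqrt ?n)"
      by (simp add: algebra_simps)
    also have "\<dots> = (sqrt ?n * sqrt ?n) * (?n * h - f * g) / (?n * ?n * sqrt ?n)"
      unfolding s using n by simp
    also have "\<dots> = sqrt ?n * (h / ?n - f / ?n * (g / ?n))"
      using n by (simp add: field_simps)
    finally show ?thesis ..
  qed
  ultimately show ?thesis
    by (simp add: edge_sum_def remainder_def)
qed

text \<open>If some vertex occurs exactly once, averaging over its label gives zero.\<close>

lemma Ex_four:
  assumes k: "k \<in> {1..K}" "l \<in> {1..K}" and V: "u \<in> V" "v \<in> V" "w \<in> V" "z \<in> V"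
  shows "\<bar>Ex V (\<lambda>y. cind k (y u) * cind k (y v) * (cind l (y w) * cind l (y z)))\<bar>
    \<le> of_bool (u = v \<and> w = z) + of_bool (u = w \<and> v = z) + of_bool (u = z \<and> v = w)"
proof (cases "u = v \<and> w = z \<or> u = w \<and> v = z \<or> u = z \<and> v = w")
  case True
  have "\<bar>Ex V (\<lambda>y. cind k (y u) * cind k (y v) * (cind l (y w) * cind l (y z)))\<bar> \<le> 1"
    unfolding real_norm_def[symmetric]
    by (rule Ex_norm_le_const) (auto simp: abs_mult intro!: mult_le_one cind_bound k)
  also have "1 \<le> of_bool (u = v \<and> w = z) + of_bool (u = w \<and> v = z) + (of_bool (u = z \<and> v = w) :: real)"
    using True by auto
  finally show ?thesis .
next
  case False
  have zero: "Ex V (\<lambda>y. cind m (y i) * g y) = 0"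
    if "m \<in> {1..K}" "i \<in> V" "depends_on (- {i}) g" for m i and g :: "(nat \<Rightarrow> nat) \<Rightarrow> real"
    using that by (intro Ex_centred1) (auto simp: sum_p_cind simp del: One_nat_def)
  have dep: "depends_on (- {i}) (\<lambda>y. cind m1 (y i1) * (cind m2 (y i2) * cind m3 (y i3)))"
    if "i1 \<noteq> i" "i2 \<noteq> i" "i3 \<noteq> i" for i i1 i2 i3 m1 m2 m3
    using that by (intro depends_on_mult depends_on_apply) auto
  consider "u \<noteq> v" "u \<noteq> w" "u \<noteq> z" | "v \<noteq> u" "v \<noteq> w" "v \<noteq> z"
    | "w \<noteq> u" "w \<noteq> v" "w \<noteq> z" | "z \<noteq> u" "z \<noteq> v" "z \<noteq> w"
    using False by metis
  then have "Ex V (\<lambda>y. cind k (y u) * cind k (y v) * (cind l (y w) * cind l (y z))) = 0"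
  proof cases
    case 1
    then show ?thesis
      using zero[OF k(1) V(1) dep[of v u w z k l l]] by (simp add: mult_ac)
  next
    case 2
    then show ?thesis
      using zero[OF k(1) V(2) dep[of u v w z k l l]] by (simp add: mult_ac)
  next
    case 3
    then show ?thesis
      using zero[OF k(2) V(3) dep[of u w v z k k l]] by (simp add: mult_ac)
  next
    case 4
    then show ?thesis
      using zero[OF k(2) V(4) dep[of u z v w k k l]] by (simp add: mult_ac)
  qed
  then show ?thesis by (simp only: abs_zero) (intro add_nonneg_nonneg zero_less_eq_of_bool)
qed

text \<open>Of the three pairings that survive in the fourth moment, \<open>i = i'\<close> with
  \<open>N j = N j'\<close> leaves \<open>i\<close> free and gives \<open>n * collisions\<close>;
  the two crossed pairings determine \<open>i\<close> and \<open>i'\<close> and give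
  \<open>n\<^sup>2\<close> each. The normalisation divides by the cube of \<open>n\<close>.\<close>

lemma Ex_remainder_square:
  assumes k: "k \<in> {1..K}" "l \<in> {1..K}"
  shows "Ex V (\<lambda>y. (remainder k l y)\<^sup>2) \<le> collisions / (real n)\<^sup>2 + 2 / n"
proof -
  let ?t = "\<lambda>i i' j j'. of_bool (i = i' \<and> N j = N j') + of_bool (i = N j \<and> i' = N j') + (of_bool (i = N j' \<and> i' = N j) :: real)"
  have sq: "(remainder k l y)\<^sup>2 = (\<Sum>j\<in>V. \<Sum>j'\<in>V. \<Sum>i\<in>V. \<Sum>i'\<in>V.
      cind k (y i) * cind k (y i') * (cind l (y (N j)) * cind l (y (N j')))) * (1 / real n ^ 3)" for y
  proof -
    have "(remainder k l y)\<^sup>2 = ((\<Sum>i\<in>V. cind k (y i)) * (\<Sum>i\<in>V. cind k (y i))) * ((\<Sum>j\<in>V. cind l (y (N j))) * (\<Sum>j\<in>V. cind l (y (N j)))) * (1 / real n ^ 3)"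
      by (simp add: remainder_def power_divide power_mult_distrib power2_eq_square power3_eq_cube mult_ac)
    also have "((\<Sum>i\<in>V. cind k (y i)) * (\<Sum>i\<in>V. cind k (y i))) * ((\<Sum>j\<in>V. cind l (y (N j))) * (\<Sum>j\<in>V. cind l (y (N j))))
      = (\<Sum>j\<in>V. \<Sum>j'\<in>V. (\<Sum>i\<in>V. \<Sum>i'\<in>V. cind k (y i) * cind k (y i')) * (cind l (y (N j)) * cind l (y (N j'))))"
    proof -
      have "((\<Sum>i\<in>V. cind k (y i)) * (\<Sum>i\<in>V. cind k (y i))) = (\<Sum>i\<in>V. \<Sum>i'\<in>V. cind k (y i) * cind k (y i'))"
        by (rule sum_product)
      moreover have "((\<Sum>j\<in>V. cind l (y (N j))) * (\<Sum>j\<in>V. cind l (y (N j)))) = (\<Sum>j\<in>V. \<Sum>j'\<in>V. cind l (y (N j)) * cind l (y (N j')))"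
        by (rule sum_product)
      ultimately show ?thesis by (simp only: sum_distrib_left)
    qed
    finally show ?thesis by (simp add: sum_distrib_right)
  qed
  have in1: "(\<Sum>i\<in>V. \<Sum>i'\<in>V. ?t i i' j j') = real n * of_bool (N j = N j') + 2" if j: "j \<in> V" "j' \<in> V" for j j'
  proof -
    have "(\<Sum>i'\<in>V. ?t i i' j j') = of_bool (N j = N j') + of_bool (i = N j) + of_bool (i = N j')" if i: "i \<in> V" for i
    proof -
      have "(\<Sum>i'\<in>V. ?t i i' j j') = (\<Sum>i'\<in>V. (if i = i' then of_bool (N j = N j') else 0)
          + (if i' = N j' then of_bool (i = N j) else 0) + (if i' = N j then of_bool (i = N j') else 0))"
        by (intro sum.cong) auto
      then show ?thesis using i N_in[OF j(1)] N_in[OF j(2)] by (simp add: sum.distrib del: One_nat_def)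
    qed
    then have "(\<Sum>i\<in>V. \<Sum>i'\<in>V. ?t i i' j j') = (\<Sum>i\<in>V. of_bool (N j = N j') + of_bool (i = N j) + of_bool (i = N j'))"
      by (intro sum.cong refl) auto
    also have "\<dots> = (\<Sum>i\<in>V. of_bool (N j = N j') + (if i = N j then 1 else 0) + (if i = N j' then 1 else 0))"
      by (intro sum.cong) auto
    finally show ?thesis using N_in[OF j(1)] N_in[OF j(2)] by (simp add: sum.distrib del: One_nat_def)
  qed
  have "Ex V (\<lambda>y. (remainder k l y)\<^sup>2) = (\<Sum>j\<in>V. \<Sum>j'\<in>V. \<Sum>i\<in>V. \<Sum>i'\<in>V.
      Ex V (\<lambda>y. cind k (y i) * cind k (y i') * (cind l (y (N j)) * cind l (y (N j'))))) * (1 / real n ^ 3)"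
    unfolding sq Ex_mult_right Ex_sum ..
  also have "\<dots> \<le> (\<Sum>j\<in>V. \<Sum>j'\<in>V. \<Sum>i\<in>V. \<Sum>i'\<in>V. ?t i i' j j') * (1 / real n ^ 3)"
    by (intro mult_right_mono sum_mono order_trans[OF abs_ge_self Ex_four] k N_in) auto
  also have "(\<Sum>j\<in>V. \<Sum>j'\<in>V. \<Sum>i\<in>V. \<Sum>i'\<in>V. ?t i i' j j') = (\<Sum>j\<in>V. \<Sum>j'\<in>V. real n * of_bool (N j = N j') + 2)"
    by (intro sum.cong refl in1)
  also have "\<dots> = n * collisions + 2 * (real n)\<^sup>2"
    by (simp add: collisions_def sum.distrib sum_distrib_left power2_eq_square mult.commute)
  also have "\<dots> * (1 / real n ^ 3) = collisions / (real n)\<^sup>2 + 2 / n"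
    using n_pos by (simp add: field_simps power2_eq_square power3_eq_cube)
  finally show ?thesis .
qed

lemma Ex_edge_sum_square_le:
  assumes "k \<in> {1..K}" "l \<in> {1..K}"
  shows "Ex V (\<lambda>y. (edge_sum (cind2 k l) y)\<^sup>2) \<le> 2"
proof -
  have "Ex V (\<lambda>y. (edge_sum (cind2 k l) y)\<^sup>2) = form mutual (cind2 k l) (cind2 k l)"
    unfolding power2_eq_square by (intro Ex_edge_sum_mult degenerate_cind2 assms)
  also have "\<dots> \<le> (\<Sum>a=1..K. \<Sum>b=1..K. p a * p b * 2)"
    unfolding form_def
  proof (intro sum_mono mult_left_mono)
    fix a b assume ab: "a \<in> {1..K}" "b \<in> {1..K}"
    have "cind2 k l a b * (cind2 k l a b + mutual * cind2 k l b a)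
        \<le> \<bar>cind2 k l a b\<bar> * \<bar>cind2 k l a b + mutual * cind2 k l b a\<bar>"
      by (metis abs_ge_self abs_mult)
    also have "\<dots> \<le> 1 * 2"
    proof (intro mult_mono cind2_bound assms)
      have "\<bar>mutual * cind2 k l b a\<bar> \<le> 1"
        unfolding abs_mult using mutual_nonneg mutual_le_1 cind2_bound[OF assms, of b a]
        by (intro mult_le_one) auto
      then show "\<bar>cind2 k l a b + mutual * cind2 k l b a\<bar> \<le> 2"
        using cind2_bound[OF assms, of a b] by linarith
    qed auto
    finally show "cind2 k l a b * (cind2 k l a b + mutual * cind2 k l b a) \<le> 2" by simp
    show "0 \<le> p a * p b" using ab by (simp add: p_nonneg)
  qed
  also have "\<dots> = (\<Sum>a=1..K. p a) * (\<Sum>b=1..K. p b) * 2"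
    by (subst sum_product) (simp only: sum_distrib_right)
  finally show ?thesis using sum_p by simp
qed

section \<open>Covariance of the centred pair frequencies on a fixed graph\<close>

definition pcov :: "nat \<Rightarrow> nat \<Rightarrow> nat \<Rightarrow> nat \<Rightarrow> real" where
  "pcov k1 l1 k2 l2 = Ex V (\<lambda>y. (pdev k1 l1 y - Ex V (pdev k1 l1)) * (pdev k2 l2 y - Ex V (pdev k2 l2)))"

text \<open>A weighted arithmetic-geometric mean inequality: the square of the bounded factor is
  multiplied by \<open>\<tau>\<close>, the square of the small one divided by it. The resulting
  \<open>3 / 2 * \<tau>\<close> is rounded up.\<close>

lemma abs_Ex_mult_le:
  fixes f g :: "(nat \<Rightarrow> nat) \<Rightarrow> real"
  assumes f: "Ex V (\<lambda>y. (f y)\<^sup>2) \<le> 2" and g: "Ex V (\<lambda>y. (g y)\<^sup>2) \<le> \<tau>\<^sup>2" and \<tau>: "0 < \<tau>"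
  shows "\<bar>Ex V (\<lambda>y. f y * g y)\<bar> \<le> 2 * \<tau>"
proof -
  have "\<bar>Ex V (\<lambda>y. f y * g y)\<bar> \<le> Ex V (\<lambda>y. \<tau> / 2 * (f y)\<^sup>2 + 1 / (2 * \<tau>) * (g y)\<^sup>2)"
    unfolding real_norm_def[symmetric]
  proof (rule Ex_norm_le)
    fix y
    have "0 \<le> (\<tau> * \<bar>f y\<bar> - \<bar>g y\<bar>)\<^sup>2" by simp
    then have "2 * \<tau> * (\<bar>f y\<bar> * \<bar>g y\<bar>) \<le> \<tau>\<^sup>2 * (f y)\<^sup>2 + (g y)\<^sup>2"
      by (simp add: power2_diff power_mult_distrib algebra_simps)
    then show "norm (f y * g y) \<le> \<tau> / 2 * (f y)\<^sup>2 + 1 / (2 * \<tau>) * (g y)\<^sup>2"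
      using \<tau> by (simp add: abs_mult field_simps power2_eq_square)
  qed
  also have "\<dots> = \<tau> / 2 * Ex V (\<lambda>y. (f y)\<^sup>2) + 1 / (2 * \<tau>) * Ex V (\<lambda>y. (g y)\<^sup>2)"
    unfolding Ex_add Ex_mult_left ..
  also have "\<dots> \<le> \<tau> / 2 * 2 + 1 / (2 * \<tau>) * \<tau>\<^sup>2"
    using \<tau> by (intro add_mono mult_left_mono f g) auto
  also have "\<dots> = 3 / 2 * \<tau>"
    using \<tau> by (simp add: power2_eq_square)
  finally show ?thesis using \<tau> by simp
qed

text \<open>Edge sums have mean zero, so centring \<open>pdev\<close> only centres the remainder. Of
  the four products the first gives the explicit matrix and the other three are at most
  \<open>2 * \<tau>\<close> each.\<close>

lemma pcov_approx:
  assumes k: "k1 \<in> {1..K}" "l1 \<in> {1..K}" "k2 \<in> {1..K}" "l2 \<in> {1..K}"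
    and \<tau>: "0 < \<tau>" "\<tau> \<le> 1" and small: "collisions / (real n)\<^sup>2 + 2 / n \<le> \<tau>\<^sup>2"
  shows "\<bar>pcov k1 l1 k2 l2 - Sigma_formula p mutual k1 l1 k2 l2\<bar> \<le> 6 * \<tau>"
proof -
  define S where "S k l = edge_sum (cind2 k l)" for k l
  define R where "R k l y = remainder k l y - Ex V (remainder k l)" for k l y
  have ES: "Ex V (S k l) = 0" if "k \<in> {1..K}" "l \<in> {1..K}" for k l
  proof -
    have "Ex V (S k l) = (\<Sum>i\<in>V. Ex V (edge (cind2 k l) i)) / sqrt n"
      unfolding S_def edge_sum_def[abs_def] divide_inverse Ex_mult_right Ex_sum ..
    also have "(\<Sum>i\<in>V. Ex V (edge (cind2 k l) i)) = 0"
      using Ex_edge_source[OF degenerate_cind2[OF that], of _ "\<lambda>_. 1 :: real"]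
      by (intro sum.neutral ballI) (simp add: depends_on_def)
    finally show ?thesis by simp
  qed
  have ER: "Ex V (\<lambda>y. (R k l y)\<^sup>2) \<le> \<tau>\<^sup>2" if "k \<in> {1..K}" "l \<in> {1..K}" for k l
  proof -
    define m where "m = Ex V (remainder k l)"
    have "Ex V (\<lambda>y. (R k l y)\<^sup>2) = Ex V (\<lambda>y. (remainder k l y)\<^sup>2 - 2 * m * remainder k l y + m\<^sup>2)"
      by (simp add: R_def m_def power2_diff algebra_simps)
    also have "\<dots> = Ex V (\<lambda>y. (remainder k l y)\<^sup>2) - 2 * m * m + m\<^sup>2"
      unfolding Ex_add Ex_diff Ex_mult_left by (simp add: m_def)
    also have "\<dots> \<le> Ex V (\<lambda>y. (remainder k l y)\<^sup>2)"
      by (simp add: power2_eq_square)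
    finally show ?thesis
      using Ex_remainder_square[OF that] small by linarith
  qed
  have ES2: "Ex V (\<lambda>y. (S k l y)\<^sup>2) \<le> 2" if "k \<in> {1..K}" "l \<in> {1..K}" for k l
    unfolding S_def by (rule Ex_edge_sum_square_le[OF that])
  have dev: "pdev k l y - Ex V (pdev k l) = S k l y - R k l y"
    if "k \<in> {1..K}" "l \<in> {1..K}" "y \<in> labellings V" for k l y
  proof -
    have "Ex V (pdev k l) = Ex V (\<lambda>y. S k l y - remainder k l y)"
      by (intro Ex_cong) (simp add: pdev_eq S_def)
    also have "\<dots> = - Ex V (remainder k l)"
      unfolding Ex_diff using ES[OF that(1,2)] by simp
    finally show ?thesis using that by (simp add: pdev_eq S_def R_def)
  qed
  have "pcov k1 l1 k2 l2 = Ex V (\<lambda>y. (S k1 l1 y - R k1 l1 y) * (S k2 l2 y - R k2 l2 y))"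
    unfolding pcov_def using k by (intro Ex_cong) (simp add: dev del: One_nat_def)
  also have "\<dots> = Ex V (\<lambda>y. S k1 l1 y * S k2 l2 y - S k1 l1 y * R k2 l2 y - S k2 l2 y * R k1 l1 y + R k1 l1 y * R k2 l2 y)"
    by (simp add: algebra_simps)
  also have "\<dots> = Ex V (\<lambda>y. S k1 l1 y * S k2 l2 y) - Ex V (\<lambda>y. S k1 l1 y * R k2 l2 y)
      - Ex V (\<lambda>y. S k2 l2 y * R k1 l1 y) + Ex V (\<lambda>y. R k1 l1 y * R k2 l2 y)"
    unfolding Ex_add Ex_diff ..
  also have "Ex V (\<lambda>y. S k1 l1 y * S k2 l2 y) = Sigma_formula p mutual k1 l1 k2 l2"
    unfolding S_def form_cind2[OF k, symmetric] using k by (intro Ex_edge_sum_mult degenerate_cind2)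
  finally have eq: "pcov k1 l1 k2 l2 - Sigma_formula p mutual k1 l1 k2 l2 = - Ex V (\<lambda>y. S k1 l1 y * R k2 l2 y)
      - Ex V (\<lambda>y. S k2 l2 y * R k1 l1 y) + Ex V (\<lambda>y. R k1 l1 y * R k2 l2 y)" by simp
  \<comment> \<open>\<open>\<tau> \<le> 1\<close> lets a centred remainder also serve as the bounded
    factor in \<open>abs_Ex_mult_le\<close>.\<close>
  have "\<tau>\<^sup>2 \<le> 2" using \<tau> power_le_one[of \<tau> 2] by linarith
  then have 3: "Ex V (\<lambda>y. (R k1 l1 y)\<^sup>2) \<le> 2" using ER[OF k(1,2)] by linarith
  show ?thesis
    unfolding eq
    using abs_Ex_mult_le[OF ES2[OF k(1,2)] ER[OF k(3,4)] \<tau>(1)]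
      abs_Ex_mult_le[OF ES2[OF k(3,4)] ER[OF k(1,2)] \<tau>(1)]
      abs_Ex_mult_le[OF 3 ER[OF k(3,4)] \<tau>(1)] by linarith
qed

text \<open>The row sums are plain label frequencies of independent labels, so distinct vertices are
  uncorrelated. This gives the consistency of \<open>p_hat\<close>, uniformly over graphs.\<close>

lemma Ex_marginal_square:
  assumes k: "k \<in> {1..K}"
  shows "Ex V (\<lambda>y. ((\<Sum>m=1..K. pfreq k m y) - p k)\<^sup>2) \<le> 1 / n"
proof -
  have sq: "((\<Sum>m=1..K. pfreq k m y) - p k)\<^sup>2 = (\<Sum>i\<in>V. \<Sum>j\<in>V. cind k (y i) * cind k (y j)) * (1 / (real n)\<^sup>2)"
    if "y \<in> labellings V" for y
  proof -
    have "(\<Sum>m=1..K. pfreq k m y) - p k = (\<Sum>i\<in>V. cind k (y i)) * (1 / n)"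
      unfolding sum_pfreq_right[OF that] using n_pos by (simp add: cind_def sum_subtractf field_simps)
    then show ?thesis
      by (simp add: power_mult_distrib power_divide) (simp add: power2_eq_square sum_product)
  qed
  have t: "Ex V (\<lambda>y. cind k (y i) * cind k (y j)) \<le> (if i = j then 1 else 0)" if "i \<in> V" "j \<in> V" for i j
  proof (cases "i = j")
    case True
    have "\<bar>Ex V (\<lambda>y. cind k (y i) * cind k (y j))\<bar> \<le> 1"
      unfolding real_norm_def[symmetric]
      by (rule Ex_norm_le_const) (auto simp: abs_mult intro!: mult_le_one cind_bound k)
    then show ?thesis using True by simp
  next
    case False
    have "Ex V (\<lambda>y. cind k (y i) * cind k (y j)) = 0"
      by (rule Ex_centred1) (use that False k sum_p_cind[OF k] in \<open>auto simp: depends_on_def\<close>)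
    then show ?thesis using False by simp
  qed
  have "Ex V (\<lambda>y. ((\<Sum>m=1..K. pfreq k m y) - p k)\<^sup>2)
      = (\<Sum>i\<in>V. \<Sum>j\<in>V. Ex V (\<lambda>y. cind k (y i) * cind k (y j))) * (1 / (real n)\<^sup>2)"
    unfolding Ex_sum[symmetric] Ex_mult_right[symmetric] by (intro Ex_cong sq)
  also have "\<dots> \<le> (\<Sum>i\<in>V. \<Sum>j\<in>V. if i = j then 1 else 0) * (1 / (real n)\<^sup>2)"
    by (intro mult_right_mono sum_mono t) auto
  also have "\<dots> = 1 / n"
    using n_pos by (simp add: power2_eq_square)
  finally show ?thesis .
qed

end

section \<open>Perturbation of inverse quadratic forms\<close>

text \<open>The hypothesis says \<open>H S H\<^sup>T = I\<close>. For square matrices the right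
  inverse \<open>H\<^sup>T\<close> of \<open>H S\<close> is also a left inverse, and
  \<open>H\<^sup>T H S = I\<close> is read off entrywise.\<close>

lemma inverse_of_congruence:
  fixes H S :: "nat \<Rightarrow> nat \<Rightarrow> real"
  assumes HSH: "\<And>r r'. r < d \<Longrightarrow> r' < d \<Longrightarrow>
      (\<Sum>s<d. \<Sum>s'<d. H r s * S s s' * H r' s') = of_bool (r = r')"
    and r: "r < d" "r' < d"
  shows "(\<Sum>s<d. (\<Sum>q<d. H q r * H q s) * S s r') = of_bool (r = r')"
proof -
  define Hm where "Hm = Matrix.mat d d (\<lambda>(i, j). H i j)"
  define Sm where "Sm = Matrix.mat d d (\<lambda>(i, j). S i j)"
  define Ht where "Ht = Matrix.mat d d (\<lambda>(i, j). H j i)"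
  have c: "Hm \<in> carrier_mat d d" "Sm \<in> carrier_mat d d" "Ht \<in> carrier_mat d d"
    by (auto simp: Hm_def Sm_def Ht_def)
  have "(Hm * Sm) * Ht = 1\<^sub>m d"
  proof (rule eq_matI)
    fix i j assume "i < dim_row (1\<^sub>m d :: real mat)" "j < dim_col (1\<^sub>m d :: real mat)"
    then have ij: "i < d" "j < d" by auto
    have "((Hm * Sm) * Ht) $$ (i, j) = (\<Sum>s'=0..<d. (\<Sum>s=0..<d. H i s * S s s') * H j s')"
      using ij by (simp add: Hm_def Sm_def Ht_def scalar_prod_def)
    also have "\<dots> = (\<Sum>s'<d. \<Sum>s<d. H i s * S s s' * H j s')"
      by (simp add: sum_distrib_right atLeast0LessThan)
    also have "\<dots> = of_bool (i = j)"
      by (subst sum.swap) (rule HSH[OF ij])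
    finally show "((Hm * Sm) * Ht) $$ (i, j) = 1\<^sub>m d $$ (i, j)" using ij by simp
  qed (use c in auto)
  then have "Ht * (Hm * Sm) = 1\<^sub>m d"
    by (intro mat_mult_left_right_inverse[of "Hm * Sm" d Ht]) (use c in auto)
  then have "(Ht * Hm) * Sm = 1\<^sub>m d"
    using assoc_mult_mat[OF c(3,1,2)] by simp
  then have "((Ht * Hm) * Sm) $$ (r, r') = of_bool (r = r')"
    using r by simp
  moreover have "((Ht * Hm) * Sm) $$ (r, r') = (\<Sum>s=0..<d. (\<Sum>q=0..<d. H q r * H q s) * S s r')"
    using r by (simp add: Hm_def Sm_def Ht_def scalar_prod_def)
  ultimately show ?thesis by (simp add: atLeast0LessThan)
qed

section \<open>Determinants, inverses and measurability of inverse quadratic forms\<close>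

lemma mult_mat_vec_index:
  assumes "A \<in> carrier_mat d d" "v \<in> carrier_vec d" "s < d"
  shows "vec_index (A *\<^sub>v v) s = (\<Sum>q<d. A $$ (s, q) * vec_index v q)"
  using assms by (simp add: scalar_prod_def atLeast0LessThan)

lemma mat_inverse_det_nonzero:
  fixes A :: "real mat"
  assumes A: "A \<in> carrier_mat d d" and det: "Determinant.det A \<noteq> 0"
  obtains B where "mat_inverse A = Some B" "B \<in> carrier_mat d d" "A * B = 1\<^sub>m d" "B * A = 1\<^sub>m d"
proof (cases "mat_inverse A")
  case None
  then show ?thesis
    using mat_inverse(1)[OF A None, of "()"] det_non_zero_imp_unit[OF A det, of "()"] by blast
next
  case (Some B)
  then show ?thesis using mat_inverse(2)[OF A Some] that by blast
qed

lemma mat_inverse_det_zero: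
  fixes A :: "real mat"
  assumes A: "A \<in> carrier_mat d d" and det: "Determinant.det A = 0"
  shows "mat_inverse A = None"
proof (cases "mat_inverse A")
  case (Some B)
  then have "A * B = 1\<^sub>m d" "B \<in> carrier_mat d d" using mat_inverse(2)[OF A Some] by auto
  then show ?thesis using det_mult[OF A, of B] det by simp
qed auto

lemma invertible_mat_iff_det_nonzero:
  fixes A :: "real mat"
  assumes A: "A \<in> carrier_mat d d"
  shows "invertible_mat A \<longleftrightarrow> Determinant.det A \<noteq> 0"
proof
  assume "invertible_mat A"
  then obtain B where AB: "A * B = 1\<^sub>m (dim_row A)" and BA: "B * A = 1\<^sub>m (dim_row B)"
    by (auto simp: invertible_mat_def inverts_mat_def)
  have "dim_row B = dim_col (B * A)" by (simp add: BA)
  moreover have "dim_col B = dim_col (A * B)" by simp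
  ultimately have "B \<in> carrier_mat d d" using A AB by auto
  then show "Determinant.det A \<noteq> 0" using det_mult[OF A, of B] AB A by auto
next
  assume "Determinant.det A \<noteq> 0"
  then obtain B where "B \<in> carrier_mat d d" "A * B = 1\<^sub>m d" "B * A = 1\<^sub>m d"
    by (rule mat_inverse_det_nonzero[OF A])
  then show "invertible_mat A"
    using A unfolding invertible_mat_def inverts_mat_def by auto
qed

text \<open>Cramer's rule. It also holds for singular \<open>A\<close>, where division by zero makes
  the right side 0, in agreement with the convention of \<open>inv_quad_form\<close>. One expression
  in the entries thus covers all cases, and measurability follows from it.\<close>

lemma inv_quad_form_adj:
  assumes A: "A \<in> carrier_mat d d" and v: "v \<in> carrier_vec d"
  shows "inv_quad_form A v =
    (\<Sum>r<d. vec_index v r * (\<Sum>s<d. cofactor A s r / Determinant.det A * vec_index v s))"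
proof (cases "Determinant.det A = 0")
  case True
  then show ?thesis
    by (simp add: inv_quad_form_def mat_inverse_det_zero[OF A])
next
  case False
  obtain B where B: "mat_inverse A = Some B" "B \<in> carrier_mat d d" "A * B = 1\<^sub>m d" "B * A = 1\<^sub>m d"
    by (rule mat_inverse_det_nonzero[OF A False])
  have "B * (A * adj_mat A) = B * (Determinant.det A \<cdot>\<^sub>m 1\<^sub>m d)"
    by (simp add: adj_mat(2)[OF A])
  then have adj: "adj_mat A = Determinant.det A \<cdot>\<^sub>m B"
    using B adj_mat(1)[OF A] A
    by (simp add: assoc_mult_mat[of B d d A d "adj_mat A" d, symmetric]
        mult_smult_distrib[of B d d "1\<^sub>m d" d])
  have Bij: "B $$ (r, s) = cofactor A s r / Determinant.det A" if "r < d" "s < d" for r s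
  proof -
    have "adj_mat A $$ (r, s) = Determinant.det A * B $$ (r, s)"
      unfolding adj using B that by simp
    then show ?thesis using False A that by (simp add: adj_mat_def field_simps)
  qed
  have "inv_quad_form A v = (\<Sum>r<d. vec_index v r * (\<Sum>s<d. B $$ (r, s) * vec_index v s))"
    using B v by (simp add: inv_quad_form_def scalar_prod_def atLeast0LessThan)
  then show ?thesis by (simp add: Bij)
qed

lemma borel_measurable_det:
  assumes "\<And>\<omega>. A \<omega> \<in> carrier_mat d d"
    and "\<And>r s. r < d \<Longrightarrow> s < d \<Longrightarrow> (\<lambda>\<omega>. A \<omega> $$ (r, s)) \<in> borel_measurable M"
  shows "(\<lambda>\<omega>. Determinant.det (A \<omega> :: real mat)) \<in> borel_measurable M"
proof -
  have "(\<lambda>\<omega>. A \<omega> $$ (i, q i)) \<in> borel_measurable M" if "q permutes {0..<d}" "i \<in> {0..<d}" for q i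
    using assms(2)[of i "q i"] permutes_in_image[OF that(1), of i] that(2) by simp
  then show ?thesis
    unfolding det_def'[OF assms(1)]
    by (intro borel_measurable_sum borel_measurable_times borel_measurable_prod) auto
qed

lemma borel_measurable_cofactor:
  assumes "\<And>\<omega>. A \<omega> \<in> carrier_mat d d" "i < d" "j < d"
    and "\<And>r s. r < d \<Longrightarrow> s < d \<Longrightarrow> (\<lambda>\<omega>. A \<omega> $$ (r, s)) \<in> borel_measurable M"
  shows "(\<lambda>\<omega>. cofactor (A \<omega> :: real mat) i j) \<in> borel_measurable M"
  unfolding cofactor_def
proof (intro borel_measurable_times borel_measurable_const borel_measurable_det[of _ "d - 1"])
  show "mat_delete (A \<omega>) i j \<in> carrier_mat (d - 1) (d - 1)" for \<omega>
    using mat_delete_carrier[OF assms(1), of \<omega> i j] .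
  fix r s assume rs: "r < d - 1" "s < d - 1"
  have d: "d = Suc (d - 1)" using assms by simp
  have "mat_delete (A \<omega>) i j $$ (r, s) = A \<omega> $$ (insert_index i r, insert_index j s)" for \<omega>
    using mat_delete_index[of "A \<omega>" "d - 1" i j r s] assms rs d by simp
  moreover have "insert_index i r < d" "insert_index j s < d"
    using rs by (auto simp: insert_index_def)
  ultimately show "(\<lambda>\<omega>. mat_delete (A \<omega>) i j $$ (r, s)) \<in> borel_measurable M"
    using assms(4) by simp
qed

lemma borel_measurable_inv_quad_form:
  assumes "\<And>\<omega>. A \<omega> \<in> carrier_mat d d" "\<And>\<omega>. v \<omega> \<in> carrier_vec d"
    and "\<And>r s. r < d \<Longrightarrow> s < d \<Longrightarrow> (\<lambda>\<omega>. A \<omega> $$ (r, s)) \<in> borel_measurable M"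
    and "\<And>r. r < d \<Longrightarrow> (\<lambda>\<omega>. vec_index (v \<omega>) r) \<in> borel_measurable M"
  shows "(\<lambda>\<omega>. inv_quad_form (A \<omega>) (v \<omega>)) \<in> borel_measurable M"
  unfolding inv_quad_form_adj[OF assms(1,2)]
  by (intro borel_measurable_sum borel_measurable_times borel_measurable_divide
      borel_measurable_det[of _ d] borel_measurable_cofactor[of _ d] assms) auto

text \<open>\<open>H\<close> reduces the reference matrix \<open>S\<close> to the identity, and
  \<open>A\<close> is an entrywise perturbation of \<open>S\<close>. Entry bounds and the l1 norm
  keep all constants explicit in \<open>d\<close> and \<open>h\<close>; \<open>small\<close> is the
  condition under which the perturbation operator has l1 norm at most \<open>1/2\<close>.\<close>

locale near_congruence =
  fixes d :: nat and A :: "real mat" and H S :: "nat \<Rightarrow> nat \<Rightarrow> real" and h \<epsilon> :: real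
  assumes A: "A \<in> carrier_mat d d"
    and HSH: "\<And>r r'. r < d \<Longrightarrow> r' < d \<Longrightarrow>
      (\<Sum>s<d. \<Sum>s'<d. H r s * S s s' * H r' s') = of_bool (r = r')"
    and H_le: "\<And>r s. r < d \<Longrightarrow> s < d \<Longrightarrow> \<bar>H r s\<bar> \<le> h"
    and near: "\<And>r s. r < d \<Longrightarrow> s < d \<Longrightarrow> \<bar>A $$ (r, s) - S r s\<bar> \<le> \<epsilon>"
    and h_nonneg: "0 \<le> h" and \<epsilon>_nonneg: "0 \<le> \<epsilon>"
    and small: "(real d)\<^sup>2 * (real d * h\<^sup>2) * \<epsilon> \<le> 1 / 2"
begin

definition "B r s = (\<Sum>q<d. H q r * H q s)"
definition "\<beta> = real d * h\<^sup>2"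
definition "E r s = A $$ (r, s) - S r s"

lemma \<beta>_nonneg: "0 \<le> \<beta>"
  by (simp add: \<beta>_def)

lemma B_le: "r < d \<Longrightarrow> s < d \<Longrightarrow> \<bar>B r s\<bar> \<le> \<beta>"
proof -
  assume rs: "r < d" "s < d"
  have "\<bar>B r s\<bar> \<le> (\<Sum>q<d. h * h)"
    unfolding B_def using rs
    by (intro order_trans[OF sum_abs] sum_mono) (auto simp: abs_mult h_nonneg intro!: mult_mono H_le)
  then show ?thesis by (simp add: \<beta>_def power2_eq_square)
qed

text \<open>
  By \<open>HSH\<close>, \<open>B = H\<^sup>T H\<close> inverts \<open>S\<close>, so \<open>x = B (A x) - B E x\<close>, and \<open>B E\<close> is a contraction.
\<close>

definition "BE x r = (\<Sum>s<d. B r s * (\<Sum>q<d. E s q * x q))"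

lemma BE_le: "r < d \<Longrightarrow> \<bar>BE x r\<bar> \<le> real d * \<beta> * \<epsilon> * (\<Sum>q<d. \<bar>x q\<bar>)"
proof -
  assume r: "r < d"
  have e: "\<bar>\<Sum>q<d. E s q * x q\<bar> \<le> \<epsilon> * (\<Sum>q<d. \<bar>x q\<bar>)" if "s < d" for s
    unfolding sum_distrib_left using that
    by (intro order_trans[OF sum_abs] sum_mono) (auto simp: abs_mult E_def intro!: mult_right_mono near)
  have "\<bar>BE x r\<bar> \<le> (\<Sum>s<d. \<beta> * (\<epsilon> * (\<Sum>q<d. \<bar>x q\<bar>)))"
    unfolding BE_def using r
    by (intro order_trans[OF sum_abs] sum_mono)
      (auto simp: abs_mult \<beta>_nonneg intro!: mult_mono B_le e)
  then show ?thesis by (simp add: mult_ac)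
qed

lemma solution_eq:
  assumes "r < d"
  shows "x r = (\<Sum>s<d. B r s * (\<Sum>q<d. A $$ (s, q) * x q)) - BE x r"
proof -
  have "(\<Sum>s<d. B r s * (\<Sum>q<d. A $$ (s, q) * x q)) - BE x r = (\<Sum>s<d. \<Sum>q<d. B r s * S s q * x q)"
    by (simp add: BE_def E_def sum_subtractf[symmetric] sum_distrib_left algebra_simps)
  also have "\<dots> = (\<Sum>q<d. (\<Sum>s<d. B r s * S s q) * x q)"
    by (subst sum.swap) (simp add: sum_distrib_right)
  also have "\<dots> = (\<Sum>q<d. if r = q then x q else 0)"
    unfolding B_def using assms by (intro sum.cong refl) (auto simp: inverse_of_congruence[OF HSH])
  finally show ?thesis using assms by simp
qed

lemma sum_BE_le: "(\<Sum>r<d. \<bar>BE x r\<bar>) \<le> (\<Sum>r<d. \<bar>x r\<bar>) / 2"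
proof -
  have "(\<Sum>r<d. \<bar>BE x r\<bar>) \<le> (\<Sum>r<d. real d * \<beta> * \<epsilon> * (\<Sum>q<d. \<bar>x q\<bar>))"
    by (intro sum_mono BE_le) auto
  also have "\<dots> = (real d)\<^sup>2 * \<beta> * \<epsilon> * (\<Sum>q<d. \<bar>x q\<bar>)"
    by (simp add: power2_eq_square)
  also have "\<dots> \<le> 1 / 2 * (\<Sum>q<d. \<bar>x q\<bar>)"
    using small by (intro mult_right_mono) (auto simp: \<beta>_def intro!: sum_nonneg)
  finally show ?thesis by simp
qed

text \<open>A kernel vector equals minus its own image under a map that at least halves the l1 norm,
  so it vanishes.\<close>

lemma det_nonzero: "Determinant.det A \<noteq> 0"
proof
  assume "Determinant.det A = 0"
  then obtain v where v: "v \<in> carrier_vec d" "v \<noteq> 0\<^sub>v d" "A *\<^sub>v v = 0\<^sub>v d"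
    using det_0_iff_vec_prod_zero_field[OF A] by blast
  have z: "(\<Sum>q<d. A $$ (s, q) * vec_index v q) = 0" if "s < d" for s
  proof -
    have "vec_index (A *\<^sub>v v) s = 0" using v(3) that by simp
    then show ?thesis using mult_mat_vec_index[OF A v(1) that] by simp
  qed
  have "vec_index v r = - BE (\<lambda>q. vec_index v q) r" if "r < d" for r
    using solution_eq[OF that, of "\<lambda>q. vec_index v q"] by (simp add: z)
  then have "(\<Sum>r<d. \<bar>vec_index v r\<bar>) = (\<Sum>r<d. \<bar>BE (\<lambda>q. vec_index v q) r\<bar>)"
    by (intro sum.cong refl) (metis abs_minus_cancel lessThan_iff)
  then have "(\<Sum>r<d. \<bar>vec_index v r\<bar>) \<le> 0"
    using sum_BE_le[of "\<lambda>q. vec_index v q"] by simp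
  then have "(\<Sum>r<d. \<bar>vec_index v r\<bar>) = 0"
    by (intro antisym sum_nonneg) auto
  then have "vec_index v r = 0" if "r < d" for r
    using that by (subst (asm) sum_nonneg_eq_0_iff) auto
  then have "v = 0\<^sub>v d" using v(1) by (intro eq_vecI) auto
  then show False using v(2) by simp
qed

lemma invertible: "invertible_mat A"
  using det_nonzero invertible_mat_iff_det_nonzero[OF A] by simp

text \<open>If \<open>x\<close> solves \<open>A x = v\<close>, the form is
  \<open>v' B v - v' B E x\<close>, and \<open>v' B v\<close> is the squared length of
  \<open>H v\<close>. The contraction bounds the l1 norm of \<open>x\<close> by twice that of
  \<open>B v\<close>, which is the origin of the factor 2.\<close>

lemma inv_quad_form_near:
  assumes v: "v \<in> carrier_vec d"
  shows "\<bar>inv_quad_form A v - (\<Sum>r<d. (\<Sum>s<d. H r s * vec_index v s)\<^sup>2)\<bar>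
    \<le> 2 * (real d * \<beta>)\<^sup>2 * \<epsilon> * (\<Sum>s<d. \<bar>vec_index v s\<bar>)\<^sup>2"
proof -
  obtain Bi where Bi: "mat_inverse A = Some Bi" "Bi \<in> carrier_mat d d" "A * Bi = 1\<^sub>m d" "Bi * A = 1\<^sub>m d"
    by (rule mat_inverse_det_nonzero[OF A det_nonzero])
  define xv where "xv = Bi *\<^sub>v v"
  define x where "x q = vec_index xv q" for q
  have "A *\<^sub>v xv = v"
    unfolding xv_def using assoc_mult_mat_vec[OF A Bi(2) v] Bi(3) v by simp
  then have Ax: "(\<Sum>q<d. A $$ (s, q) * x q) = vec_index v s" if "s < d" for s
    using mult_mat_vec_index[OF A _ that, of xv] Bi(2) v unfolding x_def by (simp add: xv_def)
  have x: "x r = (\<Sum>s<d. B r s * vec_index v s) - BE x r" if "r < d" for r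
    using solution_eq[OF that, of x] by (simp add: Ax)
  let ?n = "\<Sum>s<d. \<bar>vec_index v s\<bar>" and ?m = "\<Sum>s<d. \<bar>x s\<bar>"
  have n0: "0 \<le> ?n" "0 \<le> ?m" by (auto intro: sum_nonneg)
  have "\<bar>\<Sum>s<d. B r s * vec_index v s\<bar> \<le> \<beta> * ?n" if "r < d" for r
    unfolding sum_distrib_left using that
    by (intro order_trans[OF sum_abs] sum_mono) (auto simp: abs_mult intro!: mult_right_mono B_le)
  then have "?m \<le> (\<Sum>r<d. \<beta> * ?n + \<bar>BE x r\<bar>)"
    using x by (intro sum_mono) (smt (verit) lessThan_iff)
  also have "\<dots> \<le> real d * (\<beta> * ?n) + ?m / 2"
    using sum_BE_le[of x] by (simp add: sum.distrib)
  finally have m: "?m \<le> 2 * (real d * (\<beta> * ?n))" by simp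
  have "inv_quad_form A v = (\<Sum>r<d. vec_index v r * x r)"
    using Bi v by (simp add: inv_quad_form_def xv_def x_def scalar_prod_def atLeast0LessThan)
  also have "\<dots> = (\<Sum>r<d. vec_index v r * (\<Sum>s<d. B r s * vec_index v s)) - (\<Sum>r<d. vec_index v r * BE x r)"
    using x by (simp add: sum_subtractf[symmetric] right_diff_distrib[symmetric])
  also have "(\<Sum>r<d. vec_index v r * (\<Sum>s<d. B r s * vec_index v s)) = (\<Sum>r<d. (\<Sum>s<d. H r s * vec_index v s)\<^sup>2)"
  proof -
    have "(\<Sum>r<d. vec_index v r * (\<Sum>s<d. B r s * vec_index v s)) = (\<Sum>r<d. \<Sum>s<d. \<Sum>q<d. (H q r * vec_index v r) * (H q s * vec_index v s))"
      by (simp add: B_def sum_distrib_left sum_distrib_right mult_ac)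
    also have "\<dots> = (\<Sum>r<d. \<Sum>q<d. \<Sum>s<d. (H q r * vec_index v r) * (H q s * vec_index v s))"
      by (intro sum.cong refl sum.swap)
    also have "\<dots> = (\<Sum>q<d. \<Sum>r<d. \<Sum>s<d. (H q r * vec_index v r) * (H q s * vec_index v s))"
      by (rule sum.swap)
    finally show ?thesis by (simp add: power2_eq_square sum_product)
  qed
  finally have "\<bar>inv_quad_form A v - (\<Sum>r<d. (\<Sum>s<d. H r s * vec_index v s)\<^sup>2)\<bar> = \<bar>\<Sum>r<d. vec_index v r * BE x r\<bar>"
    by simp
  also have "\<dots> \<le> (\<Sum>r<d. \<bar>vec_index v r\<bar> * (real d * \<beta> * \<epsilon> * ?m))"
    by (intro order_trans[OF sum_abs] sum_mono) (auto simp: abs_mult intro!: mult_left_mono BE_le)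
  also have "\<dots> = ?n * (real d * \<beta> * \<epsilon> * ?m)"
    by (simp add: sum_distrib_right)
  also have "\<dots> \<le> ?n * (real d * \<beta> * \<epsilon> * (2 * (real d * (\<beta> * ?n))))"
    using m n0 \<beta>_nonneg \<epsilon>_nonneg by (intro mult_left_mono) auto
  also have "\<dots> = 2 * (real d * \<beta>)\<^sup>2 * \<epsilon> * ?n\<^sup>2"
    by (simp add: power2_eq_square mult_ac)
  finally show ?thesis .
qed

end

section \<open>An orthonormal basis of the centred functions\<close>

locale pos_law = finite_law +
  assumes p_pos: "k \<in> {1..K} \<Longrightarrow> 0 < p k" and K_ge: "2 \<le> K"
begin

definition tail :: "nat \<Rightarrow> real" where "tail a = (\<Sum>k\<in>{a<..K}. p k)"

lemma tail_rec: "a \<in> {1..K} \<Longrightarrow> tail (a - 1) = p a + tail a"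
proof -
  assume "a \<in> {1..K}"
  then have "{a - 1<..K} = insert a {a<..K}" by auto
  then show ?thesis by (simp add: tail_def)
qed

lemma tail_pos: "a < K \<Longrightarrow> 0 < tail a"
  unfolding tail_def by (rule sum_pos) (auto intro!: p_pos)

text \<open>Helmert contrasts for the weights \<open>p\<close>: \<open>helm a\<close> compares level \<open>a\<close> with the levels above \<open>a\<close>.\<close>

definition helm_at :: "nat \<Rightarrow> real" where
  "helm_at a = sqrt (tail a) / (sqrt (p a) * sqrt (tail (a - 1)))"

definition helm_above :: "nat \<Rightarrow> real" where
  "helm_above a = - sqrt (p a) / (sqrt (tail a) * sqrt (tail (a - 1)))"

definition helm :: "nat \<Rightarrow> nat \<Rightarrow> real" where
  "helm a k = (if k < a then 0 else if k = a then helm_at a else helm_above a)"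

lemma sum_helm:
  assumes a: "a \<in> {1..K}"
  shows "(\<Sum>k=1..K. p k * (helm a k * f k)) = p a * (helm_at a * f a) + helm_above a * (\<Sum>k\<in>{a<..K}. p k * f k)"
proof -
  have "{1..K} = {1..<a} \<union> insert a {a<..K}" using a by auto
  then have "(\<Sum>k=1..K. p k * (helm a k * f k)) = (\<Sum>k\<in>{1..<a} \<union> insert a {a<..K}. p k * (helm a k * f k))"
    by simp
  also have "\<dots> = (\<Sum>k\<in>{1..<a}. p k * (helm a k * f k)) + (\<Sum>k\<in>insert a {a<..K}. p k * (helm a k * f k))"
    by (rule sum.union_disjoint) auto
  also have "(\<Sum>k\<in>{1..<a}. p k * (helm a k * f k)) = 0"
    by (intro sum.neutral) (auto simp: helm_def)
  also have "(\<Sum>k\<in>insert a {a<..K}. p k * (helm a k * f k)) = p a * (helm a a * f a) + (\<Sum>k\<in>{a<..K}. p k * (helm a k * f k))"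
    by simp
  also have "(\<Sum>k\<in>{a<..K}. p k * (helm a k * f k)) = helm_above a * (\<Sum>k\<in>{a<..K}. p k * f k)"
    unfolding sum_distrib_left by (intro sum.cong) (auto simp: helm_def)
  finally show ?thesis by (simp add: helm_def)
qed

text \<open>The two values are the solution of these equations: mean zero and unit variance for a
  function that vanishes below \<open>a\<close> and is constant above. The range stops at
  \<open>K - 1\<close> to keep \<open>tail a\<close> positive.\<close>

lemma helm_balance:
  assumes a: "a \<in> {1..K-1}"
  shows "p a * helm_at a + tail a * helm_above a = 0"
    and "p a * helm_at a ^ 2 + tail a * helm_above a ^ 2 = 1"
proof -
  define x where "x = sqrt (p a)"
  define y where "y = sqrt (tail a)"
  define z where "z = sqrt (tail (a - 1))"
  have pos: "0 < p a" "0 < tail a" using a by (auto intro!: p_pos tail_pos)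
  have "a \<in> {1..K}" using a by auto
  note t = tail_rec[OF this]
  have xyz: "0 < x" "0 < y" "0 < z" using pos t by (auto simp: x_def y_def z_def)
  have sq: "p a = x\<^sup>2" "tail a = y\<^sup>2" "z\<^sup>2 = x\<^sup>2 + y\<^sup>2"
    using pos t by (auto simp: x_def y_def z_def)
  have h: "helm_at a = y / (x * z)" "helm_above a = - x / (y * z)"
    by (simp_all add: helm_at_def helm_above_def x_def y_def z_def)
  show "p a * helm_at a + tail a * helm_above a = 0"
    unfolding h sq(1,2) using xyz by (simp add: field_simps power2_eq_square)
  have "p a * helm_at a ^ 2 + tail a * helm_above a ^ 2 = (y\<^sup>2 + x\<^sup>2) / z\<^sup>2"
    unfolding h sq(1,2) using xyz by (simp add: field_simps power2_eq_square)
  also have "\<dots> = 1" using sq(3) xyz by simp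
  finally show "p a * helm_at a ^ 2 + tail a * helm_above a ^ 2 = 1" .
qed

lemma sum_p_helm: "a \<in> {1..K-1} \<Longrightarrow> (\<Sum>k=1..K. p k * helm a k) = 0"
proof -
  assume a: "a \<in> {1..K-1}"
  then have "a \<in> {1..K}" by auto
  from sum_helm[OF this, of "\<lambda>_. 1"] show ?thesis
    using helm_balance(1)[OF a] by (simp add: tail_def mult.commute)
qed

text \<open>On the levels where \<open>helm b\<close> does not vanish, \<open>helm a\<close> is
  constant, so only the mean of \<open>helm b\<close> remains.\<close>

lemma sum_p_helm_helm_less:
  assumes ab: "a \<in> {1..K-1}" "b \<in> {1..K-1}" "a < b"
  shows "(\<Sum>k=1..K. p k * (helm a k * helm b k)) = 0"
proof -
  have "(\<Sum>k=1..K. p k * (helm a k * helm b k)) = (\<Sum>k=1..K. helm_above a * (p k * helm b k))"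
    using ab by (intro sum.cong) (auto simp: helm_def)
  then show ?thesis
    using sum_p_helm[OF ab(2)] by (simp only: sum_distrib_left[symmetric])
qed

lemma sum_p_helm_helm:
  assumes a: "a \<in> {1..K-1}" and b: "b \<in> {1..K-1}"
  shows "(\<Sum>k=1..K. p k * (helm a k * helm b k)) = of_bool (a = b)"
proof -
  consider "a < b" | "b < a" | "a = b" by linarith
  then show ?thesis
  proof cases
    case 1
    then show ?thesis using sum_p_helm_helm_less[OF a b] by simp
  next
    case 2
    then show ?thesis using sum_p_helm_helm_less[OF b a] by (simp add: mult.commute[of "helm a _"])
  next
    case 3
    have "a \<in> {1..K}" using a by auto
    from sum_helm[OF this, of "helm a"]
    have "(\<Sum>k=1..K. p k * (helm a k * helm a k)) = p a * (helm_at a * helm a a) + helm_above a * (\<Sum>k\<in>{a<..K}. p k * helm a k)" .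
    also have "(\<Sum>k\<in>{a<..K}. p k * helm a k) = tail a * helm_above a"
      unfolding tail_def sum_distrib_right by (intro sum.cong) (auto simp: helm_def)
    also have "p a * (helm_at a * helm a a) + helm_above a * (tail a * helm_above a) = 1"
      using helm_balance(2)[OF a] by (simp add: helm_def power2_eq_square mult_ac)
    finally show ?thesis using 3 by simp
  qed
qed

text \<open>Coefficients of \<open>helm a\<close> in \<open>cind 1, ..., cind (K - 1)\<close>, the
  functions available in \<open>P_vec\<close>. Subtracting the value at \<open>K\<close> removes
  \<open>cind K\<close>; shifting all coefficients changes nothing because the \<open>cind k\<close>
  sum to zero over \<open>k\<close>.\<close>

definition contrast :: "nat \<Rightarrow> nat \<Rightarrow> real" where
  "contrast a k = helm a k - helm a K"

lemma helm_eq_cind: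
  assumes a: "a \<in> {1..K-1}" and x: "x \<in> {1..K}"
  shows "helm a x = (\<Sum>k=1..K-1. contrast a k * cind k x)"
proof -
  have Ks: "{1..K} = insert K {1..K-1}" using K_ge by auto
  have "(\<Sum>k=1..K-1. contrast a k * cind k x) = (\<Sum>k=1..K. contrast a k * cind k x)"
    unfolding Ks using K_ge by (simp add: contrast_def del: One_nat_def)
  also have "\<dots> = (\<Sum>k=1..K. contrast a k * of_bool (x = k)) - (\<Sum>k=1..K. p k * contrast a k)"
    by (simp add: cind_def right_diff_distrib sum_subtractf mult.commute[of "p _"])
  also have "(\<Sum>k=1..K. contrast a k * of_bool (x = k)) = contrast a x"
  proof -
    have "(\<Sum>k=1..K. contrast a k * of_bool (x = k)) = (\<Sum>k=1..K. if x = k then contrast a k else 0)"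
      by (intro sum.cong) auto
    then show ?thesis using x by simp
  qed
  also have "(\<Sum>k=1..K. p k * contrast a k) = - helm a K"
  proof -
    have "(\<Sum>k=1..K. p k * contrast a k) = (\<Sum>k=1..K. p k * helm a k) - (\<Sum>k=1..K. p k) * helm a K"
      by (simp add: contrast_def right_diff_distrib sum_subtractf sum_distrib_right)
    then show ?thesis using sum_p_helm[OF a] sum_p by simp
  qed
  finally show ?thesis by (simp add: contrast_def)
qed

definition helm_max :: real where
  "helm_max = (\<Sum>a=1..K-1. \<Sum>k=1..K. \<bar>helm a k\<bar>)"

lemma helm_max_nonneg: "0 \<le> helm_max"
  unfolding helm_max_def by (intro sum_nonneg) auto

lemma helm_le: "a \<in> {1..K-1} \<Longrightarrow> k \<in> {1..K} \<Longrightarrow> \<bar>helm a k\<bar> \<le> helm_max"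
proof -
  assume ak: "a \<in> {1..K-1}" "k \<in> {1..K}"
  have "\<bar>helm a k\<bar> \<le> (\<Sum>k=1..K. \<bar>helm a k\<bar>)"
    by (rule member_le_sum[OF ak(2)]) auto
  also have "\<dots> \<le> helm_max"
    unfolding helm_max_def by (rule member_le_sum[OF ak(1), of "\<lambda>a. \<Sum>k=1..K. \<bar>helm a k\<bar>"]) (auto intro: sum_nonneg)
  finally show ?thesis .
qed

section \<open>Decorrelating the pair frequencies\<close>

definition row_ix :: "nat \<Rightarrow> nat" where "row_ix r = r mod (K - 1) + 1"
definition col_ix :: "nat \<Rightarrow> nat" where "col_ix r = r div (K - 1) + 1"

lemma ix_range:
  assumes "r < (K - 1)\<^sup>2"
  shows "row_ix r \<in> {1..K-1}" "col_ix r \<in> {1..K-1}"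
proof -
  have K: "0 < K - 1" using K_ge by simp
  show "row_ix r \<in> {1..K-1}" using mod_less_divisor[OF K, of r] by (simp add: row_ix_def)
  have "r div (K - 1) < K - 1"
    using assms by (intro less_mult_imp_div_less) (simp add: power2_eq_square)
  then show "col_ix r \<in> {1..K-1}" by (simp add: col_ix_def)
qed

lemma ix_range_K:
  assumes "r < (K - 1)\<^sup>2"
  shows "row_ix r \<in> {1..K}" "col_ix r \<in> {1..K}"
  using ix_range[OF assms] by auto

lemma pair_index_ix: "pair_index K (row_ix r) (col_ix r) = r"
  unfolding pair_index_def row_ix_def col_ix_def add_diff_cancel_right' by (rule div_mult_mod_eq)

lemma ix_eq_iff: "row_ix r = row_ix s \<and> col_ix r = col_ix s \<longleftrightarrow> r = s"
  using pair_index_ix[of r] pair_index_ix[of s] by metis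

lemma sum_ix:
  "(\<Sum>r<(K - 1)\<^sup>2. f (row_ix r) (col_ix r)) = (\<Sum>k=1..K-1. \<Sum>l=1..K-1. f k l)"
  unfolding sum.cartesian_product
proof (rule sum.reindex_bij_witness[where i = "\<lambda>(k, l). pair_index K k l" and j = "\<lambda>r. (row_ix r, col_ix r)"])
  fix b assume b: "b \<in> {1..K-1} \<times> {1..K-1}"
  then obtain k l where kl: "b = (k, l)" "k \<in> {1..K-1}" "l \<in> {1..K-1}" by auto
  show "(row_ix (case b of (k, l) \<Rightarrow> pair_index K k l), col_ix (case b of (k, l) \<Rightarrow> pair_index K k l)) = b"
    using pair_index_inverse(2,3)[OF kl(2,3)] by (simp add: kl(1) row_ix_def col_ix_def)
  show "(case b of (k, l) \<Rightarrow> pair_index K k l) \<in> {..<(K - 1)\<^sup>2}"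
    using pair_index_inverse(1)[OF kl(2,3)] kl(1) by simp
qed (use ix_range in \<open>auto simp: pair_index_ix simp del: One_nat_def atLeastAtMost_iff\<close>)

text \<open>
  On the span of the \<open>cind2 k l\<close> the form \<open>form w\<close> is the tensor square of the covariance form
  composed with \<open>I + w \<cdot> swap\<close>, which has the eigenvalues \<open>1 \<plusminus> w\<close> on symmetric and antisymmetric
  functions. \<open>decorr w r\<close> is the image of a Helmert tensor under \<open>(I + w \<cdot> swap) powr (- 1/2)\<close>.
\<close>

definition sym_coef :: "real \<Rightarrow> real" where
  "sym_coef w = (1 / sqrt (1 + w) + 1 / sqrt (1 - w)) / 2"

definition swap_coef :: "real \<Rightarrow> real" where
  "swap_coef w = (1 / sqrt (1 + w) - 1 / sqrt (1 - w)) / 2"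

definition helm2 :: "nat \<Rightarrow> nat \<Rightarrow> nat \<Rightarrow> nat \<Rightarrow> real" where
  "helm2 a b x y = helm a x * helm b y"

definition decorr :: "real \<Rightarrow> nat \<Rightarrow> nat \<Rightarrow> nat \<Rightarrow> real" where
  "decorr w r x y = sym_coef w * helm2 (row_ix r) (col_ix r) x y + swap_coef w * helm2 (col_ix r) (row_ix r) x y"

text \<open>The coordinates of \<open>decorr w r\<close> in the basis \<open>cind2\<close>: the
  matrix applied to \<open>P_vec\<close>, and the \<open>H\<close> of the perturbation
  argument.\<close>

definition decorr_mat :: "real \<Rightarrow> nat \<Rightarrow> nat \<Rightarrow> real" where
  "decorr_mat w r s = sym_coef w * (contrast (row_ix r) (row_ix s) * contrast (col_ix r) (col_ix s))
    + swap_coef w * (contrast (col_ix r) (row_ix s) * contrast (row_ix r) (col_ix s))"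

text \<open>These are the two coefficients in \<open>(\<alpha> + \<beta> \<cdot> swap)\<^sup>2 (1 +
  w \<cdot> swap) = 1\<close>, compared using that the swap squares to the identity.\<close>

lemma coef_eqs:
  assumes w: "0 \<le> w" "w < 1"
  defines "\<alpha> \<equiv> sym_coef w" and "\<beta> \<equiv> swap_coef w"
  shows "\<alpha>\<^sup>2 + \<beta>\<^sup>2 + 2 * \<alpha> * \<beta> * w = 1" "(\<alpha>\<^sup>2 + \<beta>\<^sup>2) * w + 2 * \<alpha> * \<beta> = 0"
proof -
  define s where "s = 1 / sqrt (1 + w)"
  define t where "t = 1 / sqrt (1 - w)"
  have s: "s\<^sup>2 * (1 + w) = 1" and t: "t\<^sup>2 * (1 - w) = 1"
    using w by (auto simp: s_def t_def power_divide)
  have ab: "\<alpha> = (s + t) / 2" "\<beta> = (s - t) / 2"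
    by (simp_all add: \<alpha>_def \<beta>_def sym_coef_def swap_coef_def s_def t_def)
  have "\<alpha>\<^sup>2 + \<beta>\<^sup>2 + 2 * \<alpha> * \<beta> * w = (s\<^sup>2 * (1 + w) + t\<^sup>2 * (1 - w)) / 2"
    unfolding ab by (simp add: power2_eq_square field_simps)
  then show "\<alpha>\<^sup>2 + \<beta>\<^sup>2 + 2 * \<alpha> * \<beta> * w = 1" unfolding s t by simp
  have "(\<alpha>\<^sup>2 + \<beta>\<^sup>2) * w + 2 * \<alpha> * \<beta> = (s\<^sup>2 * (1 + w) - t\<^sup>2 * (1 - w)) / 2"
    unfolding ab by (simp add: power2_eq_square field_simps)
  then show "(\<alpha>\<^sup>2 + \<beta>\<^sup>2) * w + 2 * \<alpha> * \<beta> = 0" unfolding s t by simp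
qed

lemma form_helm2:
  assumes "a \<in> {1..K-1}" "b \<in> {1..K-1}" "a' \<in> {1..K-1}" "b' \<in> {1..K-1}"
  shows "form w (helm2 a b) (helm2 a' b') = of_bool (a = a' \<and> b = b') + w * of_bool (a = b' \<and> b = a')"
  unfolding helm2_def[abs_def] form_product using assms by (simp only: sum_p_helm_helm of_bool_conj)

lemma form_two_left:
  "form w (\<lambda>x y. c * \<phi> x y + d * \<phi>' x y) \<theta> = c * form w \<phi> \<theta> + d * form w \<phi>' \<theta>"
  unfolding form_def by (simp add: sum_distrib_left sum.distrib[symmetric] algebra_simps)

lemma form_two_right:
  "form w \<theta> (\<lambda>x y. c * \<phi> x y + d * \<phi>' x y) = c * form w \<theta> \<phi> + d * form w \<theta> \<phi>'"
  unfolding form_sym[of w \<theta>] form_two_left ..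

lemma form_decorr:
  assumes w: "0 \<le> w" "w < 1" and r: "r < (K - 1)\<^sup>2" "r' < (K - 1)\<^sup>2"
  shows "form w (decorr w r) (decorr w r') = of_bool (r = r')"
proof -
  let ?\<alpha> = "sym_coef w" and ?\<beta> = "swap_coef w"
  let ?e = "of_bool (row_ix r = row_ix r' \<and> col_ix r = col_ix r') :: real"
  let ?f = "of_bool (row_ix r = col_ix r' \<and> col_ix r = row_ix r') :: real"
  have c: "(col_ix r = col_ix r' \<and> row_ix r = row_ix r') = (row_ix r = row_ix r' \<and> col_ix r = col_ix r')"
    "(col_ix r = row_ix r' \<and> row_ix r = col_ix r') = (row_ix r = col_ix r' \<and> col_ix r = row_ix r')" by auto
  have "form w (decorr w r) (decorr w r') =
      ?\<alpha> * (?\<alpha> * (?e + w * ?f) + ?\<beta> * (?f + w * ?e)) + ?\<beta> * (?\<alpha> * (?f + w * ?e) + ?\<beta> * (?e + w * ?f))"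
    unfolding decorr_def[abs_def] form_two_left form_two_right
    using ix_range[OF r(1)] ix_range[OF r(2)] by (simp only: form_helm2 c)
  also have "\<dots> = (?\<alpha>\<^sup>2 + ?\<beta>\<^sup>2 + 2 * ?\<alpha> * ?\<beta> * w) * ?e + ((?\<alpha>\<^sup>2 + ?\<beta>\<^sup>2) * w + 2 * ?\<alpha> * ?\<beta>) * ?f"
    by (simp add: power2_eq_square algebra_simps)
  also have "\<dots> = ?e" unfolding coef_eqs[OF w] by simp
  finally show ?thesis by (simp add: ix_eq_iff)
qed

lemma decorr_eq:
  assumes r: "r < (K - 1)\<^sup>2" and xy: "x \<in> {1..K}" "y \<in> {1..K}"
  shows "decorr w r x y = (\<Sum>s<(K - 1)\<^sup>2. decorr_mat w r s * cind2 (row_ix s) (col_ix s) x y)"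
proof -
  let ?a = "row_ix r" and ?b = "col_ix r"
  have h: "helm2 a b x y = (\<Sum>k=1..K-1. \<Sum>l=1..K-1. contrast a k * contrast b l * cind2 k l x y)"
    if "a \<in> {1..K-1}" "b \<in> {1..K-1}" for a b
    unfolding helm2_def helm_eq_cind[OF that(1) xy(1)] helm_eq_cind[OF that(2) xy(2)] sum_product
    by (simp add: cind2_def mult_ac)
  have "(\<Sum>s<(K - 1)\<^sup>2. decorr_mat w r s * cind2 (row_ix s) (col_ix s) x y)
      = (\<Sum>k=1..K-1. \<Sum>l=1..K-1. (sym_coef w * (contrast ?a k * contrast ?b l)
         + swap_coef w * (contrast ?b k * contrast ?a l)) * cind2 k l x y)"
    unfolding decorr_mat_def by (rule sum_ix)
  also have "\<dots> = decorr w r x y"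
    unfolding decorr_def h[OF ix_range[OF r]] h[OF ix_range(2)[OF r] ix_range(1)[OF r]]
    by (simp add: sum_distrib_left sum.distrib[symmetric] algebra_simps)
  finally show ?thesis ..
qed

lemma degenerate_decorr: "r < (K - 1)\<^sup>2 \<Longrightarrow> degenerate (decorr w r)"
proof -
  assume r: "r < (K - 1)\<^sup>2"
  have "degenerate (\<lambda>x y. \<Sum>s<(K - 1)\<^sup>2. decorr_mat w r s * cind2 (row_ix s) (col_ix s) x y)"
    by (intro degenerate_sum degenerate_cind2) (use ix_range_K in auto)
  then show ?thesis
    using decorr_eq[OF r] unfolding degenerate_def by simp
qed

text \<open>Orthonormality of the kernels \<open>decorr w r\<close> for \<open>form w\<close>,
  written in the coordinates \<open>cind2\<close>, whose Gram matrix is the explicit covariance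
  matrix.\<close>

lemma decorr_mat_congruence:
  assumes w: "0 \<le> w" "w < 1" and r: "r < (K - 1)\<^sup>2" "r' < (K - 1)\<^sup>2"
  shows "(\<Sum>s<(K - 1)\<^sup>2. \<Sum>s'<(K - 1)\<^sup>2. decorr_mat w r s
      * Sigma_formula p w (row_ix s) (col_ix s) (row_ix s') (col_ix s') * decorr_mat w r' s') = of_bool (r = r')"
proof -
  let ?d = "(K - 1)\<^sup>2" and ?c = "\<lambda>s. cind2 (row_ix s) (col_ix s)"
  have "of_bool (r = r') = form w (decorr w r) (decorr w r')"
    using form_decorr[OF w r] by simp
  also have "\<dots> = form w (\<lambda>x y. \<Sum>s<?d. decorr_mat w r s * ?c s x y) (\<lambda>x y. \<Sum>s<?d. decorr_mat w r' s * ?c s x y)"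
    by (rule form_cong) (simp_all only: decorr_eq r)
  also have "\<dots> = (\<Sum>s<?d. decorr_mat w r s * (\<Sum>s'<?d. decorr_mat w r' s' * form w (?c s) (?c s')))"
    unfolding form_sum_left form_sum_right ..
  also have "\<dots> = (\<Sum>s<?d. \<Sum>s'<?d. decorr_mat w r s
      * Sigma_formula p w (row_ix s) (col_ix s) (row_ix s') (col_ix s') * decorr_mat w r' s')"
    unfolding sum_distrib_left using ix_range_K
    by (intro sum.cong refl) (simp add: form_cind2 mult_ac del: One_nat_def)
  finally show ?thesis ..
qed

text \<open>Only \<open>1 / sqrt (1 - w)\<close> can blow up, when almost every edge is
  reciprocated; the gap \<open>b\<close> turns this into a bound that no longer depends on the
  graph.\<close>

lemma coef_le:
  assumes w: "0 \<le> w" "w \<le> 1 - b" and b: "0 < b"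
  shows "\<bar>sym_coef w\<bar> \<le> (1 + 1 / sqrt b) / 2" "\<bar>swap_coef w\<bar> \<le> (1 + 1 / sqrt b) / 2"
proof -
  have gen: "\<bar>(s + t) / 2\<bar> \<le> (1 + u) / 2 \<and> \<bar>(s - t) / 2\<bar> \<le> (1 + u) / 2"
    if "0 \<le> s" "s \<le> 1" "0 \<le> t" "t \<le> u" for s t u :: real
    using that by (auto simp: abs_le_iff)
  have "1 / sqrt (1 - w) \<le> 1 / sqrt b"
    using w b by (auto intro!: divide_left_mono)
  then have "\<bar>sym_coef w\<bar> \<le> (1 + 1 / sqrt b) / 2 \<and> \<bar>swap_coef w\<bar> \<le> (1 + 1 / sqrt b) / 2"
    unfolding sym_coef_def swap_coef_def using w b by (intro gen) auto
  then show "\<bar>sym_coef w\<bar> \<le> (1 + 1 / sqrt b) / 2" "\<bar>swap_coef w\<bar> \<le> (1 + 1 / sqrt b) / 2"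
    by auto
qed

lemma decorr_le:
  assumes w: "0 \<le> w" "w \<le> 1 - b" and b: "0 < b" and r: "r < (K - 1)\<^sup>2"
    and xy: "x \<in> {1..K}" "y \<in> {1..K}"
  shows "\<bar>decorr w r x y\<bar> \<le> (1 + 1 / sqrt b) * helm_max\<^sup>2"
proof -
  let ?c = "(1 + 1 / sqrt b) / 2"
  have h: "\<bar>helm2 a b x y\<bar> \<le> helm_max\<^sup>2" if "a \<in> {1..K-1}" "b \<in> {1..K-1}" for a b
    unfolding helm2_def abs_mult power2_eq_square using that xy helm_max_nonneg
    by (intro mult_mono helm_le) auto
  have t: "\<bar>c * z\<bar> \<le> ?c * helm_max\<^sup>2" if "\<bar>c\<bar> \<le> ?c" "\<bar>z\<bar> \<le> helm_max\<^sup>2" for c z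
    unfolding abs_mult by (intro mult_mono that) (use b in auto)
  have "\<bar>decorr w r x y\<bar> \<le> ?c * helm_max\<^sup>2 + ?c * helm_max\<^sup>2"
    unfolding decorr_def
    by (intro order_trans[OF abs_triangle_ineq] add_mono t h coef_le w b ix_range r)
  then show ?thesis by (simp add: field_simps)
qed

lemma contrast_le: "a \<in> {1..K-1} \<Longrightarrow> k \<in> {1..K} \<Longrightarrow> \<bar>contrast a k\<bar> \<le> 2 * helm_max"
  using helm_le[of a k] helm_le[of a K] K_ge unfolding contrast_def by auto

lemma decorr_mat_le:
  assumes w: "0 \<le> w" "w \<le> 1 - b" and b: "0 < b" and r: "r < (K - 1)\<^sup>2" "s < (K - 1)\<^sup>2"
  shows "\<bar>decorr_mat w r s\<bar> \<le> (1 + 1 / sqrt b) * (4 * helm_max\<^sup>2)"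
proof -
  let ?c = "(1 + 1 / sqrt b) / 2" and ?h = "4 * helm_max\<^sup>2"
  have h: "\<bar>contrast a k * contrast b l\<bar> \<le> ?h"
    if "a \<in> {1..K-1}" "b \<in> {1..K-1}" "k \<in> {1..K}" "l \<in> {1..K}" for a b k l
  proof -
    have "\<bar>contrast a k * contrast b l\<bar> \<le> (2 * helm_max) * (2 * helm_max)"
      unfolding abs_mult using that helm_max_nonneg by (intro mult_mono contrast_le) auto
    then show ?thesis by (simp add: power2_eq_square)
  qed
  have t: "\<bar>c * z\<bar> \<le> ?c * ?h" if "\<bar>c\<bar> \<le> ?c" "\<bar>z\<bar> \<le> ?h" for c z
    unfolding abs_mult by (intro mult_mono that) (use b in auto)
  have "\<bar>decorr_mat w r s\<bar> \<le> ?c * ?h + ?c * ?h"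
    unfolding decorr_mat_def
    by (intro order_trans[OF abs_triangle_ineq] add_mono t h coef_le w b ix_range ix_range_K r)
  then show ?thesis by (simp add: field_simps)
qed

end

section \<open>Convergence in probability\<close>

text \<open>\<open>cts_step\<close> is an affine function of slope \<open>- 1 / (y - x)\<close>
  clamped to \<open>[0, 1]\<close>, and clamping does not increase distances.\<close>

lemma cts_step_Lipschitz:
  assumes "x < y"
  shows "\<bar>cts_step x y u - cts_step x y v\<bar> \<le> \<bar>u - v\<bar> / (y - x)"
proof -
  have eq: "cts_step x y u = min 1 (max 0 ((y - u) / (y - x)))" for u
    using assms by (auto simp: cts_step_def min_def max_def field_simps)
  have "\<bar>cts_step x y u - cts_step x y v\<bar> \<le> \<bar>(y - u) / (y - x) - (y - v) / (y - x)\<bar>"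
    unfolding eq by (auto simp: min_def max_def abs_if)
  also have "\<dots> = \<bar>u - v\<bar> / (y - x)"
    using assms by (simp add: diff_divide_distrib[symmetric] abs_minus_commute)
  finally show ?thesis .
qed

lemma cts_step_bounds: "x < y \<Longrightarrow> 0 \<le> cts_step x y u" "x < y \<Longrightarrow> cts_step x y u \<le> 1"
  by (auto simp: cts_step_def field_simps)

lemma continuous_on_cts_step: "x < y \<Longrightarrow> continuous_on UNIV (cts_step x y)"
  by (intro uniformly_continuous_imp_continuous cts_step_uniformly_continuous)

lemma borel_measurable_cts_step: "x < y \<Longrightarrow> cts_step x y \<in> borel_measurable borel"
  by (intro borel_measurable_continuous_onI continuous_on_cts_step)

context prob_space
begin

text \<open>The exceptional sets need not be the complements of \<open>R n\<close>, so no measurability of \<open>R\<close> is required.\<close>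

definition whp :: "(nat \<Rightarrow> 'a \<Rightarrow> bool) \<Rightarrow> bool" where
  "whp R \<longleftrightarrow> (\<forall>e>0. \<forall>\<^sub>F n in sequentially. \<exists>B\<in>sets M. prob B \<le> e \<and> (\<forall>\<omega>\<in>space M - B. R n \<omega>))"

lemma whpD:
  "whp R \<Longrightarrow> 0 < e \<Longrightarrow> \<forall>\<^sub>F n in sequentially. \<exists>B\<in>sets M. prob B \<le> e \<and> (\<forall>\<omega>\<in>space M - B. R n \<omega>)"
  by (simp add: whp_def)

lemma whp_eventually_mono:
  assumes "whp R" "\<forall>\<^sub>F n in sequentially. \<forall>\<omega>\<in>space M. R n \<omega> \<longrightarrow> S n \<omega>"
  shows "whp S"
  unfolding whp_def
proof (intro allI impI)
  fix e :: real assume "e > 0"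
  then have "\<forall>\<^sub>F n in sequentially. \<exists>B\<in>sets M. prob B \<le> e \<and> (\<forall>\<omega>\<in>space M - B. R n \<omega>)"
    using assms(1) by (simp add: whp_def)
  then show "\<forall>\<^sub>F n in sequentially. \<exists>B\<in>sets M. prob B \<le> e \<and> (\<forall>\<omega>\<in>space M - B. S n \<omega>)"
    using assms(2) by eventually_elim blast
qed

lemma whp_mono:
  assumes "whp R" "\<And>n \<omega>. \<omega> \<in> space M \<Longrightarrow> R n \<omega> \<Longrightarrow> S n \<omega>"
  shows "whp S"
  using assms by (intro whp_eventually_mono[OF assms(1)]) auto

lemma whp_conj:
  assumes "whp R" "whp S"
  shows "whp (\<lambda>n \<omega>. R n \<omega> \<and> S n \<omega>)"
  unfolding whp_def
proof (intro allI impI)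
  fix e :: real assume "e > 0"
  then have "e / 2 > 0" by simp
  then have "\<forall>\<^sub>F n in sequentially. \<exists>B\<in>sets M. prob B \<le> e / 2 \<and> (\<forall>\<omega>\<in>space M - B. R n \<omega>)"
    "\<forall>\<^sub>F n in sequentially. \<exists>B\<in>sets M. prob B \<le> e / 2 \<and> (\<forall>\<omega>\<in>space M - B. S n \<omega>)"
    using assms unfolding whp_def by blast+
  then show "\<forall>\<^sub>F n in sequentially. \<exists>B\<in>sets M. prob B \<le> e \<and> (\<forall>\<omega>\<in>space M - B. R n \<omega> \<and> S n \<omega>)"
  proof eventually_elim
    case (elim n)
    then obtain B B' where B: "B \<in> sets M" "prob B \<le> e / 2" "\<forall>\<omega>\<in>space M - B. R n \<omega>"
      and B': "B' \<in> sets M" "prob B' \<le> e / 2" "\<forall>\<omega>\<in>space M - B'. S n \<omega>" by blast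
    have "prob (B \<union> B') \<le> e"
      using measure_Un_le[OF B(1) B'(1)] B(2) B'(2) by simp
    then show ?case using B B' by (intro bexI[of _ "B \<union> B'"]) auto
  qed
qed

lemma whp_True: "(\<And>n \<omega>. \<omega> \<in> space M \<Longrightarrow> R n \<omega>) \<Longrightarrow> whp R"
  unfolding whp_def by (intro allI impI always_eventually bexI[of _ "{}"]) auto

text \<open>Conditional expectations are determined only almost everywhere; their null sets are
  moved into the exceptional sets.\<close>

lemma whp_AE:
  assumes "\<forall>\<^sub>F n in sequentially. AE \<omega> in M. R n \<omega>"
  shows "whp R"
  unfolding whp_def
proof (intro allI impI)
  fix e :: real assume e: "e > 0"
  from assms show "\<forall>\<^sub>F n in sequentially. \<exists>B\<in>sets M. prob B \<le> e \<and> (\<forall>\<omega>\<in>space M - B. R n \<omega>)"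
  proof eventually_elim
    case (elim n)
    then obtain B where "{\<omega> \<in> space M. \<not> R n \<omega>} \<subseteq> B" "emeasure M B = 0" "B \<in> sets M"
      by (rule AE_E)
    then show ?case
      using e by (intro bexI[of _ B]) (auto simp: measure_def)
  qed
qed

lemma whp_finite_ball:
  assumes "finite I" "\<And>i. i \<in> I \<Longrightarrow> whp (R i)"
  shows "whp (\<lambda>n \<omega>. \<forall>i\<in>I. R i n \<omega>)"
  using assms
proof (induction I)
  case empty
  then show ?case by (intro whp_True) auto
next
  case (insert i I)
  have "whp (\<lambda>n \<omega>. R i n \<omega> \<and> (\<forall>i\<in>I. R i n \<omega>))"
    using insert by (intro whp_conj) auto
  then show ?case by (rule whp_mono) auto
qed

lemma whp_approx:
  assumes "\<And>e. e > 0 \<Longrightarrow> \<forall>\<^sub>F n in sequentially. \<exists>B\<in>sets M. prob B \<le> e \<and> (\<forall>\<omega>\<in>space M - B. R n \<omega>)"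
  shows "whp R"
  using assms by (auto simp: whp_def)

lemma whp_prob_tendsto_1:
  assumes w: "whp R" and meas: "\<forall>\<^sub>F n in sequentially. {\<omega> \<in> space M. R n \<omega>} \<in> sets M"
  shows "(\<lambda>n. prob {\<omega> \<in> space M. R n \<omega>}) \<longlonglongrightarrow> 1"
proof (rule LIMSEQ_I)
  fix r :: real assume r: "0 < r"
  have "\<forall>\<^sub>F n in sequentially. \<exists>B\<in>sets M. prob B \<le> r / 2 \<and> (\<forall>\<omega>\<in>space M - B. R n \<omega>)"
    by (rule whpD[OF w]) (use r in simp)
  with meas have "\<forall>\<^sub>F n in sequentially. norm (prob {\<omega> \<in> space M. R n \<omega>} - 1) < r"
  proof eventually_elim
    case (elim n)
    then obtain B where B: "B \<in> sets M" "prob B \<le> r / 2" "\<forall>\<omega>\<in>space M - B. R n \<omega>" by blast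
    have "1 - prob B = prob (space M - B)" using B(1) by (simp add: prob_compl)
    also have "\<dots> \<le> prob {\<omega> \<in> space M. R n \<omega>}"
      by (intro finite_measure_mono) (use B elim in auto)
    finally show ?case using B(2) r prob_le_1[of "{\<omega> \<in> space M. R n \<omega>}"] by simp
  qed
  then show "\<exists>no. \<forall>n\<ge>no. norm (prob {\<omega> \<in> space M. R n \<omega>} - 1) < r"
    by (simp add: eventually_sequentially)
qed

lemma prob_tendsto_1_whp:
  assumes lim: "(\<lambda>n. prob {\<omega> \<in> space M. R n \<omega>}) \<longlonglongrightarrow> 1"
    and meas: "\<forall>\<^sub>F n in sequentially. {\<omega> \<in> space M. R n \<omega>} \<in> sets M"
  shows "whp R"
proof (rule whp_approx)
  fix e :: real assume "e > 0"
  then have "\<forall>\<^sub>F n in sequentially. prob {\<omega> \<in> space M. R n \<omega>} > 1 - e"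
    by (intro order_tendstoD(1)[OF lim]) auto
  with meas show "\<forall>\<^sub>F n in sequentially. \<exists>B\<in>sets M. prob B \<le> e \<and> (\<forall>\<omega>\<in>space M - B. R n \<omega>)"
  proof eventually_elim
    case (elim n)
    then show ?case
      using prob_compl[of "{\<omega> \<in> space M. R n \<omega>}"]
      by (intro bexI[of _ "space M - {\<omega> \<in> space M. R n \<omega>}"]) auto
  qed
qed

lemma whp_small_o_P:
  assumes "\<And>\<epsilon>. \<epsilon> > 0 \<Longrightarrow> whp (\<lambda>n \<omega>. \<bar>R n \<omega>\<bar> \<le> \<epsilon>)"
  shows "small_o_P M R (\<lambda>_. 1)"
  unfolding small_o_P_def
proof (intro allI impI LIMSEQ_I)
  fix \<epsilon> r :: real assume \<epsilon>: "0 < \<epsilon>" and r: "0 < r"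
  have "\<forall>\<^sub>F n in sequentially. \<exists>B\<in>sets M. prob B \<le> r / 2 \<and> (\<forall>\<omega>\<in>space M - B. \<bar>R n \<omega>\<bar> \<le> \<epsilon>)"
    by (rule whpD[OF assms[OF \<epsilon>]]) (use r in simp)
  then have "\<forall>\<^sub>F n in sequentially. norm (prob {\<omega> \<in> space M. \<bar>R n \<omega>\<bar> > \<epsilon> * 1} - 0) < r"
  proof eventually_elim
    case (elim n)
    then obtain B where B: "B \<in> sets M" "prob B \<le> r / 2" "\<forall>\<omega>\<in>space M - B. \<bar>R n \<omega>\<bar> \<le> \<epsilon>" by blast
    have "prob {\<omega> \<in> space M. \<bar>R n \<omega>\<bar> > \<epsilon> * 1} \<le> prob B"
      using B by (intro finite_measure_mono) force+
    then show ?case using B(2) r measure_nonneg[of M "{\<omega> \<in> space M. \<bar>R n \<omega>\<bar> > \<epsilon> * 1}"] by simp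
  qed
  then show "\<exists>no. \<forall>n\<ge>no. norm (prob {\<omega> \<in> space M. \<bar>R n \<omega>\<bar> > \<epsilon> * 1} - 0) < r"
    by (simp add: eventually_sequentially)
qed

text \<open>Measurability is asked for only eventually, since the nearest neighbour statistics are
  meaningful from \<open>n = 2\<close> on.\<close>

lemma small_o_P_whp:
  assumes o: "small_o_P M R a" and \<epsilon>: "0 < \<epsilon>"
    and meas: "\<forall>\<^sub>F n in sequentially. R n \<in> borel_measurable M"
  shows "whp (\<lambda>n \<omega>. \<bar>R n \<omega>\<bar> \<le> \<epsilon> * a n)"
proof (rule whp_approx)
  fix e :: real assume "e > 0"
  have "(\<lambda>n. prob {\<omega> \<in> space M. \<bar>R n \<omega>\<bar> > \<epsilon> * a n}) \<longlonglongrightarrow> 0"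
    using o \<epsilon> by (simp add: small_o_P_def)
  then have "\<forall>\<^sub>F n in sequentially. prob {\<omega> \<in> space M. \<bar>R n \<omega>\<bar> > \<epsilon> * a n} < e"
    using \<open>e > 0\<close> by (rule order_tendstoD(2))
  with meas show "\<forall>\<^sub>F n in sequentially. \<exists>B\<in>sets M. prob B \<le> e \<and> (\<forall>\<omega>\<in>space M - B. \<bar>R n \<omega>\<bar> \<le> \<epsilon> * a n)"
  proof eventually_elim
    case (elim n)
    note [measurable] = elim(1)
    show ?case
      using elim(2) by (intro bexI[of _ "{\<omega> \<in> space M. \<bar>R n \<omega>\<bar> > \<epsilon> * a n}"]) auto
  qed
qed

lemma whp_Markov:
  fixes R :: "nat \<Rightarrow> 'a \<Rightarrow> real"
  assumes int: "\<forall>\<^sub>F n in sequentially. integrable M (R n)"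
    and nonneg: "\<forall>\<^sub>F n in sequentially. \<forall>\<omega>\<in>space M. 0 \<le> R n \<omega>"
    and lim: "(\<lambda>n. expectation (R n)) \<longlonglongrightarrow> 0" and \<epsilon>: "0 < \<epsilon>"
  shows "whp (\<lambda>n \<omega>. R n \<omega> \<le> \<epsilon>)"
proof (rule whp_approx)
  fix e :: real assume "e > 0"
  then have "\<forall>\<^sub>F n in sequentially. expectation (R n) < e * \<epsilon>"
    using \<epsilon> by (intro order_tendstoD(2)[OF lim]) auto
  with int nonneg show "\<forall>\<^sub>F n in sequentially. \<exists>B\<in>sets M. prob B \<le> e \<and> (\<forall>\<omega>\<in>space M - B. R n \<omega> \<le> \<epsilon>)"
  proof eventually_elim
    case (elim n)
    have [measurable]: "R n \<in> borel_measurable M" using elim(1) by auto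
    have "prob {\<omega> \<in> space M. R n \<omega> \<ge> \<epsilon>} \<le> expectation (R n) / \<epsilon>"
      using elim(1,2) \<epsilon> by (intro integral_Markov_inequality_measure[where A = "{}"]) auto
    also have "\<dots> \<le> e" using elim(3) \<epsilon> by (simp add: field_simps)
    finally show ?case
      by (intro bexI[of _ "{\<omega> \<in> space M. R n \<omega> \<ge> \<epsilon>}"]) auto
  qed
qed

text \<open>Bounded convergence in probability: off the exceptional set the integrand is at most
  \<open>r / 4\<close>, on it at most \<open>c\<close>, with probability at most
  \<open>r / (4 * c)\<close>.\<close>

lemma expectation_tendsto_0:
  fixes F :: "nat \<Rightarrow> 'a \<Rightarrow> real"
  assumes w: "\<And>\<delta>. \<delta> > 0 \<Longrightarrow> whp (\<lambda>n \<omega>. \<bar>F n \<omega>\<bar> \<le> \<delta>)"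
    and meas: "\<forall>\<^sub>F n in sequentially. F n \<in> borel_measurable M"
    and bound: "\<forall>\<^sub>F n in sequentially. \<forall>\<omega>\<in>space M. \<bar>F n \<omega>\<bar> \<le> c" and c: "0 < c"
  shows "(\<lambda>n. expectation (F n)) \<longlonglongrightarrow> 0"
proof (rule LIMSEQ_I)
  fix r :: real assume r: "0 < r"
  have "\<forall>\<^sub>F n in sequentially. \<exists>B\<in>sets M. prob B \<le> r / (4 * c) \<and> (\<forall>\<omega>\<in>space M - B. \<bar>F n \<omega>\<bar> \<le> r / 4)"
    by (rule whpD[OF w]) (use r c in simp_all)
  with meas bound have "\<forall>\<^sub>F n in sequentially. norm (expectation (F n) - 0) < r"
  proof eventually_elim
    case (elim n)
    then obtain B where B: "B \<in> sets M" "prob B \<le> r / (4 * c)" "\<forall>\<omega>\<in>space M - B. \<bar>F n \<omega>\<bar> \<le> r / 4" by blast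
    have int: "integrable M (F n)"
      by (rule integrable_const_bound[of _ c]) (use elim(1,2) in auto)
    have "norm (expectation (F n)) \<le> expectation (\<lambda>\<omega>. \<bar>F n \<omega>\<bar>)"
      using integral_norm_bound[of M "F n"] by simp
    also have "\<dots> \<le> expectation (\<lambda>\<omega>. r / 4 + c * indicator B \<omega>)"
    proof (rule integral_mono)
      show "integrable M (\<lambda>\<omega>. \<bar>F n \<omega>\<bar>)" using int by simp
      show "integrable M (\<lambda>\<omega>. r / 4 + c * indicator B \<omega>)"
        using B(1) by (intro Bochner_Integration.integrable_add integrable_mult_right) (auto simp: less_top[symmetric])
      fix \<omega> assume "\<omega> \<in> space M"
      then show "\<bar>F n \<omega>\<bar> \<le> r / 4 + c * indicator B \<omega>"
        using B(3) elim(2) r by (cases "\<omega> \<in> B") auto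
    qed
    also have "\<dots> = r / 4 + c * prob B"
      using B(1) by (subst Bochner_Integration.integral_add) (auto simp: prob_space less_top[symmetric])
    also have "\<dots> \<le> r / 4 + c * (r / (4 * c))"
      using B(2) c by (intro add_left_mono mult_left_mono) auto
    also have "\<dots> < r" using c r by simp
    finally show ?case by simp
  qed
  then show "\<exists>no. \<forall>n\<ge>no. norm (expectation (F n) - 0) < r"
    by (simp add: eventually_sequentially)
qed

text \<open>The test functions are bounded and Lipschitz, so closeness in probability of two
  statistics passes to the expectations.\<close>

lemma cts_step_Slutsky:
  assumes w: "\<And>\<delta>. \<delta> > 0 \<Longrightarrow> whp (\<lambda>n \<omega>. \<bar>I n \<omega> - J n \<omega>\<bar> \<le> \<delta>)"
    and meas: "\<forall>\<^sub>F n in sequentially. I n \<in> borel_measurable M" "\<forall>\<^sub>F n in sequentially. J n \<in> borel_measurable M"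
    and xy: "x < y"
    and lim: "(\<lambda>n. expectation (\<lambda>\<omega>. cts_step x y (J n \<omega>))) \<longlonglongrightarrow> c"
  shows "(\<lambda>n. expectation (\<lambda>\<omega>. cts_step x y (I n \<omega>))) \<longlonglongrightarrow> c"
proof -
  have m: "\<forall>\<^sub>F n in sequentially. (\<lambda>\<omega>. cts_step x y (Z n \<omega>)) \<in> borel_measurable M"
    if "\<forall>\<^sub>F n in sequentially. Z n \<in> borel_measurable M" for Z
    using that by eventually_elim (rule measurable_compose[OF _ borel_measurable_cts_step[OF xy]])
  have "(\<lambda>n. expectation (\<lambda>\<omega>. cts_step x y (I n \<omega>) - cts_step x y (J n \<omega>))) \<longlonglongrightarrow> 0"
  proof (rule expectation_tendsto_0[where c = "1::real" and F = "\<lambda>n \<omega>. cts_step x y (I n \<omega>) - cts_step x y (J n \<omega>)"])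
    fix \<delta> :: real assume \<delta>: "\<delta> > 0"
    have "whp (\<lambda>n \<omega>. \<bar>I n \<omega> - J n \<omega>\<bar> \<le> \<delta> * (y - x))"
      using \<delta> xy by (intro w) simp
    then show "whp (\<lambda>n \<omega>. \<bar>cts_step x y (I n \<omega>) - cts_step x y (J n \<omega>)\<bar> \<le> \<delta>)"
    proof (rule whp_mono)
      fix n \<omega> assume "\<bar>I n \<omega> - J n \<omega>\<bar> \<le> \<delta> * (y - x)"
      then have "\<bar>I n \<omega> - J n \<omega>\<bar> / (y - x) \<le> \<delta>" using xy by (simp add: field_simps)
      then show "\<bar>cts_step x y (I n \<omega>) - cts_step x y (J n \<omega>)\<bar> \<le> \<delta>"
        using cts_step_Lipschitz[OF xy, of "I n \<omega>" "J n \<omega>"] by linarith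
    qed
  next
    have "\<bar>cts_step x y (I n \<omega>) - cts_step x y (J n \<omega>)\<bar> \<le> 1" for n \<omega>
      using cts_step_bounds[OF xy, of "I n \<omega>"] cts_step_bounds[OF xy, of "J n \<omega>"] by linarith
    then show "\<forall>\<^sub>F n in sequentially. \<forall>\<omega>\<in>space M. \<bar>cts_step x y (I n \<omega>) - cts_step x y (J n \<omega>)\<bar> \<le> 1"
      by simp
  next
    show "\<forall>\<^sub>F n in sequentially. (\<lambda>\<omega>. cts_step x y (I n \<omega>) - cts_step x y (J n \<omega>)) \<in> borel_measurable M"
      using m[OF meas(1)] m[OF meas(2)] by eventually_elim (rule borel_measurable_diff)
  qed simp
  from tendsto_add[OF this lim]
  have "(\<lambda>n. expectation (\<lambda>\<omega>. cts_step x y (I n \<omega>) - cts_step x y (J n \<omega>))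
      + expectation (\<lambda>\<omega>. cts_step x y (J n \<omega>))) \<longlonglongrightarrow> c" by simp
  then show ?thesis
  proof (rule Lim_transform_eventually)
    have int: "integrable M (\<lambda>\<omega>. cts_step x y (Z \<omega>))" if "(\<lambda>\<omega>. cts_step x y (Z \<omega>)) \<in> borel_measurable M" for Z
      by (rule integrable_const_bound[of _ 1]) (use that cts_step_bounds[OF xy] in auto)
    show "\<forall>\<^sub>F n in sequentially. expectation (\<lambda>\<omega>. cts_step x y (I n \<omega>) - cts_step x y (J n \<omega>))
        + expectation (\<lambda>\<omega>. cts_step x y (J n \<omega>)) = expectation (\<lambda>\<omega>. cts_step x y (I n \<omega>))"
      using m[OF meas(1)] m[OF meas(2)]
      by eventually_elim (simp add: Bochner_Integration.integral_diff int)
  qed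
qed

end

section \<open>Laplace transforms determine weak limits on the half line\<close>

text \<open>
  A function of \<open>x \<ge> 0\<close> that is constant for large \<open>x\<close> is a continuous function of \<open>exp (- x) \<in> [0, 1]\<close>,
  hence uniformly approximable by linear combinations of the functions \<open>exp (- m x)\<close>.
\<close>

lemma cts_step_Laplace_approx:
  assumes xy: "x < y" and e: "0 < e"
  obtains a :: "nat \<Rightarrow> real" and N where
    "\<And>u. 0 \<le> u \<Longrightarrow> \<bar>cts_step x y u - (\<Sum>m\<le>N. a m * exp (- (real m * u)))\<bar> < e"
proof -
  \<comment> \<open>The substitution is \<open>v = exp (- u)\<close>. The maximum keeps the
    logarithm away from \<open>v = 0\<close>; it cuts at \<open>u = \<bar>y\<bar> + 1\<close>, where
    \<open>cts_step x y\<close> is already 0, so no value changes and \<open>f\<close> is continuous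
    at 0.\<close>
  define f where "f v = cts_step x y (- ln (max v (exp (- (\<bar>y\<bar> + 1)))))" for v
  have pos: "0 < max v (exp (- (\<bar>y\<bar> + 1)))" for v :: real by (simp add: less_max_iff_disj)
  have "continuous_on {0..1} f"
    unfolding f_def
    by (intro continuous_on_compose2[OF continuous_on_cts_step[OF xy]] continuous_intros)
      (use pos in \<open>auto simp: less_imp_neq[symmetric] simp del: max_less_iff_conj\<close>)
  then obtain g where g: "real_polynomial_function g" "\<And>v. v \<in> {0..1} \<Longrightarrow> \<bar>f v - g v\<bar> < e"
    using Stone_Weierstrass_real_polynomial_function[of "{0..1}" f e] e by auto
  obtain a N where gs: "g = (\<lambda>v. \<Sum>m\<le>N. a m * v ^ m)"
    using g(1) real_polynomial_function_iff_sum by auto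
  show thesis
  proof (rule that)
    fix u :: real assume u: "0 \<le> u"
    have "f (exp (- u)) = cts_step x y u"
    proof (cases "u \<le> \<bar>y\<bar> + 1")
      case True
      then have "max (exp (- u)) (exp (- (\<bar>y\<bar> + 1))) = exp (- u)" by (simp add: max_def)
      then show ?thesis by (simp add: f_def)
    next
      case False
      then have "max (exp (- u)) (exp (- (\<bar>y\<bar> + 1))) = exp (- (\<bar>y\<bar> + 1))" by (simp add: max_def)
      then show ?thesis using False xy by (simp add: f_def cts_step_def)
    qed
    moreover have "g (exp (- u)) = (\<Sum>m\<le>N. a m * exp (- (real m * u)))"
      unfolding gs by (simp add: exp_of_nat_mult[symmetric])
    ultimately show "\<bar>cts_step x y u - (\<Sum>m\<le>N. a m * exp (- (real m * u)))\<bar> < e"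
      using g(2)[of "exp (- u)"] u by simp
  qed
qed

text \<open>The approximation by exponentials holds on the half line only, which is why all the laws
  live there. It costs \<open>r / 4\<close> for \<open>\<mu> n\<close> and for \<open>\<nu>\<close>,
  and the convergence of finitely many transforms costs another \<open>r / 4\<close>.\<close>

lemma cts_step_conv_of_Laplace:
  fixes \<mu> :: "nat \<Rightarrow> real measure" and \<nu> :: "real measure"
  assumes \<mu>: "\<And>n. real_distribution (\<mu> n)" "\<And>n. AE u in \<mu> n. 0 \<le> u"
    and \<nu>: "real_distribution \<nu>" "AE u in \<nu>. 0 \<le> u"
    and conv: "\<And>m::nat. (\<lambda>n. \<integral>u. exp (- (real m * u)) \<partial>\<mu> n) \<longlonglongrightarrow> (\<integral>u. exp (- (real m * u)) \<partial>\<nu>)"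
    and xy: "x < y"
  shows "(\<lambda>n. integral\<^sup>L (\<mu> n) (cts_step x y)) \<longlonglongrightarrow> integral\<^sup>L \<nu> (cts_step x y)"
proof (rule LIMSEQ_I)
  fix r :: real assume r: "0 < r"
  then have "0 < r / 4" by simp
  from cts_step_Laplace_approx[OF xy this]
  obtain a :: "nat \<Rightarrow> real" and N where
    approx: "\<And>u. 0 \<le> u \<Longrightarrow> \<bar>cts_step x y u - (\<Sum>m\<le>N. a m * exp (- (real m * u)))\<bar> < r / 4"
    by blast
  define g where "g u = (\<Sum>m\<le>N. a m * exp (- (real m * u)))" for u
  have close: "integral\<^sup>L \<kappa> g = (\<Sum>m\<le>N. a m * (\<integral>u. exp (- (real m * u)) \<partial>\<kappa>))
      \<and> \<bar>integral\<^sup>L \<kappa> (cts_step x y) - integral\<^sup>L \<kappa> g\<bar> \<le> r / 4"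
    if \<kappa>: "real_distribution \<kappa>" and nn: "AE u in \<kappa>. 0 \<le> u" for \<kappa>
  proof -
    interpret real_distribution \<kappa> by fact
    have int: "integrable \<kappa> (\<lambda>u. exp (- (real m * u)))" for m
      by (rule integrable_const_bound[of _ 1]) (use nn in \<open>auto elim!: eventually_mono\<close>)
    have ig: "integrable \<kappa> g" unfolding g_def by (intro Bochner_Integration.integrable_sum integrable_mult_right int)
    have 1: "integral\<^sup>L \<kappa> g = (\<Sum>m\<le>N. a m * (\<integral>u. exp (- (real m * u)) \<partial>\<kappa>))"
      unfolding g_def by (subst Bochner_Integration.integral_sum) (auto intro: int)
    have idf: "integrable \<kappa> (\<lambda>u. cts_step x y u - g u)"
      by (intro Bochner_Integration.integrable_diff integrable_cts_step xy ig)
    have "\<bar>integral\<^sup>L \<kappa> (cts_step x y) - integral\<^sup>L \<kappa> g\<bar> = norm (\<integral>u. cts_step x y u - g u \<partial>\<kappa>)"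
      by (simp add: Bochner_Integration.integral_diff integrable_cts_step xy ig)
    also have "\<dots> \<le> (\<integral>u. norm (cts_step x y u - g u) \<partial>\<kappa>)" by (rule integral_norm_bound)
    also have "\<dots> \<le> (\<integral>u. r / 4 \<partial>\<kappa>)"
      using nn approx idf by (intro integral_mono_AE) (auto simp: g_def elim!: eventually_mono intro: less_imp_le)
    also have "\<dots> = r / 4" using prob_space by simp
    finally show ?thesis using 1 by simp
  qed
  have "(\<lambda>n. \<Sum>m\<le>N. a m * (\<integral>u. exp (- (real m * u)) \<partial>\<mu> n)) \<longlonglongrightarrow> (\<Sum>m\<le>N. a m * (\<integral>u. exp (- (real m * u)) \<partial>\<nu>))"
    by (intro tendsto_sum tendsto_mult_left conv)
  then have "(\<lambda>n. integral\<^sup>L (\<mu> n) g) \<longlonglongrightarrow> integral\<^sup>L \<nu> g"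
    using close[OF \<mu>] close[OF \<nu>] by simp
  then obtain n0 where n0: "\<And>n. n \<ge> n0 \<Longrightarrow> norm (integral\<^sup>L (\<mu> n) g - integral\<^sup>L \<nu> g) < r / 4"
    using LIMSEQ_D[of _ _ "r / 4"] r by (metis divide_pos_pos zero_less_numeral)
  show "\<exists>no. \<forall>n\<ge>no. norm (integral\<^sup>L (\<mu> n) (cts_step x y) - integral\<^sup>L \<nu> (cts_step x y)) < r"
  proof (intro exI allI impI)
    fix n assume n: "n0 \<le> n"
    show "norm (integral\<^sup>L (\<mu> n) (cts_step x y) - integral\<^sup>L \<nu> (cts_step x y)) < r"
      using n0[OF n] close[OF \<mu>, of n] close[OF \<nu>] r unfolding real_norm_def by linarith
  qed
qed

section \<open>Standard Gaussian vectors\<close>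

definition gauss_vec :: "nat \<Rightarrow> (nat \<Rightarrow> real) measure" where
  "gauss_vec d = PiM {..<d} (\<lambda>_. density lborel std_normal_density)"

lemma prob_space_gauss_vec: "prob_space (gauss_vec d)"
  unfolding gauss_vec_def by (intro prob_space_PiM prob_space_normal_density) simp

lemma borel_measurable_gauss_vec_component: "r < d \<Longrightarrow> (\<lambda>\<theta>. \<theta> r) \<in> borel_measurable (gauss_vec d)"
  unfolding gauss_vec_def
  using measurable_component_singleton[of r "{..<d}" "\<lambda>_. density lborel std_normal_density"] by simp

lemma borel_measurable_gauss_vec_sum [measurable]:
  assumes "\<And>r. g r \<in> borel_measurable borel"
  shows "(\<lambda>\<theta>. \<Sum>r<d. g r (\<theta> r) :: real) \<in> borel_measurable (gauss_vec d)"
  by (intro borel_measurable_sum measurable_compose[OF borel_measurable_gauss_vec_component assms]) auto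

lemma integral_gauss_vec_cis:
  "(\<integral>\<theta>. cis (\<Sum>r<d. \<theta> r * z r) \<partial>gauss_vec d) = of_real (exp (- (\<Sum>r<d. (z r)\<^sup>2) / 2))"
proof -
  interpret product_sigma_finite "\<lambda>_::nat. std_normal_distribution"
    by (intro product_sigma_finite.intro prob_space_imp_sigma_finite prob_space_normal_density) simp
  interpret N: real_distribution std_normal_distribution by (rule real_dist_normal_dist)
  have cis_prod: "cis (\<Sum>r\<in>A. \<theta> r * z r) = (\<Prod>r\<in>A. iexp (z r * \<theta> r))" if "finite A" for \<theta> and A :: "nat set"
    using that
  proof (induction A)
    case (insert a A)
    then show ?case by (simp add: cis_mult[symmetric]) (simp add: cis_conv_exp mult.commute)
  qed simp
  have "(\<integral>\<theta>. cis (\<Sum>r<d. \<theta> r * z r) \<partial>gauss_vec d) = (\<integral>\<theta>. (\<Prod>r<d. iexp (z r * \<theta> r)) \<partial>gauss_vec d)"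
    by (simp add: cis_prod)
  also have "\<dots> = (\<Prod>r<d. \<integral>t. iexp (z r * t) \<partial>std_normal_distribution)"
    unfolding gauss_vec_def by (intro product_integral_prod N.integrable_iexp) auto
  also have "\<dots> = (\<Prod>r<d. of_real (exp (- ((z r)\<^sup>2) / 2)))"
    using char_std_normal_distribution by (simp add: char_def fun_eq_iff)
  also have "\<dots> = of_real (\<Prod>r<d. exp (- ((z r)\<^sup>2) / 2))" by simp
  also have "(\<Prod>r<d. exp (- ((z r)\<^sup>2) / 2)) = exp (\<Sum>r<d. - ((z r)\<^sup>2) / 2)"
    by (simp add: exp_sum)
  also have "(\<Sum>r<d. - ((z r)\<^sup>2) / 2) = - (\<Sum>r<d. (z r)\<^sup>2) / 2"
    by (simp add: sum_negf sum_divide_distrib)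
  finally show ?thesis .
qed

lemma chi_squared_eq: "chi_squared d = distr (gauss_vec d) borel (\<lambda>\<theta>. \<Sum>r<d. (\<theta> r)\<^sup>2)"
  by (simp add: chi_squared_def gauss_vec_def)

lemma measurable_sum_squares [measurable]: "(\<lambda>\<theta>. \<Sum>r<d. (\<theta> r)\<^sup>2) \<in> borel_measurable (gauss_vec d)"
  by (rule borel_measurable_gauss_vec_sum) measurable

lemma real_distribution_chi_squared: "real_distribution (chi_squared d)"
proof -
  interpret prob_space "gauss_vec d" by (rule prob_space_gauss_vec)
  show ?thesis unfolding chi_squared_eq by (intro real_distribution_distr) measurable
qed

lemma AE_chi_squared_nonneg: "AE u in chi_squared d. 0 \<le> u"
  unfolding chi_squared_eq by (subst AE_distr_iff) (auto intro!: AE_I2 sum_nonneg)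

lemma Laplace_chi_squared:
  "(\<integral>u. exp (- (real m * u)) \<partial>chi_squared d) = (\<integral>\<theta>. exp (- (real m * (\<Sum>r<d. (\<theta> r)\<^sup>2))) \<partial>gauss_vec d)"
  unfolding chi_squared_eq by (subst integral_distr) auto

text \<open>Integrates the error of the characteristic functions over the Gaussian direction: the
  cube stems from the factor \<open>B ^ 3\<close> with \<open>B\<close> linear in the absolute
  coordinates, the cap 2 from the trivial bound for a difference of two numbers of modulus at most
  1.\<close>

definition gauss_error :: "nat \<Rightarrow> real \<Rightarrow> real" where
  "gauss_error d \<eta> = (\<integral>\<theta>. min 2 (\<eta> * (\<Sum>r<d. \<bar>\<theta> r\<bar>) ^ 3) \<partial>gauss_vec d)"

lemma gauss_error_small:
  assumes "0 < e"
  obtains \<eta> where "0 < \<eta>" "gauss_error d \<eta> < e"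
proof -
  interpret prob_space "gauss_vec d" by (rule prob_space_gauss_vec)
  have [measurable]: "(\<lambda>\<theta>. \<Sum>r<d. \<bar>\<theta> r\<bar>) \<in> borel_measurable (gauss_vec d)"
    by (rule borel_measurable_gauss_vec_sum) measurable
  have "(\<lambda>k. gauss_error d (inverse (real (Suc k)))) \<longlonglongrightarrow> (\<integral>\<theta>. 0 \<partial>gauss_vec d)"
    unfolding gauss_error_def
  proof (rule integral_dominated_convergence[where w = "\<lambda>_. 2"])
    show "AE \<theta> in gauss_vec d. (\<lambda>k. min 2 (inverse (real (Suc k)) * (\<Sum>r<d. \<bar>\<theta> r\<bar>) ^ 3)) \<longlonglongrightarrow> 0"
    proof (rule AE_I2)
      fix \<theta> :: "nat \<Rightarrow> real"
      have "(\<lambda>k. min 2 (inverse (real (Suc k)) * (\<Sum>r<d. \<bar>\<theta> r\<bar>) ^ 3)) \<longlonglongrightarrow> min 2 (0 * (\<Sum>r<d. \<bar>\<theta> r\<bar>) ^ 3)"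
        by (intro tendsto_min tendsto_const tendsto_mult_right LIMSEQ_inverse_real_of_nat)
      then show "(\<lambda>k. min 2 (inverse (real (Suc k)) * (\<Sum>r<d. \<bar>\<theta> r\<bar>) ^ 3)) \<longlonglongrightarrow> 0" by simp
    qed
    show "AE \<theta> in gauss_vec d. norm (min 2 (inverse (real (Suc k)) * (\<Sum>r<d. \<bar>\<theta> r\<bar>) ^ 3)) \<le> 2" for k
      by (rule AE_I2) (auto simp: sum_nonneg)
  qed auto
  then have "\<forall>\<^sub>F k in sequentially. gauss_error d (inverse (real (Suc k))) < e"
    using assms by (intro order_tendstoD(2)) auto
  then obtain k where "gauss_error d (inverse (real (Suc k))) < e"
    by (auto simp: eventually_sequentially)
  then show thesis by (intro that[of "inverse (real (Suc k))"]) auto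
qed

text \<open>
  \<open>exp (- m \<bar>Z\<bar>\<^sup>2)\<close> is the average of \<open>cis (sqrt (2 m) (\<theta> \<bullet> Z))\<close> over a standard Gaussian \<open>\<theta>\<close>, so
  the joint convergence of the linear statistics controls the Laplace transform of \<open>\<bar>Z\<bar>\<^sup>2\<close>.
\<close>

lemma (in finite_law) Laplace_via_Gauss:
  fixes Z :: "nat \<Rightarrow> (nat \<Rightarrow> nat) \<Rightarrow> real" and m :: nat
  assumes V: "finite V" and \<eta>: "0 \<le> \<eta>"
    and char: "\<And>\<theta>. cmod (Ex V (\<lambda>y. cis (sqrt (2 * real m) * (\<Sum>r<d. \<theta> r * Z r y)))
        - of_real (exp (- (real m * (\<Sum>r<d. (\<theta> r)\<^sup>2))))) \<le> \<eta> * (\<Sum>r<d. \<bar>\<theta> r\<bar>) ^ 3"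
  shows "\<bar>Ex V (\<lambda>y. exp (- (real m * (\<Sum>r<d. (Z r y)\<^sup>2)))) - (\<integral>u. exp (- (real m * u)) \<partial>chi_squared d)\<bar>
    \<le> gauss_error d \<eta>"
proof -
  interpret prob_space "gauss_vec d" by (rule prob_space_gauss_vec)
  let ?s = "sqrt (2 * real m)"
  define F where "F \<theta> = Ex V (\<lambda>y. cis (?s * (\<Sum>r<d. \<theta> r * Z r y)))" for \<theta>
  define G where "G \<theta> = (of_real (exp (- (real m * (\<Sum>r<d. (\<theta> r)\<^sup>2)))) :: complex)" for \<theta> :: "nat \<Rightarrow> real"
  have [measurable]: "(\<lambda>\<theta>. \<Sum>r<d. \<bar>\<theta> r\<bar>) \<in> borel_measurable (gauss_vec d)"
    by (rule borel_measurable_gauss_vec_sum) measurable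
  have lin[measurable]: "(\<lambda>\<theta>. \<Sum>r<d. \<theta> r * z r) \<in> borel_measurable (gauss_vec d)" for z
    by (rule borel_measurable_gauss_vec_sum) measurable
  have cism: "(\<lambda>\<theta>. cis (c * (\<Sum>r<d. \<theta> r * z r))) \<in> borel_measurable (gauss_vec d)" for c z
    unfolding cis_conv_exp by measurable
  have cint: "integrable (gauss_vec d) (\<lambda>\<theta>. cis (c * (\<Sum>r<d. \<theta> r * z r)))" for c z
    by (rule integrable_const_bound[of _ 1]) (auto simp: cism)
  have int1: "(\<integral>\<theta>. cis (?s * (\<Sum>r<d. \<theta> r * Z r y)) \<partial>gauss_vec d) = of_real (exp (- (real m * (\<Sum>r<d. (Z r y)\<^sup>2))))" for y
  proof -
    have "(\<integral>\<theta>. cis (?s * (\<Sum>r<d. \<theta> r * Z r y)) \<partial>gauss_vec d) = (\<integral>\<theta>. cis (\<Sum>r<d. \<theta> r * (?s * Z r y)) \<partial>gauss_vec d)"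
      by (simp add: sum_distrib_left mult_ac)
    also have "\<dots> = of_real (exp (- (\<Sum>r<d. (?s * Z r y)\<^sup>2) / 2))" by (rule integral_gauss_vec_cis)
    also have "(\<Sum>r<d. (?s * Z r y)\<^sup>2) = 2 * (real m * (\<Sum>r<d. (Z r y)\<^sup>2))"
      by (simp add: power_mult_distrib sum_distrib_left mult_ac)
    finally show ?thesis by simp
  qed
  have intF: "integrable (gauss_vec d) F"
    unfolding F_def Ex_def by (intro Bochner_Integration.integrable_sum integrable_scaleR_right cint)
  have "integral\<^sup>L (gauss_vec d) F = Ex V (\<lambda>y. \<integral>\<theta>. cis (?s * (\<Sum>r<d. \<theta> r * Z r y)) \<partial>gauss_vec d)"
    unfolding F_def Ex_def by (subst Bochner_Integration.integral_sum) (auto intro: cint integrable_scaleR_right)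
  then have F: "integral\<^sup>L (gauss_vec d) F = of_real (Ex V (\<lambda>y. exp (- (real m * (\<Sum>r<d. (Z r y)\<^sup>2)))))"
    by (simp add: int1 Ex_of_real)
  have intG: "integrable (gauss_vec d) G"
    unfolding G_def by (rule integrable_const_bound[of _ 1]) (auto intro!: sum_nonneg mult_nonneg_nonneg)
  have G: "integral\<^sup>L (gauss_vec d) G = of_real (\<integral>u. exp (- (real m * u)) \<partial>chi_squared d)"
    unfolding G_def Laplace_chi_squared by (rule integral_complex_of_real)
  have G1: "cmod (G \<theta>) \<le> 1" for \<theta>
    unfolding G_def by (auto intro!: sum_nonneg mult_nonneg_nonneg)
  have F1: "cmod (F \<theta>) \<le> 1" for \<theta>
    unfolding F_def using V by (intro Ex_norm_le_const) auto
  have "\<bar>Ex V (\<lambda>y. exp (- (real m * (\<Sum>r<d. (Z r y)\<^sup>2)))) - (\<integral>u. exp (- (real m * u)) \<partial>chi_squared d)\<bar>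
      = cmod (integral\<^sup>L (gauss_vec d) F - integral\<^sup>L (gauss_vec d) G)"
    unfolding F G of_real_diff[symmetric] norm_of_real ..
  also have "integral\<^sup>L (gauss_vec d) F - integral\<^sup>L (gauss_vec d) G = (\<integral>\<theta>. F \<theta> - G \<theta> \<partial>gauss_vec d)"
    by (rule Bochner_Integration.integral_diff[symmetric, OF intF intG])
  also have "cmod \<dots> \<le> (\<integral>\<theta>. cmod (F \<theta> - G \<theta>) \<partial>gauss_vec d)" by (rule integral_norm_bound)
  also have "\<dots> \<le> gauss_error d \<eta>"
    unfolding gauss_error_def
  proof (rule integral_mono)
    show "integrable (gauss_vec d) (\<lambda>\<theta>. cmod (F \<theta> - G \<theta>))"
      using intF intG by (intro integrable_norm Bochner_Integration.integrable_diff)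
    show "integrable (gauss_vec d) (\<lambda>\<theta>. min 2 (\<eta> * (\<Sum>r<d. \<bar>\<theta> r\<bar>) ^ 3))"
      using \<eta> by (intro integrable_const_bound[of _ 2]) (auto simp: sum_nonneg)
    fix \<theta>
    show "cmod (F \<theta> - G \<theta>) \<le> min 2 (\<eta> * (\<Sum>r<d. \<bar>\<theta> r\<bar>) ^ 3)"
      using norm_triangle_ineq4[of "F \<theta>" "G \<theta>"] F1[of \<theta>] G1[of \<theta>] char[of \<theta>]
      unfolding F_def[symmetric] G_def[symmetric] by simp
  qed
  finally show ?thesis .
qed

section \<open>Independent labels on random graphs\<close>

text \<open>Extensional maps, so only finitely many graphs occur for each \<open>n\<close> and a
  random graph is a simple function.\<close>

definition graphs :: "nat \<Rightarrow> (nat \<Rightarrow> nat) set" where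
  "graphs n = {N \<in> PiE {1..n} (\<lambda>_. {1..n}). \<forall>i\<in>{1..n}. N i \<noteq> i}"

lemma finite_graphs: "finite (graphs n)"
  unfolding graphs_def by (rule finite_subset[OF _ finite_PiE[of "{1..n}" "\<lambda>_. {1..n}"]]) auto

lemma (in finite_law) label_graphI: "1 \<le> n \<Longrightarrow> g \<in> graphs n \<Longrightarrow> label_graph K p n g"
  by unfold_locales (auto simp: graphs_def)

text \<open>What the limit theory uses about the nearest neighbours: the graph is measurable for
  \<open>F n\<close>, given \<open>F n\<close> the labels are i.i.d. with law \<open>p\<close> by
  \<open>joint\<close>, and shared neighbours are rare in mean. The bound \<open>2 \<le> n\<close>
  appears because an edge without a loop needs two vertices.\<close>

locale random_graphs = pos_law K p + prob_space M
  for K :: nat and p :: "nat \<Rightarrow> real" and M :: "'w measure" +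
  fixes F :: "nat \<Rightarrow> 'w measure" and G :: "nat \<Rightarrow> 'w \<Rightarrow> nat \<Rightarrow> nat" and Y :: "nat \<Rightarrow> 'w \<Rightarrow> nat"
  assumes subalg: "2 \<le> n \<Longrightarrow> subalgebra M (F n)"
    and G_graph: "2 \<le> n \<Longrightarrow> \<omega> \<in> space M \<Longrightarrow> G n \<omega> \<in> graphs n"
    and G_meas: "2 \<le> n \<Longrightarrow> {\<omega> \<in> space M. G n \<omega> = g} \<in> sets (F n)"
    and Y_simple: "1 \<le> i \<Longrightarrow> simple_function M (Y i)"
    and joint: "2 \<le> n \<Longrightarrow> A \<in> sets (F n) \<Longrightarrow> y \<in> labellings {1..n} \<Longrightarrow>
      prob (A \<inter> {\<omega> \<in> space M. \<forall>i\<in>{1..n}. Y i \<omega> = y i}) = wt {1..n} y * prob A"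
    and collisions_lim:
      "(\<lambda>n. expectation (\<lambda>\<omega>. label_graph.collisions n (G n \<omega>) / (real n)\<^sup>2)) \<longlonglongrightarrow> 0"
begin

definition yv :: "nat \<Rightarrow> 'w \<Rightarrow> nat \<Rightarrow> nat" where
  "yv n \<omega> = restrict (\<lambda>i. Y i \<omega>) {1..n}"

lemma sets_F: "2 \<le> n \<Longrightarrow> A \<in> sets (F n) \<Longrightarrow> A \<in> sets M"
  using subalg[of n] by (auto simp: subalgebra_def)

lemma space_F: "2 \<le> n \<Longrightarrow> space (F n) = space M"
  using subalg[of n] by (auto simp: subalgebra_def)

lemma yv_event: "{\<omega> \<in> space M. yv n \<omega> = y} \<in> sets M"
proof (cases "y \<in> extensional {1..n}")
  case True
  then have "{\<omega> \<in> space M. yv n \<omega> = y} = {\<omega> \<in> space M. \<forall>i\<in>{1..n}. Y i \<omega> = y i}"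
    by (auto simp: yv_def extensional_def fun_eq_iff)
  moreover have "{\<omega> \<in> space M. \<forall>i\<in>{1..n}. Y i \<omega> = y i} \<in> sets M"
  proof (rule sets.sets_Collect_finite_All)
    fix i assume "i \<in> {1..n}"
    then have "simple_function M (Y i)" by (intro Y_simple) simp
    then show "{\<omega> \<in> space M. Y i \<omega> = y i} \<in> sets M"
      using simple_functionD(2)[of M "Y i" "{y i}"] by (simp add: vimage_def Int_def conj_commute)
  qed auto
  ultimately show ?thesis by simp
next
  case False
  then have "{\<omega> \<in> space M. yv n \<omega> = y} = {}" by (auto simp: yv_def)
  then show ?thesis by (simp only: sets.empty_sets)
qed

lemma simple_yv: "simple_function M (yv n)"
  unfolding simple_function_def
proof
  have "yv n ` space M \<subseteq> PiE {1..n} (\<lambda>i. Y i ` space M)"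
    unfolding yv_def by (intro image_subsetI restrict_PiE_iff[THEN iffD2] ballI imageI)
  moreover have "finite (PiE {1..n} (\<lambda>i. Y i ` space M))"
    using Y_simple by (intro finite_PiE) (auto simp: simple_function_def)
  ultimately show "finite (yv n ` space M)" by (rule finite_subset)
  show "\<forall>x\<in>yv n ` space M. yv n -` {x} \<inter> space M \<in> events"
  proof
    fix x
    have "yv n -` {x} \<inter> space M = {\<omega> \<in> space M. yv n \<omega> = x}" by auto
    then show "yv n -` {x} \<inter> space M \<in> events" using yv_event by (simp only:)
  qed
qed

lemma simple_G:
  assumes n: "2 \<le> n"
  shows "simple_function (F n) (G n)" "simple_function M (G n)"
proof -
  have fin: "finite (G n ` space M)"
    by (rule finite_subset[OF _ finite_graphs[of n]]) (use G_graph n in auto)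
  have "G n -` {g} \<inter> space M = {\<omega> \<in> space M. G n \<omega> = g}" for g by auto
  then have meas: "G n -` {g} \<inter> space M \<in> sets (F n)" for g using G_meas[OF n] by (simp only:)
  show "simple_function (F n) (G n)" "simple_function M (G n)"
    unfolding simple_function_def space_F[OF n] using fin meas sets_F[OF n meas] by blast+
qed

lemma simple_stat: "2 \<le> n \<Longrightarrow> simple_function M (\<lambda>\<omega>. h (G n \<omega>) (yv n \<omega>))"
  by (rule simple_function_compose2[OF simple_G(2) simple_yv])

lemma borel_measurable_stat [measurable]:
  fixes h :: "(nat \<Rightarrow> nat) \<Rightarrow> (nat \<Rightarrow> nat) \<Rightarrow> real"
  shows "2 \<le> n \<Longrightarrow> (\<lambda>\<omega>. h (G n \<omega>) (yv n \<omega>)) \<in> borel_measurable M"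
  by (rule borel_measurable_simple_function[OF simple_stat])

lemma integrable_simple:
  fixes f :: "'w \<Rightarrow> real"
  assumes f: "simple_function M f"
  shows "integrable M f"
proof (rule integrable_const_bound[of _ "\<Sum>z\<in>f ` space M. \<bar>z\<bar>"])
  have fin: "finite (f ` space M)" using f by (simp add: simple_function_def)
  show "AE \<omega> in M. norm (f \<omega>) \<le> (\<Sum>z\<in>f ` space M. \<bar>z\<bar>)"
    using fin by (auto intro!: AE_I2 member_le_sum[where f = abs])
qed (rule borel_measurable_simple_function[OF f])

lemma integrable_stat:
  fixes h :: "(nat \<Rightarrow> nat) \<Rightarrow> (nat \<Rightarrow> nat) \<Rightarrow> real"
  shows "2 \<le> n \<Longrightarrow> integrable M (\<lambda>\<omega>. h (G n \<omega>) (yv n \<omega>))"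
  by (rule integrable_simple[OF simple_stat])

lemma yv_eq_iff:
  assumes "y \<in> labellings {1..n}"
  shows "yv n \<omega> = y \<longleftrightarrow> (\<forall>i\<in>{1..n}. Y i \<omega> = y i)"
  using assms by (auto simp: yv_def labellings_def PiE_iff extensional_def fun_eq_iff)

lemma joint_yv:
  assumes n: "2 \<le> n" and A: "A \<in> sets (F n)" and y: "y \<in> labellings {1..n}"
  shows "prob {\<omega> \<in> A. yv n \<omega> = y} = wt {1..n} y * prob A"
proof -
  have "A \<subseteq> space M" using sets.sets_into_space[OF sets_F[OF n A]] .
  then have "{\<omega> \<in> A. yv n \<omega> = y} = A \<inter> {\<omega> \<in> space M. \<forall>i\<in>{1..n}. Y i \<omega> = y i}"
    using yv_eq_iff[OF y] by auto
  then show ?thesis using joint[OF n A y] by simp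
qed

text \<open>\<open>joint\<close> fixes the probability of each labelling, and these weights already
  sum to one, so values outside \<open>{1..K}\<close> have probability zero.\<close>

lemma AE_yv:
  assumes n: "2 \<le> n"
  shows "AE \<omega> in M. yv n \<omega> \<in> labellings {1..n}"
proof -
  have "{\<omega> \<in> space M. yv n \<omega> \<in> labellings {1..n}} = (\<Union>y\<in>labellings {1..n}. {\<omega> \<in> space M. yv n \<omega> = y})"
    by auto
  then have "prob {\<omega> \<in> space M. yv n \<omega> \<in> labellings {1..n}}
      = prob (\<Union>y\<in>labellings {1..n}. {\<omega> \<in> space M. yv n \<omega> = y})" by simp
  also have "\<dots> = (\<Sum>y\<in>labellings {1..n}. prob {\<omega> \<in> space M. yv n \<omega> = y})"
    by (rule finite_measure_finite_Union) (auto simp: finite_labellings yv_event disjoint_family_on_def)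
  also have "\<dots> = (\<Sum>y\<in>labellings {1..n}. wt {1..n} y)"
  proof (intro sum.cong refl)
    fix y assume y: "y \<in> labellings {1..n}"
    have "space M \<in> sets (F n)" using space_F[OF n] by (metis sets.top)
    from joint_yv[OF n this y] show "prob {\<omega> \<in> space M. yv n \<omega> = y} = wt {1..n} y"
      by (simp add: prob_space)
  qed
  also have "\<dots> = 1" by (rule sum_wt) simp
  finally have "AE \<omega> in M. \<omega> \<in> {\<omega> \<in> space M. yv n \<omega> \<in> labellings {1..n}}" by (rule AE_prob_1)
  then show ?thesis by eventually_elim simp
qed

text \<open>The defining property of conditional expectation given \<open>F n\<close>. Up to a null
  set the integrand is a finite sum over graphs and labellings, and on each graph event
  \<open>joint\<close> replaces the labels by their weights.\<close>

lemma set_integral_stat: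
  fixes h :: "(nat \<Rightarrow> nat) \<Rightarrow> (nat \<Rightarrow> nat) \<Rightarrow> real"
  assumes n: "2 \<le> n" and A: "A \<in> sets (F n)"
  shows "(\<integral>\<omega>\<in>A. h (G n \<omega>) (yv n \<omega>) \<partial>M) = (\<integral>\<omega>\<in>A. Ex {1..n} (h (G n \<omega>)) \<partial>M)"
proof -
  let ?Ag = "\<lambda>g. A \<inter> {\<omega> \<in> space M. G n \<omega> = g}"
  let ?Agy = "\<lambda>g y. {\<omega> \<in> ?Ag g. yv n \<omega> = y}"
  have AM: "A \<subseteq> space M" using sets.sets_into_space[OF sets_F[OF n A]] .
  have Ag: "?Ag g \<in> sets (F n)" for g using A G_meas[OF n] by auto
  have Agy: "?Agy g y \<in> sets M" for g y
  proof -
    have "?Agy g y = ?Ag g \<inter> {\<omega> \<in> space M. yv n \<omega> = y}" by auto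
    then show ?thesis using sets_F[OF n Ag] yv_event by auto
  qed
  have "(\<integral>\<omega>\<in>A. h (G n \<omega>) (yv n \<omega>) \<partial>M)
      = (\<integral>\<omega>. (\<Sum>g\<in>graphs n. \<Sum>y\<in>labellings {1..n}. h g y * indicator (?Agy g y) \<omega>) \<partial>M)"
    unfolding set_lebesgue_integral_def
  proof (rule integral_cong_AE)
    show "(\<lambda>\<omega>. \<Sum>g\<in>graphs n. \<Sum>y\<in>labellings {1..n}. h g y * indicator (?Agy g y) \<omega>) \<in> borel_measurable M"
      by (intro borel_measurable_sum borel_measurable_times borel_measurable_const borel_measurable_indicator Agy)
    show "(\<lambda>\<omega>. indicat_real A \<omega> *\<^sub>R h (G n \<omega>) (yv n \<omega>)) \<in> borel_measurable M"
      by (intro borel_measurable_scaleR borel_measurable_indicator sets_F[OF n A] borel_measurable_stat[OF n])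
    show "AE \<omega> in M. indicat_real A \<omega> *\<^sub>R h (G n \<omega>) (yv n \<omega>)
        = (\<Sum>g\<in>graphs n. \<Sum>y\<in>labellings {1..n}. h g y * indicator (?Agy g y) \<omega>)"
      using AE_yv[OF n] AE_space
    proof eventually_elim
      case (elim \<omega>)
      have "(\<Sum>g\<in>graphs n. \<Sum>y\<in>labellings {1..n}. h g y * indicator (?Agy g y) \<omega>)
          = (\<Sum>g\<in>graphs n. if g = G n \<omega> then h (G n \<omega>) (yv n \<omega>) * indicator A \<omega> else 0)"
      proof (intro sum.cong refl)
        fix g
        have "(\<Sum>y\<in>labellings {1..n}. h g y * indicator (?Agy g y) \<omega>)
            = (\<Sum>y\<in>labellings {1..n}. if y = yv n \<omega> then (if g = G n \<omega> then h (G n \<omega>) (yv n \<omega>) * indicator A \<omega> else 0) else 0)"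
          using elim(2) by (intro sum.cong refl) (auto simp: indicator_def)
        also have "\<dots> = (if g = G n \<omega> then h (G n \<omega>) (yv n \<omega>) * indicator A \<omega> else 0)"
          using elim(1) by (simp add: finite_labellings)
        finally show "(\<Sum>y\<in>labellings {1..n}. h g y * indicator (?Agy g y) \<omega>)
            = (if g = G n \<omega> then h (G n \<omega>) (yv n \<omega>) * indicator A \<omega> else 0)" .
      qed
      also have "\<dots> = h (G n \<omega>) (yv n \<omega>) * indicator A \<omega>"
        using G_graph[OF n elim(2)] by (simp add: finite_graphs)
      finally show ?case by simp
    qed
  qed
  also have "\<dots> = (\<Sum>g\<in>graphs n. \<Sum>y\<in>labellings {1..n}. h g y * prob (?Agy g y))"
  proof -
    have int: "integrable M (\<lambda>\<omega>. h g y * indicator (?Agy g y) \<omega>)" for g y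
      using Agy by (intro integrable_mult_right) (auto simp: less_top[symmetric])
    have "(\<integral>\<omega>. (\<Sum>g\<in>graphs n. \<Sum>y\<in>labellings {1..n}. h g y * indicator (?Agy g y) \<omega>) \<partial>M)
        = (\<Sum>g\<in>graphs n. \<Sum>y\<in>labellings {1..n}. \<integral>\<omega>. h g y * indicator (?Agy g y) \<omega> \<partial>M)"
    proof -
      have "(\<integral>\<omega>. (\<Sum>y\<in>labellings {1..n}. h g y * indicator (?Agy g y) \<omega>) \<partial>M)
          = (\<Sum>y\<in>labellings {1..n}. \<integral>\<omega>. h g y * indicator (?Agy g y) \<omega> \<partial>M)" for g
        by (rule Bochner_Integration.integral_sum) (rule int)
      note inner = this
      have "(\<integral>\<omega>. (\<Sum>g\<in>graphs n. \<Sum>y\<in>labellings {1..n}. h g y * indicator (?Agy g y) \<omega>) \<partial>M)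
          = (\<Sum>g\<in>graphs n. \<integral>\<omega>. (\<Sum>y\<in>labellings {1..n}. h g y * indicator (?Agy g y) \<omega>) \<partial>M)"
        by (rule Bochner_Integration.integral_sum) (intro Bochner_Integration.integrable_sum int)
      then show ?thesis unfolding inner .
    qed
    moreover have "(\<integral>\<omega>. h g y * indicator (?Agy g y) \<omega> \<partial>M) = h g y * prob (?Agy g y)" for g y
      using Agy by simp
    ultimately show ?thesis by (simp only:)
  qed
  also have "\<dots> = (\<Sum>g\<in>graphs n. Ex {1..n} (h g) * prob (?Ag g))"
    using joint_yv[OF n Ag] by (intro sum.cong refl) (simp add: Ex_def sum_distrib_left mult_ac)
  also have "\<dots> = (\<integral>\<omega>. (\<Sum>g\<in>graphs n. Ex {1..n} (h g) * indicator (?Ag g) \<omega>) \<partial>M)"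
  proof -
    have int: "integrable M (\<lambda>\<omega>. Ex {1..n} (h g) * indicator (?Ag g) \<omega>)" for g
      using sets_F[OF n Ag] by (intro integrable_mult_right) (auto simp: less_top[symmetric])
    have "(\<integral>\<omega>. Ex {1..n} (h g) * indicator (?Ag g) \<omega> \<partial>M) = Ex {1..n} (h g) * prob (?Ag g)" for g
      using sets_F[OF n Ag] by simp
    moreover have "(\<integral>\<omega>. (\<Sum>g\<in>graphs n. Ex {1..n} (h g) * indicator (?Ag g) \<omega>) \<partial>M)
        = (\<Sum>g\<in>graphs n. \<integral>\<omega>. Ex {1..n} (h g) * indicator (?Ag g) \<omega> \<partial>M)"
      by (rule Bochner_Integration.integral_sum) (rule int)
    ultimately show ?thesis by (simp only:)
  qed
  also have "\<dots> = (\<integral>\<omega>\<in>A. Ex {1..n} (h (G n \<omega>)) \<partial>M)"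
    unfolding set_lebesgue_integral_def
  proof (intro Bochner_Integration.integral_cong refl)
    fix \<omega> assume \<omega>: "\<omega> \<in> space M"
    have "(\<Sum>g\<in>graphs n. Ex {1..n} (h g) * indicator (?Ag g) \<omega>)
        = (\<Sum>g\<in>graphs n. if g = G n \<omega> then Ex {1..n} (h (G n \<omega>)) * indicator A \<omega> else 0)"
      using \<omega> by (intro sum.cong refl) (auto simp: indicator_def)
    then show "(\<Sum>g\<in>graphs n. Ex {1..n} (h g) * indicator (?Ag g) \<omega>)
        = indicator A \<omega> *\<^sub>R Ex {1..n} (h (G n \<omega>))"
      using G_graph[OF n \<omega>] by (simp add: finite_graphs)
  qed
  finally show ?thesis .
qed

lemma expectation_stat:
  fixes h :: "(nat \<Rightarrow> nat) \<Rightarrow> (nat \<Rightarrow> nat) \<Rightarrow> real"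
  assumes n: "2 \<le> n"
  shows "expectation (\<lambda>\<omega>. h (G n \<omega>) (yv n \<omega>)) = expectation (\<lambda>\<omega>. Ex {1..n} (h (G n \<omega>)))"
proof -
  have "space M \<in> sets (F n)" using space_F[OF n] by (metis sets.top)
  from set_integral_stat[OF n this, of h] show ?thesis
    unfolding set_integral_space[OF integrable_stat[OF n]]
      set_integral_space[OF integrable_stat[OF n, of "\<lambda>g _. Ex {1..n} (h g)"]] .
qed

lemma cond_exp_stat:
  fixes h :: "(nat \<Rightarrow> nat) \<Rightarrow> (nat \<Rightarrow> nat) \<Rightarrow> real"
  assumes n: "2 \<le> n"
  shows "AE \<omega> in M. real_cond_exp M (F n) (\<lambda>\<omega>. h (G n \<omega>) (yv n \<omega>)) \<omega> = Ex {1..n} (h (G n \<omega>))"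
proof -
  interpret S: finite_measure_subalgebra M "F n"
    by unfold_locales (rule subalg[OF n])
  show ?thesis
  proof (rule S.real_cond_exp_charact)
    show "(\<lambda>\<omega>. Ex {1..n} (h (G n \<omega>))) \<in> borel_measurable (F n)"
      by (rule borel_measurable_simple_function)
        (rule simple_function_compose1[OF simple_G(1)[OF n], of "\<lambda>g. Ex {1..n} (h g)"])
  qed (use set_integral_stat[OF n] integrable_stat[OF n] integrable_stat[OF n, of "\<lambda>g _. Ex {1..n} (h g)"] in auto)
qed

lemma cond_cov_stat:
  fixes h1 h2 :: "(nat \<Rightarrow> nat) \<Rightarrow> (nat \<Rightarrow> nat) \<Rightarrow> real"
  assumes n: "2 \<le> n"
  shows "AE \<omega> in M. cond_cov M (F n) (\<lambda>\<omega>. h1 (G n \<omega>) (yv n \<omega>)) (\<lambda>\<omega>. h2 (G n \<omega>) (yv n \<omega>)) \<omega>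
    = Ex {1..n} (\<lambda>y. (h1 (G n \<omega>) y - Ex {1..n} (h1 (G n \<omega>))) * (h2 (G n \<omega>) y - Ex {1..n} (h2 (G n \<omega>))))"
proof -
  interpret S: finite_measure_subalgebra M "F n"
    by unfold_locales (rule subalg[OF n])
  let ?h = "\<lambda>g y. (h1 g y - Ex {1..n} (h1 g)) * (h2 g y - Ex {1..n} (h2 g))"
  let ?V = "\<lambda>h \<omega>. h (G n \<omega>) (yv n \<omega>) - real_cond_exp M (F n) (\<lambda>\<omega>. h (G n \<omega>) (yv n \<omega>)) \<omega>"
  have "AE \<omega> in M. real_cond_exp M (F n) (\<lambda>\<omega>. ?V h1 \<omega> * ?V h2 \<omega>) \<omega>
      = real_cond_exp M (F n) (\<lambda>\<omega>. ?h (G n \<omega>) (yv n \<omega>)) \<omega>"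
  proof (rule S.real_cond_exp_cong)
    show "AE \<omega> in M. ?V h1 \<omega> * ?V h2 \<omega> = ?h (G n \<omega>) (yv n \<omega>)"
      using cond_exp_stat[OF n, of h1] cond_exp_stat[OF n, of h2] by eventually_elim simp
    show "(\<lambda>\<omega>. ?V h1 \<omega> * ?V h2 \<omega>) \<in> borel_measurable M"
      by (intro borel_measurable_times borel_measurable_diff borel_measurable_stat[OF n] borel_measurable_cond_exp2)
  qed (rule borel_measurable_stat[OF n])
  then show ?thesis
    unfolding cond_cov_def using cond_exp_stat[OF n, of ?h] by eventually_elim simp
qed

end

text \<open>Telescoping a product turns an error \<open>c * \<epsilon>\<close> into
  \<open>(2 * c + 1) * \<epsilon>\<close>, the 2 bounding an estimated factor; hence 3, 7 and 15 for
  two, three and four factors. Each bracket is at most 2, and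
  \<open>64 = 2 * (15 + 7 + 7 + 3)\<close>.\<close>

lemma Sigma_formula_Lipschitz:
  assumes p: "\<And>k. k \<in> S \<Longrightarrow> 0 \<le> p k \<and> p k \<le> 1" and near: "\<And>k. k \<in> S \<Longrightarrow> \<bar>p' k - p k\<bar> \<le> \<epsilon>"
    and \<epsilon>: "\<epsilon> \<le> 1" and w: "0 \<le> w" "w \<le> 1"
    and k: "k1 \<in> S" "l1 \<in> S" "k2 \<in> S" "l2 \<in> S"
  shows "\<bar>Sigma_formula p' w k1 l1 k2 l2 - Sigma_formula p w k1 l1 k2 l2\<bar> \<le> 64 * \<epsilon>"
proof -
  have \<epsilon>0: "0 \<le> \<epsilon>" using near[OF k(1)] by linarith
  have prod: "\<bar>a' * b' - a * b\<bar> \<le> (2 * c + 1) * \<epsilon> \<and> \<bar>a * b\<bar> \<le> 1"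
    if "\<bar>a' - a\<bar> \<le> c * \<epsilon>" "\<bar>a\<bar> \<le> 1" "\<bar>b' - b\<bar> \<le> \<epsilon>" "\<bar>b\<bar> \<le> 1" "0 \<le> c" for a a' b b' c :: real
  proof
    have b': "\<bar>b'\<bar> \<le> 2" using that \<epsilon> by linarith
    have "a' * b' - a * b = (a' - a) * b' + a * (b' - b)" by (simp add: algebra_simps)
    then have "\<bar>a' * b' - a * b\<bar> \<le> \<bar>a' - a\<bar> * \<bar>b'\<bar> + \<bar>a\<bar> * \<bar>b' - b\<bar>"
      by (metis abs_mult abs_triangle_ineq)
    also have "\<dots> \<le> (c * \<epsilon>) * 2 + 1 * \<epsilon>"
      using that b' \<epsilon>0 by (intro add_mono mult_mono) auto
    finally show "\<bar>a' * b' - a * b\<bar> \<le> (2 * c + 1) * \<epsilon>" by (simp add: algebra_simps)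
    show "\<bar>a * b\<bar> \<le> 1" unfolding abs_mult using that by (intro mult_le_one) auto
  qed
  have b: "\<bar>p' k - p k\<bar> \<le> \<epsilon>" "\<bar>p k\<bar> \<le> 1" if "k \<in> S" for k using near[OF that] p[OF that] by auto
  have 2: "\<bar>p' i * p' j - p i * p j\<bar> \<le> 3 * \<epsilon> \<and> \<bar>p i * p j\<bar> \<le> 1" if "i \<in> S" "j \<in> S" for i j
    using prod[of "p' i" "p i" 1 "p' j" "p j"] b[OF that(1)] b[OF that(2)] by simp
  have 3: "\<bar>p' i * p' j * p' l - p i * p j * p l\<bar> \<le> 7 * \<epsilon> \<and> \<bar>p i * p j * p l\<bar> \<le> 1" if "i \<in> S" "j \<in> S" "l \<in> S" for i j l
    using prod[of "p' i * p' j" "p i * p j" 3 "p' l" "p l"] 2[OF that(1,2)] b[OF that(3)] by simp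
  have 4: "\<bar>p' i * p' j * p' l * p' m - p i * p j * p l * p m\<bar> \<le> 15 * \<epsilon>" if "i \<in> S" "j \<in> S" "l \<in> S" "m \<in> S" for i j l m
    using prod[of "p' i * p' j * p' l" "p i * p j * p l" 7 "p' m" "p m"] 3[OF that(1,2,3)] b[OF that(4)] by simp
  have m: "\<bar>x' * c - x * c\<bar> \<le> e * 2" if "\<bar>x' - x\<bar> \<le> e" "0 \<le> c" "c \<le> 2" for x x' c e :: real
  proof -
    have "\<bar>x' * c - x * c\<bar> = \<bar>x' - x\<bar> * c" using that by (simp add: left_diff_distrib[symmetric] abs_mult)
    also have "\<dots> \<le> e * 2" using that by (intro mult_mono) auto
    finally show ?thesis .
  qed
  have c: "0 \<le> of_bool P + w * of_bool Q \<and> of_bool P + w * of_bool Q \<le> 2" for P Q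
    using w by auto
  note 1 = m[OF 4[OF k(1,2,3,4)], of "1 + w"] m[OF conjunct1[OF 3[OF k(1,2,4)]] conjunct1[OF c] conjunct2[OF c], of "k1 = k2" "l1 = k2"]
    m[OF conjunct1[OF 3[OF k(1,2,3)]] conjunct1[OF c] conjunct2[OF c], of "l1 = l2" "k1 = l2"]
    m[OF conjunct1[OF 2[OF k(1,2)]] conjunct1[OF c] conjunct2[OF c], of "k1 = k2 \<and> l1 = l2" "k1 = l2 \<and> l1 = k2"]
  show ?thesis
    using 1 w unfolding Sigma_formula_def by linarith
qed

section \<open>Consistency of the covariance matrices and tightness of the statistic\<close>

context random_graphs
begin

abbreviation "pdim \<equiv> (K - 1)\<^sup>2"

definition dev :: "nat \<Rightarrow> (nat \<Rightarrow> nat) \<Rightarrow> nat \<Rightarrow> (nat \<Rightarrow> nat) \<Rightarrow> real" where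
  "dev n g r y = label_graph.pdev K n g (row_ix r) (col_ix r) y"

definition rmd :: "nat \<Rightarrow> (nat \<Rightarrow> nat) \<Rightarrow> nat \<Rightarrow> (nat \<Rightarrow> nat) \<Rightarrow> real" where
  "rmd n g r y = label_graph.remainder p n g (row_ix r) (col_ix r) y"

definition sig :: "real \<Rightarrow> nat \<Rightarrow> nat \<Rightarrow> real" where
  "sig w r s = Sigma_formula p w (row_ix r) (col_ix r) (row_ix s) (col_ix s)"

text \<open>\<open>\<bar>Z\<bar>\<^sup>2\<close> for the decorrelated vector. The kernels use the
  proportion of mutual edges of the graph itself, so the identity covariance is exact on each graph
  where that proportion is below 1.\<close>

definition limit_form :: "nat \<Rightarrow> (nat \<Rightarrow> nat) \<Rightarrow> (nat \<Rightarrow> nat) \<Rightarrow> real" where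
  "limit_form n g y = (\<Sum>r<pdim. (label_graph.edge_sum n g (decorr (label_graph.mutual n g) r) y)\<^sup>2)"

lemma graph: "2 \<le> n \<Longrightarrow> \<omega> \<in> space M \<Longrightarrow> label_graph K p n (G n \<omega>)"
  using G_graph[of n \<omega>] by (intro label_graphI) auto

lemma collisions_bounds:
  assumes "label_graph K p n g"
  shows "0 \<le> label_graph.collisions n g" "label_graph.collisions n g \<le> (real n)\<^sup>2"
proof -
  interpret label_graph K p n g by fact
  show "0 \<le> collisions" unfolding collisions_def by (intro sum_nonneg) auto
  have "collisions \<le> (\<Sum>i\<in>V. \<Sum>j\<in>V. 1)" unfolding collisions_def by (intro sum_mono) auto
  then show "collisions \<le> (real n)\<^sup>2" by (simp add: power2_eq_square)
qed

lemma whp_collisions: "0 < \<epsilon> \<Longrightarrow> whp (\<lambda>n \<omega>. label_graph.collisions n (G n \<omega>) / (real n)\<^sup>2 \<le> \<epsilon>)"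
proof (rule whp_Markov[OF _ _ collisions_lim])
  show "\<forall>\<^sub>F n in sequentially. integrable M (\<lambda>\<omega>. label_graph.collisions n (G n \<omega>) / (real n)\<^sup>2)"
    using eventually_ge_at_top[of 2]
    by eventually_elim (rule integrable_stat[of _ "\<lambda>g _. label_graph.collisions _ g / (real _)\<^sup>2"])
  show "\<forall>\<^sub>F n in sequentially. \<forall>\<omega>\<in>space M. 0 \<le> label_graph.collisions n (G n \<omega>) / (real n)\<^sup>2"
    using eventually_ge_at_top[of 2]
    by eventually_elim (auto intro!: divide_nonneg_nonneg collisions_bounds(1)[OF graph])
qed

lemma eventually_two_over_n: "0 < \<epsilon> \<Longrightarrow> \<forall>\<^sub>F n in sequentially. 2 / real n \<le> \<epsilon>"
proof -
  assume \<epsilon>: "0 < \<epsilon>"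
  have "(\<lambda>n. 2 / real n) \<longlonglongrightarrow> 0" by (rule tendsto_divide_0[OF tendsto_const filterlim_real_sequentially[THEN filterlim_at_top_imp_at_infinity]])
  from order_tendstoD(2)[OF this \<epsilon>] show ?thesis by eventually_elim simp
qed

lemma whp_cond_cov:
  assumes rs: "r < pdim" "s < pdim" and \<epsilon>: "0 < \<epsilon>"
  shows "whp (\<lambda>n \<omega>. \<bar>cond_cov M (F n) (\<lambda>\<omega>. dev n (G n \<omega>) r (yv n \<omega>)) (\<lambda>\<omega>. dev n (G n \<omega>) s (yv n \<omega>)) \<omega>
      - sig (label_graph.mutual n (G n \<omega>)) r s\<bar> \<le> \<epsilon>)"
proof -
  let ?C = "\<lambda>n \<omega>. cond_cov M (F n) (\<lambda>\<omega>. dev n (G n \<omega>) r (yv n \<omega>)) (\<lambda>\<omega>. dev n (G n \<omega>) s (yv n \<omega>)) \<omega>"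
  let ?E = "\<lambda>n \<omega>. Ex {1..n} (\<lambda>y. (dev n (G n \<omega>) r y - Ex {1..n} (dev n (G n \<omega>) r)) * (dev n (G n \<omega>) s y - Ex {1..n} (dev n (G n \<omega>) s)))"
  \<comment> \<open>\<open>6 * \<tau>\<close> is the error in \<open>pcov_approx\<close>, whose
    smallness condition is split evenly between the collisions and \<open>2 / n\<close>.\<close>
  define \<tau> where "\<tau> = min 1 (\<epsilon> / 6)"
  have \<tau>: "0 < \<tau>" "\<tau> \<le> 1" "6 * \<tau> \<le> \<epsilon>" using \<epsilon> by (auto simp: \<tau>_def)
  have "whp (\<lambda>n \<omega>. label_graph.collisions n (G n \<omega>) / (real n)\<^sup>2 \<le> \<tau>\<^sup>2 / 2)"
    using \<tau> by (intro whp_collisions) auto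
  moreover have "whp (\<lambda>n \<omega>. ?C n \<omega>
      = ?E n \<omega>)"
  proof (rule whp_AE)
    show "\<forall>\<^sub>F n in sequentially. AE \<omega> in M. ?C n \<omega>
      = ?E n \<omega>"
      using eventually_ge_at_top[of 2]
      by eventually_elim (rule cond_cov_stat[of _ "\<lambda>g. dev _ g r" "\<lambda>g. dev _ g s"])
  qed
  ultimately have "whp (\<lambda>n \<omega>. label_graph.collisions n (G n \<omega>) / (real n)\<^sup>2 \<le> \<tau>\<^sup>2 / 2 \<and>
      ?C n \<omega>
      = ?E n \<omega>)"
    by (rule whp_conj)
  moreover have "\<forall>\<^sub>F n in sequentially. 2 / real n \<le> \<tau>\<^sup>2 / 2" using \<tau> by (intro eventually_two_over_n) auto
  with eventually_ge_at_top[of 2]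
  have "\<forall>\<^sub>F n in sequentially. \<forall>\<omega>\<in>space M. label_graph.collisions n (G n \<omega>) / (real n)\<^sup>2 \<le> \<tau>\<^sup>2 / 2 \<and>
      ?C n \<omega>
      = ?E n \<omega>
      \<longrightarrow> \<bar>?C n \<omega>
      - sig (label_graph.mutual n (G n \<omega>)) r s\<bar> \<le> \<epsilon>"
  proof eventually_elim
    case (elim n)
    show ?case
    proof (intro ballI impI, elim conjE)
      fix \<omega> assume \<omega>: "\<omega> \<in> space M"
        and c: "label_graph.collisions n (G n \<omega>) / (real n)\<^sup>2 \<le> \<tau>\<^sup>2 / 2"
        and eq: "?C n \<omega>
          = ?E n \<omega>"
      interpret label_graph K p n "G n \<omega>" by (rule graph[OF elim(1) \<omega>])
      have dev_eta: "dev n (G n \<omega>) q = pdev (row_ix q) (col_ix q)" for q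
        by (simp add: dev_def fun_eq_iff)
      have "collisions / (real n)\<^sup>2 + 2 / real n \<le> \<tau>\<^sup>2" using c elim(2) by linarith
      from pcov_approx[OF ix_range_K[OF rs(1)] ix_range_K[OF rs(2)] \<tau>(1,2) this]
      show "\<bar>?C n \<omega>
          - sig (label_graph.mutual n (G n \<omega>)) r s\<bar> \<le> \<epsilon>"
        using \<tau>(3) unfolding eq dev_eta sig_def pcov_def[symmetric] by linarith
    qed
  qed
  ultimately show ?thesis by (rule whp_eventually_mono)
qed

text \<open>From \<open>(a - b)\<^sup>2 \<le> 2 * a\<^sup>2 + 2 * b\<^sup>2\<close>, with second
  moments at most 2 for the edge sum and, by the trivial bound on collisions, also for the
  remainder.\<close>

lemma Ex_dev_square_le:
  assumes n: "2 \<le> n" and g: "label_graph K p n g" and r: "r < pdim"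
  shows "Ex {1..n} (\<lambda>y. (dev n g r y)\<^sup>2) \<le> 8"
proof -
  interpret label_graph K p n g by fact
  let ?k = "row_ix r" and ?l = "col_ix r"
  have "Ex V (\<lambda>y. (dev n g r y)\<^sup>2) \<le> Ex V (\<lambda>y. 2 * (edge_sum (cind2 ?k ?l) y)\<^sup>2 + 2 * (remainder ?k ?l y)\<^sup>2)"
  proof (rule Ex_mono)
    fix y assume y: "y \<in> labellings V"
    have "(a - b)\<^sup>2 \<le> 2 * a\<^sup>2 + 2 * b\<^sup>2" for a b :: real
    proof -
      have "2 * a\<^sup>2 + 2 * b\<^sup>2 - (a - b)\<^sup>2 = (a + b)\<^sup>2" by (simp add: power2_eq_square algebra_simps)
      then show ?thesis using zero_le_power2[of "a + b"] by linarith
    qed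
    then show "(dev n g r y)\<^sup>2 \<le> 2 * (edge_sum (cind2 ?k ?l) y)\<^sup>2 + 2 * (remainder ?k ?l y)\<^sup>2"
      by (simp add: dev_def pdev_eq[OF y])
  qed
  also have "\<dots> = 2 * Ex V (\<lambda>y. (edge_sum (cind2 ?k ?l) y)\<^sup>2) + 2 * Ex V (\<lambda>y. (remainder ?k ?l y)\<^sup>2)"
    unfolding Ex_add Ex_mult_left ..
  also have "\<dots> \<le> 2 * 2 + 2 * (collisions / (real n)\<^sup>2 + 2 / n)"
    by (intro add_mono mult_left_mono Ex_edge_sum_square_le Ex_remainder_square ix_range_K r) auto
  also have "\<dots> \<le> 2 * 2 + 2 * (1 + 1)"
    using collisions_bounds(2)[OF g] n by (intro add_left_mono mult_left_mono add_mono) (auto simp: field_simps)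
  finally show ?thesis by simp
qed

lemma tight_dev:
  assumes e: "0 < e"
  obtains R where "0 < R"
    "\<forall>\<^sub>F n in sequentially. \<exists>B\<in>sets M. prob B \<le> e \<and> (\<forall>\<omega>\<in>space M - B. \<forall>r<pdim. \<bar>dev n (G n \<omega>) r (yv n \<omega>)\<bar> \<le> R)"
proof -
  \<comment> \<open>Chebyshev's inequality with second moment 8 then leaves probability
    \<open>e / pdim\<close> for each of the \<open>pdim\<close> coordinates.\<close>
  define R where "R = sqrt (8 * real pdim / e)"
  have pdim: "0 < real pdim" using K_ge by simp
  have R: "0 < R" "R\<^sup>2 = 8 * real pdim / e" using e pdim by (auto simp: R_def)
  let ?S = "\<lambda>n r. {\<omega> \<in> space M. R\<^sup>2 \<le> (dev n (G n \<omega>) r (yv n \<omega>))\<^sup>2}"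
  have "\<forall>\<^sub>F n in sequentially. \<exists>B\<in>sets M. prob B \<le> e \<and> (\<forall>\<omega>\<in>space M - B. \<forall>r<pdim. \<bar>dev n (G n \<omega>) r (yv n \<omega>)\<bar> \<le> R)"
    using eventually_ge_at_top[of 2]
  proof eventually_elim
    case (elim n)
    have [measurable]: "(\<lambda>\<omega>. dev n (G n \<omega>) r (yv n \<omega>)) \<in> borel_measurable M" for r
      by (rule borel_measurable_stat[OF elim])
    have S: "?S n r \<in> sets M" for r by measurable
    have "prob (?S n r) \<le> e / real pdim" if r: "r < pdim" for r
    proof -
      have "prob (?S n r) \<le> expectation (\<lambda>\<omega>. (dev n (G n \<omega>) r (yv n \<omega>))\<^sup>2) / R\<^sup>2"
        using R(1) by (intro integral_Markov_inequality_measure[where A = "{}"] integrable_stat[OF elim, of "\<lambda>g y. (dev n g r y)\<^sup>2"]) auto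
      also have "expectation (\<lambda>\<omega>. (dev n (G n \<omega>) r (yv n \<omega>))\<^sup>2) = expectation (\<lambda>\<omega>. Ex {1..n} (\<lambda>y. (dev n (G n \<omega>) r y)\<^sup>2))"
        by (rule expectation_stat[OF elim])
      also have "\<dots> \<le> expectation (\<lambda>\<omega>. 8)"
        using Ex_dev_square_le[OF elim graph[OF elim] r]
        by (intro integral_mono integrable_stat[OF elim, of "\<lambda>g _. Ex {1..n} (\<lambda>y. (dev n g r y)\<^sup>2)"]) auto
      also have "\<dots> / R\<^sup>2 = e / real pdim" using R pdim e by (simp add: prob_space field_simps)
      finally show ?thesis by (simp add: divide_right_mono)
    qed
    then have "(\<Sum>r<pdim. prob (?S n r)) \<le> (\<Sum>r<pdim. e / real pdim)" by (intro sum_mono) auto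
    also have "\<dots> = e" using pdim by simp
    finally have sum_le: "(\<Sum>r<pdim. prob (?S n r)) \<le> e" .
    have "?S n ` {..<pdim} \<subseteq> events" using S by blast
    from order_trans[OF finite_measure_subadditive_finite[OF _ this] sum_le]
    have "prob (\<Union>r<pdim. ?S n r) \<le> e" by simp
    moreover have "\<bar>dev n (G n \<omega>) r (yv n \<omega>)\<bar> \<le> R" if "\<omega> \<in> space M - (\<Union>r<pdim. ?S n r)" "r < pdim" for \<omega> r
    proof -
      have "(dev n (G n \<omega>) r (yv n \<omega>))\<^sup>2 < R\<^sup>2" using that by force
      then show ?thesis using R(1) abs_le_square_iff[of "dev n (G n \<omega>) r (yv n \<omega>)" R] by simp
    qed
    ultimately show ?case using S by (intro bexI[of _ "\<Union>r<pdim. ?S n r"]) auto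
  qed
  then show thesis using R(1) that by blast
qed

text \<open>A conditional second moment bounded by the collisions and \<open>2 / n\<close> tends to
  zero in mean, and Markov's inequality applies to the square. This serves the remainders as well as
  the marginal frequencies.\<close>

lemma whp_square_small:
  assumes h: "\<And>n g. 2 \<le> n \<Longrightarrow> label_graph K p n g \<Longrightarrow>
      Ex {1..n} (\<lambda>y. (h n g y)\<^sup>2) \<le> label_graph.collisions n g / (real n)\<^sup>2 + 2 / real n"
    and \<epsilon>: "0 < \<epsilon>"
  shows "whp (\<lambda>n \<omega>. \<bar>h n (G n \<omega>) (yv n \<omega>)\<bar> \<le> \<epsilon>)"
proof -
  have "whp (\<lambda>n \<omega>. (h n (G n \<omega>) (yv n \<omega>))\<^sup>2 \<le> \<epsilon>\<^sup>2)"
  proof (rule whp_Markov)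
    show "\<forall>\<^sub>F n in sequentially. integrable M (\<lambda>\<omega>. (h n (G n \<omega>) (yv n \<omega>))\<^sup>2)"
      using eventually_ge_at_top[of 2]
      by eventually_elim (rule integrable_stat[of _ "\<lambda>g y. (h _ g y)\<^sup>2"])
    show "(\<lambda>n. expectation (\<lambda>\<omega>. (h n (G n \<omega>) (yv n \<omega>))\<^sup>2)) \<longlonglongrightarrow> 0"
    proof (rule tendsto_sandwich[where f = "\<lambda>_. 0"])
      have "(\<lambda>n. 2 / real n) \<longlonglongrightarrow> 0" by (rule tendsto_divide_0[OF tendsto_const filterlim_real_sequentially[THEN filterlim_at_top_imp_at_infinity]])
      from tendsto_add[OF collisions_lim this]
      show "(\<lambda>n. expectation (\<lambda>\<omega>. label_graph.collisions n (G n \<omega>) / (real n)\<^sup>2) + 2 / real n) \<longlonglongrightarrow> 0" by simp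
      show "\<forall>\<^sub>F n in sequentially. expectation (\<lambda>\<omega>. (h n (G n \<omega>) (yv n \<omega>))\<^sup>2)
          \<le> expectation (\<lambda>\<omega>. label_graph.collisions n (G n \<omega>) / (real n)\<^sup>2) + 2 / real n"
        using eventually_ge_at_top[of 2]
      proof eventually_elim
        case (elim n)
        note int = integrable_stat[OF elim, of "\<lambda>g _. label_graph.collisions n g / (real n)\<^sup>2"]
        have "expectation (\<lambda>\<omega>. (h n (G n \<omega>) (yv n \<omega>))\<^sup>2) = expectation (\<lambda>\<omega>. Ex {1..n} (\<lambda>y. (h n (G n \<omega>) y)\<^sup>2))"
          by (rule expectation_stat[OF elim])
        also have "\<dots> \<le> expectation (\<lambda>\<omega>. label_graph.collisions n (G n \<omega>) / (real n)\<^sup>2 + 2 / real n)"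
          using h[OF elim graph[OF elim]] int
          by (intro integral_mono integrable_stat[OF elim, of "\<lambda>g _. Ex {1..n} (\<lambda>y. (h n g y)\<^sup>2)"]) auto
        also have "\<dots> = expectation (\<lambda>\<omega>. label_graph.collisions n (G n \<omega>) / (real n)\<^sup>2) + 2 / real n"
          using int by (simp add: prob_space)
        finally show ?case .
      qed
    qed (auto intro!: always_eventually integral_nonneg_AE)
  qed (use \<epsilon> in auto)
  then show ?thesis
    by (rule whp_mono) (metis \<epsilon> abs_le_square_iff abs_of_pos)
qed

lemma whp_rmd: "r < pdim \<Longrightarrow> 0 < \<epsilon> \<Longrightarrow> whp (\<lambda>n \<omega>. \<bar>rmd n (G n \<omega>) r (yv n \<omega>)\<bar> \<le> \<epsilon>)"
  unfolding rmd_def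
  by (rule whp_square_small[where h = "\<lambda>n g y. label_graph.remainder p n g (row_ix r) (col_ix r) y"])
    (auto intro!: label_graph.Ex_remainder_square ix_range_K simp del: One_nat_def)

lemma whp_marginal:
  assumes k: "k \<in> {1..K}" and \<epsilon>: "0 < \<epsilon>"
  shows "whp (\<lambda>n \<omega>. \<bar>(\<Sum>m=1..K. label_graph.pfreq n (G n \<omega>) k m (yv n \<omega>)) - p k\<bar> \<le> \<epsilon>)"
proof (rule whp_square_small[where h = "\<lambda>n g y. (\<Sum>m=1..K. label_graph.pfreq n g k m y) - p k", OF _ \<epsilon>])
  fix n g assume "2 \<le> n" and g: "label_graph K p n g"
  show "Ex {1..n} (\<lambda>y. ((\<Sum>m=1..K. label_graph.pfreq n g k m y) - p k)\<^sup>2) \<le> label_graph.collisions n g / (real n)\<^sup>2 + 2 / real n"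
  proof -
    have "1 / real n \<le> label_graph.collisions n g / (real n)\<^sup>2 + 2 / real n"
      using collisions_bounds(1)[OF g] by (intro order_trans[OF _ add_increasing[OF _ order_refl]]) (auto intro: divide_right_mono)
    then show ?thesis
      using label_graph.Ex_marginal_square[OF g k] by linarith
  qed
qed

lemma whp_Sigma_formula_plugin:
  assumes rs: "r < pdim" "s < pdim" and \<epsilon>: "0 < \<epsilon>"
  shows "whp (\<lambda>n \<omega>. \<bar>Sigma_formula (\<lambda>k. \<Sum>m=1..K. label_graph.pfreq n (G n \<omega>) k m (yv n \<omega>)) (label_graph.mutual n (G n \<omega>))
      (row_ix r) (col_ix r) (row_ix s) (col_ix s) - sig (label_graph.mutual n (G n \<omega>)) r s\<bar> \<le> \<epsilon>)"
proof -
  define \<eta> where "\<eta> = min 1 (\<epsilon> / 64)"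
  have \<eta>: "0 < \<eta>" "\<eta> \<le> 1" "64 * \<eta> \<le> \<epsilon>" using \<epsilon> by (auto simp: \<eta>_def)
  have "whp (\<lambda>n \<omega>. \<forall>k\<in>{1..K}. \<bar>(\<Sum>m=1..K. label_graph.pfreq n (G n \<omega>) k m (yv n \<omega>)) - p k\<bar> \<le> \<eta>)"
    using whp_marginal[OF _ \<eta>(1)] by (intro whp_finite_ball) auto
  then show ?thesis
  proof (rule whp_eventually_mono)
    show "\<forall>\<^sub>F n in sequentially. \<forall>\<omega>\<in>space M.
      (\<forall>k\<in>{1..K}. \<bar>(\<Sum>m=1..K. label_graph.pfreq n (G n \<omega>) k m (yv n \<omega>)) - p k\<bar> \<le> \<eta>) \<longrightarrow>
      \<bar>Sigma_formula (\<lambda>k. \<Sum>m=1..K. label_graph.pfreq n (G n \<omega>) k m (yv n \<omega>)) (label_graph.mutual n (G n \<omega>))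
      (row_ix r) (col_ix r) (row_ix s) (col_ix s) - sig (label_graph.mutual n (G n \<omega>)) r s\<bar> \<le> \<epsilon>"
      using eventually_ge_at_top[of 2]
    proof eventually_elim
      case (elim n)
      show ?case
      proof (intro ballI impI)
        fix \<omega> assume \<omega>: "\<omega> \<in> space M" and near: "\<forall>k\<in>{1..K}. \<bar>(\<Sum>m=1..K. label_graph.pfreq n (G n \<omega>) k m (yv n \<omega>)) - p k\<bar> \<le> \<eta>"
        interpret label_graph K p n "G n \<omega>" by (rule graph[OF elim \<omega>])
        have "\<bar>Sigma_formula (\<lambda>k. \<Sum>m=1..K. pfreq k m (yv n \<omega>)) mutual (row_ix r) (col_ix r) (row_ix s) (col_ix s)
            - Sigma_formula p mutual (row_ix r) (col_ix r) (row_ix s) (col_ix s)\<bar> \<le> 64 * \<eta>"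
          by (rule Sigma_formula_Lipschitz[where S = "{1..K}"])
            (use near p_nonneg p_le_1 \<eta>(2) mutual_nonneg mutual_le_1 ix_range_K[OF rs(1)] ix_range_K[OF rs(2)] in blast)+
        then show "\<bar>Sigma_formula (\<lambda>k. \<Sum>m=1..K. label_graph.pfreq n (G n \<omega>) k m (yv n \<omega>)) (label_graph.mutual n (G n \<omega>))
          (row_ix r) (col_ix r) (row_ix s) (col_ix s) - sig (label_graph.mutual n (G n \<omega>)) r s\<bar> \<le> \<epsilon>"
          using \<eta>(3) unfolding sig_def by linarith
      qed
    qed
  qed
qed

end

section \<open>The chi-squared limit on random graphs\<close>

lemma gauss_error_mono:
  assumes "0 \<le> \<eta>" "\<eta> \<le> \<eta>'"
  shows "gauss_error d \<eta> \<le> gauss_error d \<eta>'"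
proof -
  interpret prob_space "gauss_vec d" by (rule prob_space_gauss_vec)
  have [measurable]: "(\<lambda>\<theta>. \<Sum>r<d. \<bar>\<theta> r\<bar>) \<in> borel_measurable (gauss_vec d)"
    by (rule borel_measurable_gauss_vec_sum) measurable
  have int: "integrable (gauss_vec d) (\<lambda>\<theta>. min 2 (\<eta> * (\<Sum>r<d. \<bar>\<theta> r\<bar>) ^ 3))" if "0 \<le> \<eta>" for \<eta>
    using that by (intro integrable_const_bound[of _ 2]) (auto simp: sum_nonneg)
  show ?thesis
    unfolding gauss_error_def
  proof (rule integral_mono)
    show "integrable (gauss_vec d) (\<lambda>\<theta>. min 2 (\<eta> * (\<Sum>r<d. \<bar>\<theta> r\<bar>) ^ 3))"
      "integrable (gauss_vec d) (\<lambda>\<theta>. min 2 (\<eta>' * (\<Sum>r<d. \<bar>\<theta> r\<bar>) ^ 3))"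
      using assms by (auto intro!: int)
    show "min 2 (\<eta> * (\<Sum>r<d. \<bar>\<theta> r\<bar>) ^ 3) \<le> min 2 (\<eta>' * (\<Sum>r<d. \<bar>\<theta> r\<bar>) ^ 3)" for \<theta>
      using assms by (intro min.mono mult_right_mono) (auto simp: sum_nonneg)
  qed
qed

lemma Laplace_chi_squared_bounds:
  "0 \<le> (\<integral>u. exp (- (real m * u)) \<partial>chi_squared d)" "(\<integral>u. exp (- (real m * u)) \<partial>chi_squared d) \<le> 1"
proof -
  interpret real_distribution "chi_squared d" by (rule real_distribution_chi_squared)
  show "0 \<le> (\<integral>u. exp (- (real m * u)) \<partial>chi_squared d)" by (rule integral_nonneg_AE) auto
  have "(\<integral>u. exp (- (real m * u)) \<partial>chi_squared d) \<le> (\<integral>u. 1 \<partial>chi_squared d)"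
  proof (rule integral_mono_AE)
    show "integrable (chi_squared d) (\<lambda>u. exp (- (real m * u)))"
      by (rule integrable_const_bound[of _ 1]) (use AE_chi_squared_nonneg[of d] in \<open>auto elim!: eventually_mono\<close>)
    show "AE u in chi_squared d. exp (- (real m * u)) \<le> 1"
      using AE_chi_squared_nonneg[of d] by eventually_elim simp
  qed simp
  then show "(\<integral>u. exp (- (real m * u)) \<partial>chi_squared d) \<le> 1" using prob_space by simp
qed

context random_graphs
begin

definition hb :: "real \<Rightarrow> real" where "hb b = (1 + 1 / sqrt b) * helm_max\<^sup>2"

lemma hb_nonneg: "0 < b \<Longrightarrow> 0 \<le> hb b"
  by (simp add: hb_def)

text \<open>The kernel \<open>\<phi>\<close> mixes the decorrelated kernels with weights
  \<open>sqrt (2 m) \<theta> r\<close>. Orthonormality makes its variance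
  \<open>2 m \<bar>\<theta>\<bar>\<^sup>2\<close>, whose Gaussian characteristic function at 1 is
  the required \<open>exp (- m \<bar>\<theta>\<bar>\<^sup>2)\<close>. Its bound is linear in the
  absolute values of the \<open>\<theta> r\<close>, hence the cube in the Stein error.\<close>

lemma Laplace_limit_form_bound:
  fixes m :: nat
  assumes g: "label_graph K p n g" and b: "0 < b" "label_graph.mutual n g \<le> 1 - b"
    and D: "\<And>i. i \<in> {1..n} \<Longrightarrow> card (label_graph.star n g i) \<le> D" "(real D)\<^sup>2 / sqrt n \<le> \<kappa>"
  shows "\<bar>Ex {1..n} (\<lambda>y. exp (- (real m * limit_form n g y))) - (\<integral>u. exp (- (real m * u)) \<partial>chi_squared pdim)\<bar>
    \<le> gauss_error pdim (7 * (sqrt (2 * real m) * hb b) ^ 3 * \<kappa>)"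
proof -
  interpret label_graph K p n g by fact
  let ?s = "sqrt (2 * real m)"
  have w: "0 \<le> mutual" "mutual < 1" using mutual_nonneg b by auto
  have \<kappa>: "0 \<le> \<kappa>" by (rule order_trans[OF _ D(2)]) simp
  show ?thesis
    unfolding limit_form_def
  proof (rule Laplace_via_Gauss)
    show "0 \<le> 7 * (?s * hb b) ^ 3 * \<kappa>" using \<kappa> hb_nonneg[OF b(1)] by simp
    fix \<theta> :: "nat \<Rightarrow> real"
    define \<phi> where "\<phi> = (\<lambda>a c. \<Sum>r<pdim. (?s * \<theta> r) * decorr mutual r a c)"
    define B where "B = ?s * hb b * (\<Sum>r<pdim. \<bar>\<theta> r\<bar>)"
    interpret N: normal_approx K p n g \<phi> B D
    proof
      show "degenerate \<phi>"
        unfolding \<phi>_def by (intro degenerate_sum degenerate_decorr) auto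
      fix a c assume ac: "a \<in> {1..K}" "c \<in> {1..K}"
      have "\<bar>\<phi> a c\<bar> \<le> (\<Sum>r<pdim. (?s * \<bar>\<theta> r\<bar>) * hb b)"
        unfolding \<phi>_def hb_def
        by (intro order_trans[OF sum_abs] sum_mono)
          (auto simp: abs_mult simp del: One_nat_def intro!: mult_left_mono decorr_le mutual_nonneg b ac)
      then show "\<bar>\<phi> a c\<bar> \<le> B" by (simp add: B_def sum_distrib_left mult_ac)
    next
      fix i assume "i \<in> {1..n}"
      then show "card (star i) \<le> D" by (rule D(1))
    qed
    have es: "edge_sum \<phi> y = ?s * (\<Sum>r<pdim. \<theta> r * edge_sum (decorr mutual r) y)" for y
    proof -
      have "(\<Sum>i\<in>V. edge \<phi> i y) = (\<Sum>r<pdim. (?s * \<theta> r) * (\<Sum>i\<in>V. edge (decorr mutual r) i y))"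
        unfolding edge_def \<phi>_def sum_distrib_left by (rule sum.swap)
      then show ?thesis
        by (simp add: edge_sum_def sum_distrib_left sum_divide_distrib mult_ac)
    qed
    have "Ex V (\<lambda>y. (edge_sum \<phi> y)\<^sup>2) = form mutual \<phi> \<phi>"
      unfolding power2_eq_square by (intro Ex_edge_sum_mult N.deg)
    also have "\<dots> = (\<Sum>r<pdim. (?s * \<theta> r) * (\<Sum>r'<pdim. (?s * \<theta> r') * form mutual (decorr mutual r) (decorr mutual r')))"
      unfolding \<phi>_def form_sum_left form_sum_right ..
    also have "\<dots> = (\<Sum>r<pdim. (?s * \<theta> r) * (\<Sum>r'<pdim. if r = r' then ?s * \<theta> r' else 0))"
    proof (intro sum.cong refl arg_cong2[where f = "(*)"])
      fix r r' assume "r \<in> {..<pdim}" "r' \<in> {..<pdim}"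
      then show "(?s * \<theta> r') * form mutual (decorr mutual r) (decorr mutual r') = (if r = r' then ?s * \<theta> r' else 0)"
        by (simp add: form_decorr[OF w] del: One_nat_def)
    qed
    also have "\<dots> = (\<Sum>r<pdim. 2 * real m * (\<theta> r)\<^sup>2)"
      by (intro sum.cong refl) (simp add: power2_eq_square mult_ac)
    also have "\<dots> = 2 * (real m * (\<Sum>r<pdim. (\<theta> r)\<^sup>2))"
      by (simp add: sum_distrib_left mult_ac)
    finally have var: "Ex V (\<lambda>y. (edge_sum \<phi> y)\<^sup>2) = 2 * (real m * (\<Sum>r<pdim. (\<theta> r)\<^sup>2))" .
    have "cmod (Ex V (\<lambda>y. cis (?s * (\<Sum>r<pdim. \<theta> r * edge_sum (decorr mutual r) y)))
        - of_real (exp (- (real m * (\<Sum>r<pdim. (\<theta> r)\<^sup>2))))) \<le> 7 * B ^ 3 * (real D)\<^sup>2 / sqrt n"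
      using N.char_fun_bound unfolding var unfolding es by simp
    also have "\<dots> = 7 * B ^ 3 * ((real D)\<^sup>2 / sqrt n)" by simp
    also have "\<dots> \<le> 7 * B ^ 3 * \<kappa>"
      using N.B_nonneg by (intro mult_left_mono D(2)) auto
    also have "\<dots> = 7 * (?s * hb b) ^ 3 * \<kappa> * (\<Sum>r<pdim. \<bar>\<theta> r\<bar>) ^ 3"
      by (simp add: B_def power_mult_distrib mult_ac)
    finally show "cmod (Ex V (\<lambda>y. cis (?s * (\<Sum>r<pdim. \<theta> r * edge_sum (decorr mutual r) y)))
        - of_real (exp (- (real m * (\<Sum>r<pdim. (\<theta> r)\<^sup>2)))))
      \<le> 7 * (?s * hb b) ^ 3 * \<kappa> * (\<Sum>r<pdim. \<bar>\<theta> r\<bar>) ^ 3" .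
  qed simp
qed

lemma limit_form_nonneg: "label_graph K p n g \<Longrightarrow> 0 \<le> limit_form n g y"
  by (simp add: limit_form_def sum_nonneg)

lemma powr_quarter_square: "0 < n \<Longrightarrow> (real n powr (1/4))\<^sup>2 = sqrt (real n)"
  by (simp add: power2_eq_square powr_add[symmetric] powr_half_sqrt)

text \<open>The transform is the mean of its conditional value \<open>E\<close> given the graph.
  \<open>E\<close> is bounded and, with high probability, close to the chi-squared
  transform.\<close>

lemma Laplace_limit_form:
  fixes L :: "nat \<Rightarrow> 'w \<Rightarrow> nat" and m :: nat
  assumes b: "0 < b" and W: "whp (\<lambda>n \<omega>. label_graph.mutual n (G n \<omega>) \<le> 1 - b)"
    and L: "\<And>\<epsilon>. 0 < \<epsilon> \<Longrightarrow> whp (\<lambda>n \<omega>. real (L n \<omega>) \<le> \<epsilon> * real n powr (1/4))"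
    and star: "\<And>n \<omega> i. 2 \<le> n \<Longrightarrow> \<omega> \<in> space M \<Longrightarrow> i \<in> {1..n} \<Longrightarrow> card (label_graph.star n (G n \<omega>) i) \<le> L n \<omega> + 1"
  shows "(\<lambda>n. expectation (\<lambda>\<omega>. exp (- (real m * limit_form n (G n \<omega>) (yv n \<omega>)))))
    \<longlonglongrightarrow> (\<integral>u. exp (- (real m * u)) \<partial>chi_squared pdim)"
proof -
  define lam where "lam = (\<integral>u. exp (- (real m * u)) \<partial>chi_squared pdim)"
  define E where "E n g = Ex {1..n} (\<lambda>y. exp (- (real m * limit_form n g y)))" for n g
  have E01: "0 \<le> E n g \<and> E n g \<le> 1" if "label_graph K p n g" for n g
  proof
    show "0 \<le> E n g" unfolding E_def by (rule Ex_nonneg) simp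
    have "E n g \<le> Ex {1..n} (\<lambda>y. 1)"
      unfolding E_def using limit_form_nonneg[OF that] by (intro Ex_mono) simp
    then show "E n g \<le> 1" by simp
  qed
  have "(\<lambda>n. expectation (\<lambda>\<omega>. E n (G n \<omega>) - lam)) \<longlonglongrightarrow> 0"
  proof (rule expectation_tendsto_0[where c = "1::real"])
    fix \<delta> :: real assume "\<delta> > 0"
    then obtain \<eta> where \<eta>: "0 < \<eta>" "gauss_error pdim \<eta> < \<delta>" by (rule gauss_error_small)
    define C where "C = 7 * (sqrt (2 * real m) * hb b) ^ 3"
    have C: "0 \<le> C" using hb_nonneg[OF b] by (simp add: C_def)
    \<comment> \<open>The \<open>+ 1\<close> avoids a division by zero: \<open>C\<close> vanishes
      for \<open>m = 0\<close>.\<close>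
    define \<kappa> where "\<kappa> = \<eta> / (C + 1)"
    have \<kappa>: "0 < \<kappa>" using \<eta> C by (simp add: \<kappa>_def)
    have C\<kappa>: "C * \<kappa> \<le> \<eta>" "0 \<le> C * \<kappa>" using \<eta> C by (auto simp: \<kappa>_def field_simps)
    \<comment> \<open>In \<open>(L + 1)\<^sup>2 \<le> 2 * L\<^sup>2 + 2\<close> this makes the first
      term at most half of \<open>\<kappa> * sqrt n\<close>; the other half absorbs the constant 2
      for large \<open>n\<close>.\<close>
    have "whp (\<lambda>n \<omega>. label_graph.mutual n (G n \<omega>) \<le> 1 - b \<and> real (L n \<omega>) \<le> (sqrt \<kappa> / 2) * real n powr (1/4))"
      using \<kappa> by (intro whp_conj W L) simp
    then show "whp (\<lambda>n \<omega>. \<bar>E n (G n \<omega>) - lam\<bar> \<le> \<delta>)"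
    proof (rule whp_eventually_mono)
      have "(\<lambda>n. 2 / sqrt (real n)) \<longlonglongrightarrow> 0"
        by (rule tendsto_divide_0[OF tendsto_const filterlim_compose[OF sqrt_at_top filterlim_real_sequentially, THEN filterlim_at_top_imp_at_infinity]])
      then have "\<forall>\<^sub>F n in sequentially. 2 / sqrt (real n) < \<kappa> / 2" using \<kappa> by (intro order_tendstoD(2)) auto
      with eventually_ge_at_top[of 2]
      show "\<forall>\<^sub>F n in sequentially. \<forall>\<omega>\<in>space M. label_graph.mutual n (G n \<omega>) \<le> 1 - b
          \<and> real (L n \<omega>) \<le> (sqrt \<kappa> / 2) * real n powr (1/4) \<longrightarrow> \<bar>E n (G n \<omega>) - lam\<bar> \<le> \<delta>"
      proof eventually_elim
        case (elim n)
        show ?case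
        proof (intro ballI impI, elim conjE)
          fix \<omega> assume \<omega>: "\<omega> \<in> space M" and mut: "label_graph.mutual n (G n \<omega>) \<le> 1 - b"
            and l: "real (L n \<omega>) \<le> (sqrt \<kappa> / 2) * real n powr (1/4)"
          have sn: "0 < sqrt (real n)" using elim(1) by simp
          have "(real (L n \<omega>))\<^sup>2 \<le> ((sqrt \<kappa> / 2) * real n powr (1/4))\<^sup>2"
            using l by (intro power_mono) auto
          also have "\<dots> = \<kappa> / 4 * sqrt (real n)"
            using \<kappa> elim(1) powr_quarter_square[of n] by (simp add: power_mult_distrib power_divide)
          finally have l2: "(real (L n \<omega>))\<^sup>2 \<le> \<kappa> / 4 * sqrt (real n)" .
          have "0 \<le> (real (L n \<omega>) - 1)\<^sup>2" by simp
          then have "(real (L n \<omega> + 1))\<^sup>2 \<le> 2 * (real (L n \<omega>))\<^sup>2 + 2"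
            by (simp add: power2_eq_square algebra_simps)
          also have "\<dots> \<le> \<kappa> / 2 * sqrt (real n) + \<kappa> / 2 * sqrt (real n)"
            using l2 elim(2) sn by (simp add: field_simps)
          finally have D: "(real (L n \<omega> + 1))\<^sup>2 / sqrt n \<le> \<kappa>" using sn by (simp add: field_simps)
          have "\<bar>E n (G n \<omega>) - lam\<bar> \<le> gauss_error pdim (7 * (sqrt (2 * real m) * hb b) ^ 3 * \<kappa>)"
            unfolding E_def lam_def
            by (rule Laplace_limit_form_bound[OF graph[OF elim(1) \<omega>] b mut star[OF elim(1) \<omega>] D])
          also have "\<dots> \<le> gauss_error pdim \<eta>"
            using gauss_error_mono[OF C\<kappa>(2,1)] by (simp add: C_def)
          finally show "\<bar>E n (G n \<omega>) - lam\<bar> \<le> \<delta>" using \<eta>(2) by simp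
        qed
      qed
    qed
  next
    show "\<forall>\<^sub>F n in sequentially. (\<lambda>\<omega>. E n (G n \<omega>) - lam) \<in> borel_measurable M"
      using eventually_ge_at_top[of 2]
      by eventually_elim (rule borel_measurable_stat[of _ "\<lambda>g _. E _ g - lam"])
    show "\<forall>\<^sub>F n in sequentially. \<forall>\<omega>\<in>space M. \<bar>E n (G n \<omega>) - lam\<bar> \<le> 1"
      using eventually_ge_at_top[of 2]
    proof eventually_elim
      case (elim n)
      show ?case
      proof
        fix \<omega> assume "\<omega> \<in> space M"
        from E01[OF graph[OF elim this]] Laplace_chi_squared_bounds[where m = m and d = pdim]
        show "\<bar>E n (G n \<omega>) - lam\<bar> \<le> 1" unfolding lam_def by linarith
      qed
    qed
  qed simp
  from tendsto_add[OF this tendsto_const[of lam]]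
  have "(\<lambda>n. expectation (\<lambda>\<omega>. E n (G n \<omega>) - lam) + lam) \<longlonglongrightarrow> lam" by simp
  then show ?thesis
    unfolding lam_def[symmetric]
  proof (rule Lim_transform_eventually)
    show "\<forall>\<^sub>F n in sequentially. expectation (\<lambda>\<omega>. E n (G n \<omega>) - lam) + lam
        = expectation (\<lambda>\<omega>. exp (- (real m * limit_form n (G n \<omega>) (yv n \<omega>))))"
      using eventually_ge_at_top[of 2]
    proof eventually_elim
      case (elim n)
      have "expectation (\<lambda>\<omega>. exp (- (real m * limit_form n (G n \<omega>) (yv n \<omega>)))) = expectation (\<lambda>\<omega>. E n (G n \<omega>))"
        unfolding E_def by (rule expectation_stat[OF elim, of "\<lambda>g y. exp (- (real m * limit_form n g y))"])
      moreover have "expectation (\<lambda>\<omega>. E n (G n \<omega>) - lam) = expectation (\<lambda>\<omega>. E n (G n \<omega>)) - lam"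
        using integrable_stat[OF elim, of "\<lambda>g _. E n g"] by (simp add: prob_space)
      ultimately show ?case by simp
    qed
  qed
qed

lemma cts_step_limit_form:
  fixes L :: "nat \<Rightarrow> 'w \<Rightarrow> nat"
  assumes b: "0 < b" and W: "whp (\<lambda>n \<omega>. label_graph.mutual n (G n \<omega>) \<le> 1 - b)"
    and L: "\<And>\<epsilon>. 0 < \<epsilon> \<Longrightarrow> whp (\<lambda>n \<omega>. real (L n \<omega>) \<le> \<epsilon> * real n powr (1/4))"
    and star: "\<And>n \<omega> i. 2 \<le> n \<Longrightarrow> \<omega> \<in> space M \<Longrightarrow> i \<in> {1..n} \<Longrightarrow> card (label_graph.star n (G n \<omega>) i) \<le> L n \<omega> + 1"
    and xy: "x < y"
  shows "(\<lambda>n. expectation (\<lambda>\<omega>. cts_step x y (limit_form n (G n \<omega>) (yv n \<omega>))))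
    \<longlonglongrightarrow> integral\<^sup>L (chi_squared pdim) (cts_step x y)"
proof -
  \<comment> \<open>The hypotheses on the graph begin at \<open>n = 2\<close>. The shift makes every
    member of the sequence a law on the half line and is undone at the end.\<close>
  let ?J = "\<lambda>n \<omega>. limit_form (n + 2) (G (n + 2) \<omega>) (yv (n + 2) \<omega>)"
  have J[measurable]: "?J n \<in> borel_measurable M" for n
    by (rule borel_measurable_stat) simp
  define \<mu> where "\<mu> n = distr M borel (?J n)" for n
  have int: "integral\<^sup>L (\<mu> n) f = expectation (\<lambda>\<omega>. f (?J n \<omega>))" if "f \<in> borel_measurable borel" for f :: "real \<Rightarrow> real" and n
    unfolding \<mu>_def by (rule integral_distr[OF J that])
  have "(\<lambda>n. integral\<^sup>L (\<mu> n) (cts_step x y)) \<longlonglongrightarrow> integral\<^sup>L (chi_squared pdim) (cts_step x y)"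
  proof (rule cts_step_conv_of_Laplace[OF _ _ real_distribution_chi_squared AE_chi_squared_nonneg _ xy])
    show "real_distribution (\<mu> n)" for n unfolding \<mu>_def by (rule real_distribution_distr[OF J])
    show "AE u in \<mu> n. 0 \<le> u" for n
      unfolding \<mu>_def by (subst AE_distr_iff) (auto intro!: AE_I2 limit_form_nonneg graph)
    fix m :: nat
    have "(\<lambda>n. expectation (\<lambda>\<omega>. exp (- (real m * ?J n \<omega>)))) \<longlonglongrightarrow> (\<integral>u. exp (- (real m * u)) \<partial>chi_squared pdim)"
      by (rule LIMSEQ_ignore_initial_segment[OF Laplace_limit_form[OF b W L star]])
    then show "(\<lambda>n. \<integral>u. exp (- (real m * u)) \<partial>\<mu> n) \<longlonglongrightarrow> (\<integral>u. exp (- (real m * u)) \<partial>chi_squared pdim)"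
      by (subst int) auto
  qed
  then have "(\<lambda>n. expectation (\<lambda>\<omega>. cts_step x y (?J n \<omega>))) \<longlonglongrightarrow> integral\<^sup>L (chi_squared pdim) (cts_step x y)"
    by (subst (asm) int[OF borel_measurable_cts_step[OF xy]])
  then show ?thesis by (rule LIMSEQ_offset)
qed

text \<open>A deterministic estimate. The choice of \<open>\<epsilon>\<close> before
  \<open>n\<close>, the graph, the matrix and the labels makes it applicable to random graphs; only
  the bound \<open>R\<close> on the statistic has to be known beforehand, besides \<open>b\<close>
  and \<open>\<delta>\<close>.\<close>

lemma inv_quad_form_approx:
  assumes b: "0 < b" and R: "0 \<le> R" and \<delta>: "0 < \<delta>"
  shows "\<exists>\<epsilon>>0. \<forall>n g A v y. label_graph K p n g \<longrightarrow> label_graph.mutual n g \<le> 1 - b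
      \<longrightarrow> A \<in> carrier_mat pdim pdim \<longrightarrow> v \<in> carrier_vec pdim \<longrightarrow> y \<in> labellings {1..n}
      \<longrightarrow> (\<forall>r<pdim. \<forall>s<pdim. \<bar>A $$ (r, s) - sig (label_graph.mutual n g) r s\<bar> \<le> \<epsilon>)
      \<longrightarrow> (\<forall>r<pdim. vec_index v r = dev n g r y \<and> \<bar>dev n g r y\<bar> \<le> R \<and> \<bar>rmd n g r y\<bar> \<le> \<epsilon>)
      \<longrightarrow> invertible_mat A \<and> \<bar>inv_quad_form A v - limit_form n g y\<bar> \<le> \<delta>"
proof -
  define d where "d = real pdim"
  define h where "h = (1 + 1 / sqrt b) * (4 * helm_max\<^sup>2)"
  have d0: "0 \<le> d" and h0: "0 \<le> h" using b by (auto simp: d_def h_def)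
  \<comment> \<open>\<open>C1\<close> is the price of inverting \<open>A\<close> instead of the
    explicit matrix, \<open>C2\<close> that of restoring the remainders, a difference of squares in
    each coordinate; \<open>C3\<close> belongs to the contraction condition
    \<open>small\<close>.\<close>
  define C1 where "C1 = 2 * (d * (d * h\<^sup>2))\<^sup>2 * (d * R)\<^sup>2"
  define C2 where "C2 = d * (d * h * (2 * (d * h * R) + d * h))"
  define C3 where "C3 = d\<^sup>2 * (d * h\<^sup>2)"
  have C0: "0 \<le> C1" "0 \<le> C2" "0 \<le> C3" using d0 h0 R by (auto simp: C1_def C2_def C3_def)
  define \<epsilon> where "\<epsilon> = min 1 (min (\<delta> / (C1 + C2 + 1)) (1 / (2 * (C3 + 1))))"
  have \<epsilon>: "0 < \<epsilon>" "\<epsilon> \<le> 1" using \<delta> C0 by (auto simp: \<epsilon>_def)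
  have \<epsilon>1: "(C1 + C2) * \<epsilon> \<le> \<delta>"
  proof -
    have "(C1 + C2) * \<epsilon> \<le> (C1 + C2 + 1) * (\<delta> / (C1 + C2 + 1))"
      using C0 \<epsilon> \<delta> by (intro mult_mono) (auto simp: \<epsilon>_def)
    also have "\<dots> = \<delta>" using C0 by simp
    finally show ?thesis .
  qed
  have \<epsilon>3: "C3 * \<epsilon> \<le> 1 / 2"
  proof -
    have "C3 * \<epsilon> \<le> (C3 + 1) * (1 / (2 * (C3 + 1)))"
      using C0 \<epsilon> by (intro mult_mono) (auto simp: \<epsilon>_def)
    also have "\<dots> = 1 / 2" using C0 by (simp add: field_simps)
    finally show ?thesis .
  qed
  show ?thesis
  proof (intro exI[of _ \<epsilon>] conjI allI impI)
    show "0 < \<epsilon>" by (rule \<epsilon>(1))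
    fix n g A v y
    assume g: "label_graph K p n g" and mut: "label_graph.mutual n g \<le> 1 - b"
      and A: "A \<in> carrier_mat pdim pdim" and v: "v \<in> carrier_vec pdim" and y: "y \<in> labellings {1..n}"
      and near': "\<forall>r<pdim. \<forall>s<pdim. \<bar>A $$ (r, s) - sig (label_graph.mutual n g) r s\<bar> \<le> \<epsilon>"
      and dev': "\<forall>r<pdim. vec_index v r = dev n g r y \<and> \<bar>dev n g r y\<bar> \<le> R \<and> \<bar>rmd n g r y\<bar> \<le> \<epsilon>"
    have near: "\<bar>A $$ (r, s) - sig (label_graph.mutual n g) r s\<bar> \<le> \<epsilon>" if "r < pdim" "s < pdim" for r s
      using near' that by blast
    have vd: "vec_index v r = dev n g r y" and dR: "\<bar>dev n g r y\<bar> \<le> R" and rm: "\<bar>rmd n g r y\<bar> \<le> \<epsilon>" if "r < pdim" for r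
      using dev' that by blast+
    have "invertible_mat A \<and> \<bar>inv_quad_form A v - limit_form n g y\<bar> \<le> \<delta>"
    proof -
      interpret label_graph K p n g by fact
      let ?H = "decorr_mat mutual"
      have w: "0 \<le> mutual" "mutual < 1" using mutual_nonneg mut b by auto
      have H: "\<bar>?H r s\<bar> \<le> h" if "r < pdim" "s < pdim" for r s
        unfolding h_def by (rule decorr_mat_le[OF w(1) mut b that])
      interpret C: near_congruence pdim A ?H "sig mutual" h \<epsilon>
      proof
        show "(real pdim)\<^sup>2 * (real pdim * h\<^sup>2) * \<epsilon> \<le> 1 / 2"
          using \<epsilon>3 by (simp add: C3_def d_def)
      qed (use A near H h0 \<epsilon>(1) decorr_mat_congruence[OF w] in \<open>auto simp: sig_def simp del: One_nat_def\<close>)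
      have nv: "(\<Sum>s<pdim. \<bar>vec_index v s\<bar>) \<le> d * R"
      proof -
        have "(\<Sum>s<pdim. \<bar>vec_index v s\<bar>) \<le> (\<Sum>s<pdim. R)" by (intro sum_mono) (use vd dR in auto)
        then show ?thesis by (simp add: d_def)
      qed
      have "2 * (real pdim * C.\<beta>)\<^sup>2 * \<epsilon> * (\<Sum>s<pdim. \<bar>vec_index v s\<bar>)\<^sup>2 \<le> 2 * (real pdim * C.\<beta>)\<^sup>2 * \<epsilon> * (d * R)\<^sup>2"
        using \<epsilon>(1) nv by (intro mult_left_mono power_mono) (auto intro!: sum_nonneg mult_nonneg_nonneg)
      also have "\<dots> = C1 * \<epsilon>" unfolding C1_def C.\<beta>_def d_def by (simp add: mult_ac)
      finally have 1: "\<bar>inv_quad_form A v - (\<Sum>r<pdim. (\<Sum>s<pdim. ?H r s * vec_index v s)\<^sup>2)\<bar> \<le> C1 * \<epsilon>"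
        using C.inv_quad_form_near[OF v] by linarith
      have es: "edge_sum (decorr mutual r) y = (\<Sum>s<pdim. ?H r s * vec_index v s) + (\<Sum>s<pdim. ?H r s * rmd n g s y)"
        if r: "r < pdim" for r
      proof -
        have "(\<Sum>i\<in>V. edge (decorr mutual r) i y) = (\<Sum>i\<in>V. \<Sum>s<pdim. ?H r s * edge (cind2 (row_ix s) (col_ix s)) i y)"
          unfolding edge_def using labellings_range[OF y] N_in by (intro sum.cong refl decorr_eq[OF r]) auto
        also have "\<dots> = (\<Sum>s<pdim. ?H r s * (\<Sum>i\<in>V. edge (cind2 (row_ix s) (col_ix s)) i y))"
          unfolding sum_distrib_left by (rule sum.swap)
        finally have "edge_sum (decorr mutual r) y = (\<Sum>s<pdim. ?H r s * edge_sum (cind2 (row_ix s) (col_ix s)) y)"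
          by (simp only: edge_sum_def sum_divide_distrib[where A = "{..<pdim}"] times_divide_eq_right)
        also have "\<dots> = (\<Sum>s<pdim. ?H r s * vec_index v s + ?H r s * rmd n g s y)"
        proof (intro sum.cong refl)
          fix s assume "s \<in> {..<pdim}"
          then have "edge_sum (cind2 (row_ix s) (col_ix s)) y = vec_index v s + rmd n g s y"
            using pdev_eq[OF y, of "row_ix s" "col_ix s"] vd[of s] by (simp add: dev_def rmd_def)
          then show "?H r s * edge_sum (cind2 (row_ix s) (col_ix s)) y = ?H r s * vec_index v s + ?H r s * rmd n g s y"
            by (simp add: distrib_left)
        qed
        finally show ?thesis by (simp add: sum.distrib)
      qed
      have summand: "\<bar>(\<Sum>s<pdim. ?H r s * vec_index v s)\<^sup>2 - (edge_sum (decorr mutual r) y)\<^sup>2\<bar>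
          \<le> (d * h * (2 * (d * h * R) + d * h)) * \<epsilon>" if r: "r < pdim" for r
      proof -
        let ?a = "\<Sum>s<pdim. ?H r s * vec_index v s" and ?e = "\<Sum>s<pdim. ?H r s * rmd n g s y"
        have a: "\<bar>?a\<bar> \<le> d * h * R"
        proof -
          have "\<bar>?a\<bar> \<le> (\<Sum>s<pdim. h * R)"
            by (intro order_trans[OF sum_abs] sum_mono) (use H[OF r] vd dR h0 in \<open>auto simp: abs_mult intro!: mult_mono\<close>)
          then show ?thesis by (simp add: d_def)
        qed
        have e: "\<bar>?e\<bar> \<le> d * h * \<epsilon>"
        proof -
          have "\<bar>?e\<bar> \<le> (\<Sum>s<pdim. h * \<epsilon>)"
            by (intro order_trans[OF sum_abs] sum_mono) (use H[OF r] rm h0 in \<open>auto simp: abs_mult intro!: mult_mono\<close>)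
          then show ?thesis by (simp add: d_def)
        qed
        have "d * h * \<epsilon> \<le> d * h * 1" using \<epsilon>(2) d0 h0 by (intro mult_left_mono) auto
        then have s: "\<bar>2 * ?a + ?e\<bar> \<le> 2 * (d * h * R) + d * h" using a e by linarith
        have "?a\<^sup>2 - (edge_sum (decorr mutual r) y)\<^sup>2 = - (?e * (2 * ?a + ?e))"
          unfolding es[OF r] by (simp add: power2_eq_square algebra_simps)
        then have "\<bar>?a\<^sup>2 - (edge_sum (decorr mutual r) y)\<^sup>2\<bar> = \<bar>?e\<bar> * \<bar>2 * ?a + ?e\<bar>" by (simp add: abs_mult)
        also have "\<dots> \<le> (d * h * \<epsilon>) * (2 * (d * h * R) + d * h)"
          using e s d0 h0 \<epsilon>(1) by (intro mult_mono) auto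
        finally show ?thesis by (simp add: mult_ac)
      qed
      have "\<bar>(\<Sum>r<pdim. (\<Sum>s<pdim. ?H r s * vec_index v s)\<^sup>2) - limit_form n g y\<bar>
          \<le> (\<Sum>r<pdim. (d * h * (2 * (d * h * R) + d * h)) * \<epsilon>)"
        unfolding limit_form_def sum_subtractf[symmetric]
        by (intro order_trans[OF sum_abs] sum_mono summand) auto
      also have "\<dots> = C2 * \<epsilon>" by (simp add: C2_def d_def mult_ac)
      finally have "\<bar>inv_quad_form A v - limit_form n g y\<bar> \<le> C1 * \<epsilon> + C2 * \<epsilon>" using 1 by linarith
      then show ?thesis
        using \<epsilon>1 C.invertible by (simp add: distrib_right)
    qed
    then show "invertible_mat A" "\<bar>inv_quad_form A v - limit_form n g y\<bar> \<le> \<delta>" by auto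
  qed
qed

text \<open>The bound \<open>R\<close> depends on the tolerated probability \<open>e\<close>, and
  \<open>\<epsilon>\<close> depends on \<open>R\<close>. The exceptional sets are therefore built
  separately for each \<open>e\<close>, one half for tightness and one half for the remaining
  events.\<close>

lemma whp_inv_quad_form:
  assumes b: "0 < b" and W: "whp (\<lambda>n \<omega>. label_graph.mutual n (G n \<omega>) \<le> 1 - b)"
    and A: "\<And>n \<omega>. A n \<omega> \<in> carrier_mat pdim pdim" and v: "\<And>n \<omega>. v n \<omega> \<in> carrier_vec pdim"
    and near: "\<And>r s \<epsilon>. r < pdim \<Longrightarrow> s < pdim \<Longrightarrow> 0 < \<epsilon> \<Longrightarrow>
      whp (\<lambda>n \<omega>. \<bar>A n \<omega> $$ (r, s) - sig (label_graph.mutual n (G n \<omega>)) r s\<bar> \<le> \<epsilon>)"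
    and vd: "\<And>n \<omega> r. 2 \<le> n \<Longrightarrow> \<omega> \<in> space M \<Longrightarrow> r < pdim \<Longrightarrow> vec_index (v n \<omega>) r = dev n (G n \<omega>) r (yv n \<omega>)"
    and \<delta>: "0 < \<delta>"
  shows "whp (\<lambda>n \<omega>. invertible_mat (A n \<omega>) \<and> \<bar>inv_quad_form (A n \<omega>) (v n \<omega>) - limit_form n (G n \<omega>) (yv n \<omega>)\<bar> \<le> \<delta>)"
proof (rule whp_approx)
  fix e :: real assume e: "e > 0"
  then have "0 < e / 2" by simp
  then obtain R where R: "0 < R"
    "\<forall>\<^sub>F n in sequentially. \<exists>B\<in>sets M. prob B \<le> e / 2 \<and> (\<forall>\<omega>\<in>space M - B. \<forall>r<pdim. \<bar>dev n (G n \<omega>) r (yv n \<omega>)\<bar> \<le> R)"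
    by (rule tight_dev)
  from inv_quad_form_approx[OF b less_imp_le[OF R(1)] \<delta>]
  obtain \<epsilon> where \<epsilon>: "0 < \<epsilon>" and impl: "\<forall>n g A v y. label_graph K p n g \<longrightarrow> label_graph.mutual n g \<le> 1 - b
      \<longrightarrow> A \<in> carrier_mat pdim pdim \<longrightarrow> v \<in> carrier_vec pdim \<longrightarrow> y \<in> labellings {1..n}
      \<longrightarrow> (\<forall>r<pdim. \<forall>s<pdim. \<bar>A $$ (r, s) - sig (label_graph.mutual n g) r s\<bar> \<le> \<epsilon>)
      \<longrightarrow> (\<forall>r<pdim. vec_index v r = dev n g r y \<and> \<bar>dev n g r y\<bar> \<le> R \<and> \<bar>rmd n g r y\<bar> \<le> \<epsilon>)
      \<longrightarrow> invertible_mat A \<and> \<bar>inv_quad_form A v - limit_form n g y\<bar> \<le> \<delta>"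
    by blast
  have "whp (\<lambda>n \<omega>. \<forall>r\<in>{..<pdim}. \<forall>s\<in>{..<pdim}. \<bar>A n \<omega> $$ (r, s) - sig (label_graph.mutual n (G n \<omega>)) r s\<bar> \<le> \<epsilon>)"
    by (intro whp_finite_ball near \<epsilon>) auto
  moreover have "whp (\<lambda>n \<omega>. \<forall>r\<in>{..<pdim}. \<bar>rmd n (G n \<omega>) r (yv n \<omega>)\<bar> \<le> \<epsilon>)"
    by (intro whp_finite_ball whp_rmd \<epsilon>) auto
  moreover have "whp (\<lambda>n \<omega>. yv n \<omega> \<in> labellings {1..n})"
  proof (rule whp_AE)
    show "\<forall>\<^sub>F n in sequentially. AE \<omega> in M. yv n \<omega> \<in> labellings {1..n}"
      using eventually_ge_at_top[of 2] by eventually_elim (rule AE_yv)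
  qed
  ultimately have "whp (\<lambda>n \<omega>. (\<forall>r\<in>{..<pdim}. \<forall>s\<in>{..<pdim}. \<bar>A n \<omega> $$ (r, s) - sig (label_graph.mutual n (G n \<omega>)) r s\<bar> \<le> \<epsilon>)
      \<and> (\<forall>r\<in>{..<pdim}. \<bar>rmd n (G n \<omega>) r (yv n \<omega>)\<bar> \<le> \<epsilon>) \<and> yv n \<omega> \<in> labellings {1..n}
      \<and> label_graph.mutual n (G n \<omega>) \<le> 1 - b)"
    by (intro whp_conj W)
  then have "\<forall>\<^sub>F n in sequentially. \<exists>B\<in>sets M. prob B \<le> e / 2 \<and> (\<forall>\<omega>\<in>space M - B.
      (\<forall>r\<in>{..<pdim}. \<forall>s\<in>{..<pdim}. \<bar>A n \<omega> $$ (r, s) - sig (label_graph.mutual n (G n \<omega>)) r s\<bar> \<le> \<epsilon>)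
      \<and> (\<forall>r\<in>{..<pdim}. \<bar>rmd n (G n \<omega>) r (yv n \<omega>)\<bar> \<le> \<epsilon>) \<and> yv n \<omega> \<in> labellings {1..n}
      \<and> label_graph.mutual n (G n \<omega>) \<le> 1 - b)"
    by (rule whpD) (use e in simp)
  with R(2) eventually_ge_at_top[of 2]
  show "\<forall>\<^sub>F n in sequentially. \<exists>B\<in>sets M. prob B \<le> e \<and> (\<forall>\<omega>\<in>space M - B. invertible_mat (A n \<omega>)
      \<and> \<bar>inv_quad_form (A n \<omega>) (v n \<omega>) - limit_form n (G n \<omega>) (yv n \<omega>)\<bar> \<le> \<delta>)"
  proof eventually_elim
    case (elim n)
    from elim(1) obtain B where B: "B \<in> sets M" "prob B \<le> e / 2"
      "\<And>\<omega> r. \<omega> \<in> space M - B \<Longrightarrow> r < pdim \<Longrightarrow> \<bar>dev n (G n \<omega>) r (yv n \<omega>)\<bar> \<le> R" by blast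
    from elim(3) obtain B' where B': "B' \<in> sets M" "prob B' \<le> e / 2"
      "\<And>\<omega>. \<omega> \<in> space M - B' \<Longrightarrow> (\<forall>r\<in>{..<pdim}. \<forall>s\<in>{..<pdim}. \<bar>A n \<omega> $$ (r, s) - sig (label_graph.mutual n (G n \<omega>)) r s\<bar> \<le> \<epsilon>)
      \<and> (\<forall>r\<in>{..<pdim}. \<bar>rmd n (G n \<omega>) r (yv n \<omega>)\<bar> \<le> \<epsilon>) \<and> yv n \<omega> \<in> labellings {1..n}
      \<and> label_graph.mutual n (G n \<omega>) \<le> 1 - b" by blast
    have "prob (B \<union> B') \<le> e" using measure_Un_le[OF B(1) B'(1)] B(2) B'(2) by simp
    moreover have "invertible_mat (A n \<omega>) \<and> \<bar>inv_quad_form (A n \<omega>) (v n \<omega>) - limit_form n (G n \<omega>) (yv n \<omega>)\<bar> \<le> \<delta>"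
      if "\<omega> \<in> space M - (B \<union> B')" for \<omega>
      using that B(3)[of \<omega>] B'(3)[of \<omega>] vd[OF elim(2), of \<omega>]
      by (intro impl[rule_format] graph[OF elim(2)] A v) auto
    ultimately show ?case using B(1) B'(1) by (intro bexI[of _ "B \<union> B'"]) auto
  qed
qed

lemma chi_squared_limit:
  fixes L :: "nat \<Rightarrow> 'w \<Rightarrow> nat"
  assumes b: "0 < b" and W: "whp (\<lambda>n \<omega>. label_graph.mutual n (G n \<omega>) \<le> 1 - b)"
    and L: "\<And>\<epsilon>. 0 < \<epsilon> \<Longrightarrow> whp (\<lambda>n \<omega>. real (L n \<omega>) \<le> \<epsilon> * real n powr (1/4))"
    and star: "\<And>n \<omega> i. 2 \<le> n \<Longrightarrow> \<omega> \<in> space M \<Longrightarrow> i \<in> {1..n} \<Longrightarrow> card (label_graph.star n (G n \<omega>) i) \<le> L n \<omega> + 1"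
    and A: "\<And>n \<omega>. A n \<omega> \<in> carrier_mat pdim pdim" and v: "\<And>n \<omega>. v n \<omega> \<in> carrier_vec pdim"
    and near: "\<And>r s \<epsilon>. r < pdim \<Longrightarrow> s < pdim \<Longrightarrow> 0 < \<epsilon> \<Longrightarrow>
      whp (\<lambda>n \<omega>. \<bar>A n \<omega> $$ (r, s) - sig (label_graph.mutual n (G n \<omega>)) r s\<bar> \<le> \<epsilon>)"
    and vd: "\<And>n \<omega> r. 2 \<le> n \<Longrightarrow> \<omega> \<in> space M \<Longrightarrow> r < pdim \<Longrightarrow> vec_index (v n \<omega>) r = dev n (G n \<omega>) r (yv n \<omega>)"
    and Am: "\<And>n r s. 2 \<le> n \<Longrightarrow> r < pdim \<Longrightarrow> s < pdim \<Longrightarrow> (\<lambda>\<omega>. A n \<omega> $$ (r, s)) \<in> borel_measurable M"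
  shows "(\<lambda>n. prob {\<omega> \<in> space M. invertible_mat (A n \<omega>)}) \<longlonglongrightarrow> 1"
    and "weak_conv_m (\<lambda>n. distr M borel (\<lambda>\<omega>. inv_quad_form (A n \<omega>) (v n \<omega>))) (chi_squared pdim)"
proof -
  let ?I = "\<lambda>n \<omega>. inv_quad_form (A n \<omega>) (v n \<omega>)"
  let ?J = "\<lambda>n \<omega>. limit_form n (G n \<omega>) (yv n \<omega>)"
  have w: "whp (\<lambda>n \<omega>. invertible_mat (A n \<omega>) \<and> \<bar>?I n \<omega> - ?J n \<omega>\<bar> \<le> \<delta>)" if "0 < \<delta>" for \<delta>
    by (rule whp_inv_quad_form[OF b W]) (rule A, rule v, erule (2) near, erule (2) vd, rule that)
  show "(\<lambda>n. prob {\<omega> \<in> space M. invertible_mat (A n \<omega>)}) \<longlonglongrightarrow> 1"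
  proof (rule whp_prob_tendsto_1)
    show "whp (\<lambda>n \<omega>. invertible_mat (A n \<omega>))"
      by (rule whp_mono[OF w[of 1]]) auto
    show "\<forall>\<^sub>F n in sequentially. {\<omega> \<in> space M. invertible_mat (A n \<omega>)} \<in> sets M"
      using eventually_ge_at_top[of 2]
    proof eventually_elim
      case (elim n)
      have [measurable]: "(\<lambda>\<omega>. Determinant.det (A n \<omega>)) \<in> borel_measurable M"
        by (rule borel_measurable_det[OF A Am[OF elim]])
      show ?case unfolding invertible_mat_iff_det_nonzero[OF A] by measurable
    qed
  qed
  have Im: "?I n \<in> borel_measurable M" if n: "2 \<le> n" for n
  proof (rule borel_measurable_inv_quad_form[OF A v Am[OF n]])
    fix r assume r: "r < pdim"
    have "(\<lambda>\<omega>. dev n (G n \<omega>) r (yv n \<omega>)) \<in> borel_measurable M" by (rule borel_measurable_stat[OF n])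
    then show "(\<lambda>\<omega>. vec_index (v n \<omega>) r) \<in> borel_measurable M"
      using vd[OF n _ r] by (subst measurable_cong) auto
  qed
  have conv: "(\<lambda>n. expectation (\<lambda>\<omega>. cts_step x y (?I n \<omega>))) \<longlonglongrightarrow> integral\<^sup>L (chi_squared pdim) (cts_step x y)"
    if xy: "x < y" for x y
  proof (rule cts_step_Slutsky[OF _ _ _ xy cts_step_limit_form[OF b W L star xy]])
    show "whp (\<lambda>n \<omega>. \<bar>?I n \<omega> - ?J n \<omega>\<bar> \<le> \<delta>)" if "\<delta> > 0" for \<delta>
      by (rule whp_mono[OF w[OF that]]) auto
    show "\<forall>\<^sub>F n in sequentially. ?I n \<in> borel_measurable M"
      using eventually_ge_at_top[of 2] by eventually_elim (rule Im)
    show "\<forall>\<^sub>F n in sequentially. ?J n \<in> borel_measurable M"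
      using eventually_ge_at_top[of 2] by eventually_elim (rule borel_measurable_stat)
  qed
  \<comment> \<open>The criterion needs a probability law on the line for every index; dropping
    \<open>n < 2\<close> secures measurability and leaves the limit of the distribution functions
    unchanged.\<close>
  have "weak_conv_m (\<lambda>n. distr M borel (?I (n + 2))) (chi_squared pdim)"
  proof (rule integral_cts_step_conv_imp_weak_conv)
    show "real_distribution (distr M borel (?I (n + 2)))" for n
      by (rule real_distribution_distr[OF Im]) simp
    fix x y :: real assume xy: "x < y"
    have "integral\<^sup>L (distr M borel (?I (n + 2))) (cts_step x y) = expectation (\<lambda>\<omega>. cts_step x y (?I (n + 2) \<omega>))" for n
      by (rule integral_distr[OF Im borel_measurable_cts_step[OF xy]]) simp
    then show "(\<lambda>n. integral\<^sup>L (distr M borel (?I (n + 2))) (cts_step x y)) \<longlonglongrightarrow> integral\<^sup>L (chi_squared pdim) (cts_step x y)"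
      using LIMSEQ_ignore_initial_segment[OF conv[OF xy], of 2] by (simp only:)
  qed (rule real_distribution_chi_squared)
  then show "weak_conv_m (\<lambda>n. distr M borel (?I n)) (chi_squared pdim)"
    unfolding weak_conv_m_def weak_conv_def
    using LIMSEQ_offset[of "\<lambda>n. cdf (distr M borel (?I n)) _" 2] by blast
qed

end

section \<open>The nearest neighbour graph\<close>

definition nn_opt :: "nat \<Rightarrow> (nat \<Rightarrow> 'h::metric_space) \<Rightarrow> nat \<Rightarrow> nat \<Rightarrow> bool" where
  "nn_opt n x i j \<longleftrightarrow> j \<in> {1..n} - {i} \<and> (\<forall>k\<in>{1..n} - {i}. dist (x i) (x j) \<le> dist (x i) (x k))"

lemma nn_eq_Least: "nn n x i = (LEAST j. nn_opt n x i j)"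
  unfolding nn_def nn_opt_def is_arg_min_linorder by (rule arg_cong[where f = Least]) (auto simp: Ball_def)

lemma nn_opt_exists:
  assumes n: "2 \<le> n"
  shows "\<exists>j. nn_opt n x i j"
proof -
  have "(if i = 1 then 2 else 1) \<in> {1..n} - {i}" using n by auto
  then have "{1..n} - {i} \<noteq> {}" by blast
  then obtain j where "is_arg_min (\<lambda>j. dist (x i) (x j)) (\<lambda>j. j \<in> {1..n} - {i}) j"
    using ex_is_arg_min_if_finite[of "{1..n} - {i}" "\<lambda>j. dist (x i) (x j)"] by auto
  then show ?thesis by (auto simp: is_arg_min_linorder nn_opt_def Ball_def)
qed

lemma nn_opt_nn: "2 \<le> n \<Longrightarrow> nn_opt n x i (nn n x i)"
  unfolding nn_eq_Least by (rule LeastI_ex[OF nn_opt_exists])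

text \<open>Turns the least minimiser into finitely many comparisons of distances, the form in which
  measurability is checked.\<close>

lemma nn_eq_iff: "2 \<le> n \<Longrightarrow> nn n x i = j \<longleftrightarrow> nn_opt n x i j \<and> (\<forall>k<j. \<not> nn_opt n x i k)"
  by (metis nn_eq_Least nn_opt_nn not_less_Least linorder_neqE_nat)

lemma nn_cong:
  assumes "\<And>j. j \<in> {1..n} \<Longrightarrow> x j = x' j" "i \<in> {1..n}"
  shows "nn n x i = nn n x' i"
proof -
  have "nn_opt n x i j = nn_opt n x' i j" for j
    using assms unfolding nn_opt_def by auto
  then show ?thesis by (simp add: nn_eq_Least)
qed

definition nn_graph :: "nat \<Rightarrow> (nat \<Rightarrow> 'h::metric_space) \<Rightarrow> nat \<Rightarrow> nat" where
  "nn_graph n x = restrict (nn n x) {1..n}"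

lemma nn_in: "2 \<le> n \<Longrightarrow> nn n x i \<in> {1..n} - {i}"
  using nn_opt_nn[of n x i] by (simp add: nn_opt_def)

lemma nn_graph_in_graphs: "2 \<le> n \<Longrightarrow> nn_graph n x \<in> graphs n"
  using nn_in[of n x] by (auto simp: graphs_def nn_graph_def)

context finite_law
begin

lemma label_graph_nn: "2 \<le> n \<Longrightarrow> label_graph K p n (nn_graph n x)"
  by (rule label_graphI) (auto intro: nn_graph_in_graphs)

lemma mutual_nn_graph: "2 \<le> n \<Longrightarrow> label_graph.mutual n (nn_graph n x) = W_stat n x"
proof -
  assume n: "2 \<le> n"
  interpret label_graph K p n "nn_graph n x" by (rule label_graph_nn[OF n])
  have "nn_graph n x (nn_graph n x i) = nn n x (nn n x i)" if "i \<in> {1..n}" for i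
    using that nn_in[OF n, of x i] by (simp add: nn_graph_def)
  then show ?thesis unfolding mutual_def W_stat_def by simp
qed

lemma pfreq_nn_graph:
  assumes n: "2 \<le> n"
  shows "label_graph.pfreq n (nn_graph n x) k l (restrict y {1..n}) = pair_freq n x y k l"
proof -
  interpret label_graph K p n "nn_graph n x" by (rule label_graph_nn[OF n])
  have "restrict y {1..n} (nn_graph n x i) = y (nn n x i)" if "i \<in> {1..n}" for i
    using that nn_in[OF n, of x i] by (simp add: nn_graph_def)
  then show ?thesis unfolding pfreq_def pair_freq_def by simp
qed

text \<open>The extra 1 is the edge leaving \<open>i\<close>, which \<open>star\<close> contains
  besides the edges entering \<open>i\<close>.\<close>

lemma card_star_nn_graph:
  assumes n: "2 \<le> n" and i: "i \<in> {1..n}"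
  shows "card (label_graph.star n (nn_graph n x) i) \<le> max_indeg n x + 1"
proof -
  interpret label_graph K p n "nn_graph n x" by (rule label_graph_nn[OF n])
  have "star i \<subseteq> insert i {j \<in> {1..n}. nn n x j = i}"
    unfolding star_def by (auto simp: nn_graph_def)
  then have "card (star i) \<le> card (insert i {j \<in> {1..n}. nn n x j = i})"
    by (rule card_mono[rotated]) simp
  also have "\<dots> \<le> card {j \<in> {1..n}. nn n x j = i} + 1"
    by (simp add: card_insert_if)
  also have "card {j \<in> {1..n}. nn n x j = i} \<le> max_indeg n x"
    unfolding max_indeg_def using i by (intro Max_ge) auto
  finally show ?thesis by simp
qed

end

text \<open>
  If \<open>i\<close> and \<open>j\<close> share their nearest neighbour, then either \<open>x i\<close> and \<open>x j\<close> are close, or one of them is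
  far from its nearest neighbour; the latter happens at most once in every set of small diameter.
\<close>

lemma collisions_le:
  fixes x :: "nat \<Rightarrow> 'h::metric_space" and B :: "nat \<Rightarrow> 'h set"
  assumes n: "2 \<le> n" and small: "\<And>k a b. k < m \<Longrightarrow> a \<in> B k \<Longrightarrow> b \<in> B k \<Longrightarrow> dist a b \<le> \<delta>"
  shows "(\<Sum>i=1..n. \<Sum>j=1..n. of_bool (nn n x i = nn n x j))
    \<le> real n + (\<Sum>i=1..n. \<Sum>j=1..n. of_bool (i \<noteq> j \<and> dist (x i) (x j) \<le> 2 * \<delta>))
      + 2 * real n * (real m + (\<Sum>i=1..n. of_bool (x i \<notin> (\<Union>k<m. B k))))"
proof -
  define far where "far = {i \<in> {1..n}. \<delta> < dist (x i) (x (nn n x i))}"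
  define out where "out = {i \<in> {1..n}. x i \<notin> (\<Union>k<m. B k)}"
  have one: "card {i \<in> far. x i \<in> B k} \<le> 1" if "k < m" for k
  proof (rule ccontr)
    assume "\<not> card {i \<in> far. x i \<in> B k} \<le> 1"
    then have "\<exists>i j. i \<in> far \<and> x i \<in> B k \<and> j \<in> far \<and> x j \<in> B k \<and> i \<noteq> j"
      using card_le_Suc0_iff_eq[of "{i \<in> far. x i \<in> B k}"] by (auto simp: far_def)
    then obtain i j where ij: "i \<in> far" "x i \<in> B k" "j \<in> far" "x j \<in> B k" "i \<noteq> j" by blast
    have "dist (x i) (x (nn n x i)) \<le> dist (x i) (x j)"
      using nn_opt_nn[OF n, of x i] ij by (auto simp: nn_opt_def far_def)
    also have "\<dots> \<le> \<delta>" by (rule small[OF that ij(2,4)])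
    finally show False using ij(1) by (simp add: far_def)
  qed
  have "far \<subseteq> out \<union> (\<Union>k<m. {i \<in> far. x i \<in> B k})" by (auto simp: far_def out_def)
  then have "card far \<le> card (out \<union> (\<Union>k<m. {i \<in> far. x i \<in> B k}))"
    by (rule card_mono[rotated]) (auto simp: far_def out_def)
  also have "\<dots> \<le> card out + card (\<Union>k<m. {i \<in> far. x i \<in> B k})" by (rule card_Un_le)
  also have "card (\<Union>k<m. {i \<in> far. x i \<in> B k}) \<le> (\<Sum>k<m. card {i \<in> far. x i \<in> B k})"
    by (rule card_UN_le) simp
  also have "\<dots> \<le> (\<Sum>k<m. 1)" by (rule sum_mono) (use one in auto)
  finally have far: "card far \<le> card out + m" by simp
  have out: "real (card out) = (\<Sum>i=1..n. of_bool (x i \<notin> (\<Union>k<m. B k)))"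
    by (simp add: out_def Int_def)
  have cf: "(\<Sum>i=1..n. of_bool (i \<in> far)) = real (card far)"
    by (simp add: far_def Int_def)
  have le: "of_bool (nn n x i = nn n x j) \<le> of_bool (i = j) + of_bool (i \<noteq> j \<and> dist (x i) (x j) \<le> 2 * \<delta>)
      + (of_bool (i \<in> far) + of_bool (j \<in> far) :: real)" if "i \<in> {1..n}" "j \<in> {1..n}" for i j
  proof (cases "nn n x i = nn n x j \<and> i \<noteq> j \<and> i \<notin> far \<and> j \<notin> far")
    case True
    have "dist (x i) (x j) \<le> dist (x i) (x (nn n x i)) + dist (x j) (x (nn n x j))"
      using dist_triangle2[of "x i" "x j" "x (nn n x i)"] True by simp
    moreover have "dist (x i) (x (nn n x i)) \<le> \<delta>" "dist (x j) (x (nn n x j)) \<le> \<delta>"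
      using True that unfolding far_def mem_Collect_eq by linarith+
    ultimately have "dist (x i) (x j) \<le> 2 * \<delta>" by linarith
    then show ?thesis using True by simp
  next
    case False
    then show ?thesis by auto
  qed
  have "(\<Sum>i=1..n. \<Sum>j=1..n. of_bool (nn n x i = nn n x j))
    \<le> (\<Sum>i=1..n. \<Sum>j=1..n. of_bool (i = j) + of_bool (i \<noteq> j \<and> dist (x i) (x j) \<le> 2 * \<delta>)
      + (of_bool (i \<in> far) + of_bool (j \<in> far) :: real))"
    by (intro sum_mono le) auto
  also have "\<dots> = (\<Sum>i=1..n. \<Sum>j=1..n. of_bool (i = j)) + (\<Sum>i=1..n. \<Sum>j=1..n. of_bool (i \<noteq> j \<and> dist (x i) (x j) \<le> 2 * \<delta>))
      + 2 * real n * real (card far)"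
    by (simp only: sum.distrib cf sum_constant card_atLeastAtMost sum_distrib_left[symmetric]) simp
  also have "(\<Sum>i=1..n. \<Sum>j=1..n. of_bool (i = j)) = (\<Sum>i=1..n. \<Sum>j=1..n. if i = j then 1 else (0::real))"
    by (intro sum.cong) auto
  also have "\<dots> = real n" by simp
  also have "2 * real n * real (card far) \<le> 2 * real n * (real m + (\<Sum>i=1..n. of_bool (x i \<notin> (\<Union>k<m. B k))))"
    unfolding out[symmetric] using far by (intro mult_left_mono) auto
  finally show ?thesis by simp
qed

context prob_space
begin

text \<open>Both measures agree on rectangles. For identically distributed observations it follows
  that the distance has the same law for all pairs of distinct indices.\<close>

lemma pair_distr_indep_vars:
  assumes indep: "indep_vars N X I" and ij: "i \<in> I" "j \<in> I" "i \<noteq> j"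
  shows "distr M (N i) (X i) \<Otimes>\<^sub>M distr M (N j) (X j) = distr M (N i \<Otimes>\<^sub>M N j) (\<lambda>\<omega>. (X i \<omega>, X j \<omega>))"
proof (rule pair_measure_eqI)
  have rv[measurable]: "X i \<in> M \<rightarrow>\<^sub>M N i" "X j \<in> M \<rightarrow>\<^sub>M N j"
    using indep ij by (auto simp: indep_vars_def2)
  show "sigma_finite_measure (distr M (N i) (X i))" "sigma_finite_measure (distr M (N j) (X j))"
    by (auto intro!: prob_space_imp_sigma_finite prob_space_distr)
  fix A B assume "A \<in> sets (distr M (N i) (X i))" "B \<in> sets (distr M (N j) (X j))"
  then have AB[measurable]: "A \<in> sets (N i)" "B \<in> sets (N j)" by auto
  define C where "C k = (if k = i then A else B)" for k
  have "prob (\<Inter>k\<in>{i, j}. X k -` C k \<inter> space M) = (\<Prod>k\<in>{i, j}. prob (X k -` C k \<inter> space M))"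
    by (rule indep_varsD[OF indep]) (use ij AB in \<open>auto simp: C_def\<close>)
  also have "(\<Inter>k\<in>{i, j}. X k -` C k \<inter> space M) = (\<lambda>\<omega>. (X i \<omega>, X j \<omega>)) -` (A \<times> B) \<inter> space M"
    using ij by (auto simp: C_def)
  also have "(\<Prod>k\<in>{i, j}. prob (X k -` C k \<inter> space M)) = prob (X i -` A \<inter> space M) * prob (X j -` B \<inter> space M)"
    using ij by (simp add: C_def)
  finally show "emeasure (distr M (N i) (X i)) A * emeasure (distr M (N j) (X j)) B
      = emeasure (distr M (N i \<Otimes>\<^sub>M N j) (\<lambda>\<omega>. (X i \<omega>, X j \<omega>))) (A \<times> B)"
    by (simp add: emeasure_distr emeasure_eq_measure ennreal_mult[symmetric])
qed simp

text \<open>Balls of radius \<open>\<delta> / 2\<close> around a countable dense set cover the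
  space, and by continuity from below finitely many of them carry almost all the mass. This is where
  separability enters.\<close>

lemma finite_small_cover:
  fixes \<mu> :: "'h::{metric_space, second_countable_topology} measure"
  assumes \<mu>: "prob_space \<mu>" "sets \<mu> = sets borel" and \<delta>: "0 < \<delta>" and e: "0 < e"
  obtains B :: "nat \<Rightarrow> 'h set" and m where "\<And>k. open (B k)" "\<And>k a b. a \<in> B k \<Longrightarrow> b \<in> B k \<Longrightarrow> dist a b \<le> \<delta>"
    "measure \<mu> (- (\<Union>k<m. B k)) < e"
proof -
  interpret P: prob_space \<mu> by fact
  obtain D :: "'h set" where D: "countable D" "\<And>X. open X \<Longrightarrow> X \<noteq> {} \<Longrightarrow> \<exists>d\<in>D. d \<in> X"
    by (rule countable_dense_setE) blast
  define B where "B k = ball (from_nat_into D k) (\<delta> / 2)" for k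
  have o: "open (B k)" for k by (simp add: B_def)
  have "D \<noteq> {}" using D(2)[of UNIV] by auto
  have "(\<Union>k. B k) = UNIV"
  proof (rule UNIV_eq_I[symmetric])
    fix x
    obtain d where "d \<in> D" "d \<in> ball x (\<delta> / 2)" using D(2)[of "ball x (\<delta> / 2)"] \<delta> by auto
    moreover obtain k where "from_nat_into D k = d"
      using from_nat_into_surj[OF D(1) \<open>d \<in> D\<close>] by auto
    ultimately show "x \<in> (\<Union>k. B k)" by (auto simp: B_def dist_commute intro!: exI[of _ k])
  qed
  moreover have "(\<lambda>m. measure \<mu> (\<Union>k<m. B k)) \<longlonglongrightarrow> measure \<mu> (\<Union>m. \<Union>k<m. B k)"
  proof (rule P.finite_Lim_measure_incseq)
    show "incseq (\<lambda>m. \<Union>k<m. B k)" unfolding incseq_def by (intro allI impI UN_mono) auto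
    show "range (\<lambda>m. \<Union>k<m. B k) \<subseteq> sets \<mu>" unfolding \<mu>(2) using o by (auto intro!: borel_open)
  qed
  moreover have "(\<Union>m. \<Union>k<m. B k) = (\<Union>k. B k)" by auto
  moreover have sp: "space \<mu> = UNIV" using \<mu>(2) sets_eq_imp_space_eq[of \<mu> borel] by simp
  ultimately have "(\<lambda>m. measure \<mu> (\<Union>k<m. B k)) \<longlonglongrightarrow> 1" using P.prob_space by simp
  then have "\<forall>\<^sub>F m in sequentially. 1 - e < measure \<mu> (\<Union>k<m. B k)" using e by (intro order_tendstoD(1)) auto
  then obtain m where m: "1 - e < measure \<mu> (\<Union>k<m. B k)" by (auto simp: eventually_sequentially)
  have "(\<Union>k<m. B k) \<in> sets \<mu>" using o \<mu>(2) by (auto intro!: borel_open)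
  then have "measure \<mu> (- (\<Union>k<m. B k)) < e"
    using P.prob_compl[of "\<Union>k<m. B k"] m sp by (simp add: Compl_eq_Diff_UNIV)
  moreover have "dist a b \<le> \<delta>" if "a \<in> B k" "b \<in> B k" for k a b
    using dist_triangle3[of a b "from_nat_into D k"] that by (simp add: B_def)
  ultimately show thesis using that[of B m] o by blast
qed

text \<open>The distance of two observations vanishes with probability zero because its distribution is continuous.\<close>

lemma expected_collisions:
  fixes X :: "nat \<Rightarrow> 'a \<Rightarrow> 'h::{metric_space, second_countable_topology}"
  assumes indep: "indep_vars (\<lambda>_. borel) X {1..}"
    and law: "\<And>i. 1 \<le> i \<Longrightarrow> distr M borel (X i) = \<mu>"
    and cont: "continuous_on UNIV (cdf (distr M borel (\<lambda>\<omega>. dist (X 1 \<omega>) (X 2 \<omega>))))"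
  shows "(\<lambda>n. expectation (\<lambda>\<omega>. (\<Sum>i=1..n. \<Sum>j=1..n.
      of_bool (nn n (\<lambda>i. X i \<omega>) i = nn n (\<lambda>i. X i \<omega>) j)) / (real n)\<^sup>2)) \<longlonglongrightarrow> 0"
proof -
  have X[measurable]: "X i \<in> borel_measurable M" if "1 \<le> i" for i
    using indep that by (auto simp: indep_vars_def2)
  have \<mu>: "prob_space \<mu>" "sets \<mu> = sets borel"
    using law[of 1] prob_space_distr[OF X[of 1]] by auto
  let ?D = "\<lambda>i j t. {\<omega> \<in> space M. dist (X i \<omega>) (X j \<omega>) \<le> t}"
  have D: "?D i j t \<in> sets M" if "1 \<le> i" "1 \<le> j" for i j t
    using X[OF that(1)] X[OF that(2)] by measurable
  have pD: "prob (?D i j t) = measure (\<mu> \<Otimes>\<^sub>M \<mu>) {z. dist (fst z) (snd z) \<le> t}" if ij: "1 \<le> i" "1 \<le> j" "i \<noteq> j" for i j t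
  proof -
    have [measurable]: "X i \<in> borel_measurable M" "X j \<in> borel_measurable M" using X ij by auto
    have S: "{z :: 'h \<times> 'h. dist (fst z) (snd z) \<le> t} \<in> sets (borel \<Otimes>\<^sub>M borel)"
    proof -
      have "{z \<in> space (borel \<Otimes>\<^sub>M borel). dist (fst z) (snd z :: 'h) \<le> t} \<in> sets (borel \<Otimes>\<^sub>M borel)"
        by (intro borel_measurable_le borel_measurable_dist measurable_fst measurable_snd borel_measurable_const)
      then show ?thesis by (simp add: space_pair_measure)
    qed
    have "\<mu> \<Otimes>\<^sub>M \<mu> = distr M (borel \<Otimes>\<^sub>M borel) (\<lambda>\<omega>. (X i \<omega>, X j \<omega>))"
      using pair_distr_indep_vars[OF indep, of i j] ij law by simp
    then have "measure (\<mu> \<Otimes>\<^sub>M \<mu>) {z. dist (fst z) (snd z) \<le> t}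
        = prob ((\<lambda>\<omega>. (X i \<omega>, X j \<omega>)) -` {z. dist (fst z) (snd z) \<le> t} \<inter> space M)"
      using S by (simp add: measure_distr)
    also have "(\<lambda>\<omega>. (X i \<omega>, X j \<omega>)) -` {z. dist (fst z) (snd z) \<le> t} \<inter> space M = ?D i j t" by auto
    finally show ?thesis ..
  qed
  have d12[measurable]: "(\<lambda>\<omega>. dist (X 1 \<omega>) (X 2 \<omega>)) \<in> borel_measurable M"
    using X[of 1] X[of 2] by measurable
  let ?F = "cdf (distr M borel (\<lambda>\<omega>. dist (X 1 \<omega>) (X 2 \<omega>)))"
  have F: "?F t = prob (?D 1 2 t)" for t
    by (simp add: cdf_def measure_distr vimage_def Int_def conj_commute)
  have F0: "?F 0 = 0"
  proof -
    have "(\<lambda>k. ?F (- inverse (real (Suc k)))) \<longlonglongrightarrow> ?F 0"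
    proof (rule continuous_on_tendsto_compose[OF cont])
      show "(\<lambda>k. - inverse (real (Suc k))) \<longlonglongrightarrow> 0"
        using tendsto_minus[OF LIMSEQ_inverse_real_of_nat] by simp
    qed auto
    moreover have "?F (- inverse (real (Suc k))) = 0" for k
    proof -
      have "?D 1 2 (- inverse (real (Suc k))) = {}"
      proof -
        have "- inverse (real (Suc k)) < 0" by simp
        then have "\<not> dist a b \<le> - inverse (real (Suc k))" for a b :: 'h
          using zero_le_dist[of a b] by linarith
        then show ?thesis by blast
      qed
      then show ?thesis unfolding F by (simp only: measure_empty)
    qed
    ultimately show ?thesis using LIMSEQ_unique[OF _ tendsto_const] by fastforce
  qed
  show ?thesis
  proof (rule LIMSEQ_I)
    fix r :: real assume r: "0 < r"
    have "isCont ?F 0" using cont by (simp add: continuous_on_eq_continuous_at)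
    then obtain s where s: "0 < s" "\<And>t. \<bar>t\<bar> < s \<Longrightarrow> \<bar>?F t\<bar> < r / 8"
      unfolding continuous_at_eps_delta dist_real_def F0 using r by (metis diff_zero divide_pos_pos zero_less_numeral)
    define \<delta> where "\<delta> = s / 4"
    have \<delta>: "0 < \<delta>" using s by (simp add: \<delta>_def)
    have q: "prob (?D 1 2 (2 * \<delta>)) < r / 8" using s(2)[of "2 * \<delta>"] s(1) unfolding F by (simp add: \<delta>_def)
    have r16: "0 < r / 16" using r by simp
    obtain B :: "nat \<Rightarrow> 'h set" and m where B: "\<And>k. open (B k)" "\<And>k a b. a \<in> B k \<Longrightarrow> b \<in> B k \<Longrightarrow> dist a b \<le> \<delta>"
      "measure \<mu> (- (\<Union>k<m. B k)) < r / 16"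
      using finite_small_cover[OF \<mu> \<delta> r16] by blast
    define U where "U = - (\<Union>k<m. B k)"
    have U: "U \<in> sets borel" unfolding U_def using B(1) by (intro borel_comp sets.finite_UN) (auto intro: borel_open)
    let ?O = "\<lambda>i. {\<omega> \<in> space M. X i \<omega> \<in> U}"
    have O: "?O i \<in> sets M" if "1 \<le> i" for i
      using measurable_sets[OF X[OF that] U] by (simp add: vimage_def Int_def conj_commute)
    have pO: "prob (?O i) < r / 16" if "1 \<le> i" for i
    proof -
      have "prob (?O i) = measure \<mu> U"
        unfolding law[OF that, symmetric] by (subst measure_distr[OF X[OF that] U]) (simp add: vimage_def Int_def conj_commute)
      then show ?thesis using B(3) by (simp add: U_def)
    qed
    have "(\<lambda>n. (1 + 2 * real m) / real n) \<longlonglongrightarrow> 0"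
      by (rule tendsto_divide_0[OF tendsto_const filterlim_real_sequentially[THEN filterlim_at_top_imp_at_infinity]])
    then have "\<forall>\<^sub>F n in sequentially. (1 + 2 * real m) / real n < r / 4" using r by (intro order_tendstoD(2)) auto
    with eventually_ge_at_top[of 2]
    have "\<forall>\<^sub>F n in sequentially. norm (expectation (\<lambda>\<omega>. (\<Sum>i=1..n. \<Sum>j=1..n.
      of_bool (nn n (\<lambda>i. X i \<omega>) i = nn n (\<lambda>i. X i \<omega>) j)) / (real n)\<^sup>2) - 0) < r"
    proof eventually_elim
      case (elim n)
      let ?C = "\<lambda>\<omega>. (\<Sum>i=1..n. \<Sum>j=1..n. of_bool (nn n (\<lambda>i. X i \<omega>) i = nn n (\<lambda>i. X i \<omega>) j)) / (real n)\<^sup>2 :: real"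
      let ?f = "\<lambda>\<omega>. (real n + (\<Sum>i=1..n. \<Sum>j=1..n. of_bool (i \<noteq> j) * indicator (?D i j (2 * \<delta>)) \<omega>)
          + 2 * real n * (real m + (\<Sum>i=1..n. indicator (?O i) \<omega>))) / (real n)\<^sup>2 :: real"
      have n0: "0 < real n" using elim(1) by simp
      have intD: "integrable M (\<lambda>\<omega>. of_bool (i \<noteq> j) * indicator (?D i j (2 * \<delta>)) \<omega> :: real)" if "i \<in> {1..n}" "j \<in> {1..n}" for i j
        using that D[of i j] by (intro integrable_mult_right) (auto simp: less_top[symmetric])
      have intO: "integrable M (\<lambda>\<omega>. indicator (?O i) \<omega> :: real)" if "i \<in> {1..n}" for i
        using that O[of i] by (auto simp: less_top[symmetric])
      have intf: "integrable M ?f"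
        by (intro integrable_divide Bochner_Integration.integrable_add integrable_mult_right
            Bochner_Integration.integrable_sum intD intO integrable_const)
      have "expectation ?C \<le> expectation ?f"
      proof (rule integral_mono'[OF intf])
        fix \<omega> assume \<omega>: "\<omega> \<in> space M"
        have "(\<Sum>i=1..n. \<Sum>j=1..n. of_bool (nn n (\<lambda>i. X i \<omega>) i = nn n (\<lambda>i. X i \<omega>) j))
          \<le> real n + (\<Sum>i=1..n. \<Sum>j=1..n. of_bool (i \<noteq> j \<and> dist (X i \<omega>) (X j \<omega>) \<le> 2 * \<delta>))
            + 2 * real n * (real m + (\<Sum>i=1..n. of_bool (X i \<omega> \<notin> (\<Union>k<m. B k))))"
          by (rule collisions_le[OF elim(1)]) (rule B(2))
        also have "(\<Sum>i=1..n. \<Sum>j=1..n. of_bool (i \<noteq> j \<and> dist (X i \<omega>) (X j \<omega>) \<le> 2 * \<delta>))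
            = (\<Sum>i=1..n. \<Sum>j=1..n. of_bool (i \<noteq> j) * indicator (?D i j (2 * \<delta>)) \<omega> :: real)"
          using \<omega> by (intro sum.cong refl) (auto simp: indicator_def)
        also have "(\<Sum>i=1..n. of_bool (X i \<omega> \<notin> (\<Union>k<m. B k))) = (\<Sum>i=1..n. indicator (?O i) \<omega> :: real)"
          using \<omega> by (intro sum.cong refl) (auto simp: indicator_def U_def)
        finally show "?C \<omega> \<le> ?f \<omega>" by (rule divide_right_mono) simp
        show "0 \<le> ?f \<omega>" by (auto intro!: divide_nonneg_nonneg add_nonneg_nonneg mult_nonneg_nonneg sum_nonneg)
      qed
      also have "expectation ?f = (real n + (\<Sum>i=1..n. \<Sum>j=1..n. of_bool (i \<noteq> j) * prob (?D i j (2 * \<delta>)))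
          + 2 * real n * (real m + (\<Sum>i=1..n. prob (?O i)))) / (real n)\<^sup>2"
      proof -
        have iD: "expectation (\<lambda>\<omega>. \<Sum>i=1..n. \<Sum>j=1..n. of_bool (i \<noteq> j) * indicator (?D i j (2 * \<delta>)) \<omega>)
            = (\<Sum>i=1..n. \<Sum>j=1..n. of_bool (i \<noteq> j) * prob (?D i j (2 * \<delta>)))"
        proof -
          have "expectation (\<lambda>\<omega>. \<Sum>i=1..n. \<Sum>j=1..n. of_bool (i \<noteq> j) * indicator (?D i j (2 * \<delta>)) \<omega> :: real)
              = (\<Sum>i=1..n. expectation (\<lambda>\<omega>. \<Sum>j=1..n. of_bool (i \<noteq> j) * indicator (?D i j (2 * \<delta>)) \<omega>))"
            by (rule Bochner_Integration.integral_sum) (intro Bochner_Integration.integrable_sum intD)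
          also have "\<dots> = (\<Sum>i=1..n. \<Sum>j=1..n. expectation (\<lambda>\<omega>. of_bool (i \<noteq> j) * indicator (?D i j (2 * \<delta>)) \<omega>))"
            by (intro sum.cong refl Bochner_Integration.integral_sum intD)
          also have "\<dots> = (\<Sum>i=1..n. \<Sum>j=1..n. of_bool (i \<noteq> j) * prob (?D i j (2 * \<delta>)))"
            using D by (intro sum.cong refl) simp
          finally show ?thesis .
        qed
        have iO: "expectation (\<lambda>\<omega>. \<Sum>i=1..n. indicator (?O i) \<omega>) = (\<Sum>i=1..n. prob (?O i))"
        proof -
          have "expectation (\<lambda>\<omega>. \<Sum>i=1..n. indicator (?O i) \<omega> :: real) = (\<Sum>i=1..n. expectation (\<lambda>\<omega>. indicator (?O i) \<omega>))"
            by (rule Bochner_Integration.integral_sum) (rule intO)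
          then show ?thesis using O by simp
        qed
        have A: "integrable M (\<lambda>\<omega>. \<Sum>i=1..n. \<Sum>j=1..n. of_bool (i \<noteq> j) * indicator (?D i j (2 * \<delta>)) \<omega> :: real)"
          by (intro Bochner_Integration.integrable_sum intD)
        have A': "integrable M (\<lambda>\<omega>. \<Sum>i=1..n. indicator (?O i) \<omega> :: real)"
          by (intro Bochner_Integration.integrable_sum intO)
        have gen: "expectation (\<lambda>\<omega>. (a + f \<omega> + c * (d + g \<omega>)) / e) = (a + expectation f + c * (d + expectation g)) / e"
          if "integrable M f" "integrable M g" for f g :: "'a \<Rightarrow> real" and a c d e
          using that by (simp add: prob_space)
        show ?thesis unfolding gen[OF A A'] iD iO ..
      qed
      \<comment> \<open>Pairs at small distance account for \<open>r / 8\<close> and observations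
        outside the cover for \<open>2 * (r / 16)\<close>; the rest is of order
        \<open>1 / n\<close>, since \<open>m\<close> is fixed.\<close>
      also have "\<dots> \<le> (real n + (\<Sum>i=1..n. \<Sum>j=1..n. r / 8) + 2 * real n * (real m + (\<Sum>i=1..n. r / 16))) / (real n)\<^sup>2"
      proof (intro divide_right_mono add_mono mult_left_mono sum_mono order_refl)
        fix i j assume "i \<in> {1..n}" "j \<in> {1..n}"
        then show "of_bool (i \<noteq> j) * prob (?D i j (2 * \<delta>)) \<le> r / 8"
          using q r pD[of i j] pD[of 1 2] by (cases "i = j") auto
      qed (use pO in \<open>auto intro: less_imp_le\<close>)
      also have "\<dots> = (1 + 2 * real m) / real n + r / 4"
        using n0 by (simp add: field_simps power2_eq_square)
      also have "\<dots> < r" using elim(2) r by linarith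
      finally have "expectation ?C < r" .
      moreover have "0 \<le> expectation ?C" by (intro integral_nonneg_AE AE_I2 divide_nonneg_nonneg sum_nonneg) auto
      ultimately show ?case by simp
    qed
    then show "\<exists>no. \<forall>n\<ge>no. norm (expectation (\<lambda>\<omega>. (\<Sum>i=1..n. \<Sum>j=1..n.
      of_bool (nn n (\<lambda>i. X i \<omega>) i = nn n (\<lambda>i. X i \<omega>) j)) / (real n)\<^sup>2) - 0) < r"
      by (simp add: eventually_sequentially)
  qed
qed

end

section \<open>Measurability of the nearest neighbour graph\<close>

lemma nn_event_PiM:
  assumes n: "2 \<le> n" and i: "i \<in> {1..n}"
  shows "{x \<in> space (PiM {1..n} (\<lambda>_. borel :: 'h::{metric_space, second_countable_topology} measure)). nn n x i = j}
    \<in> sets (PiM {1..n} (\<lambda>_. borel))"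
proof -
  let ?P = "PiM {1..n} (\<lambda>_. borel :: 'h measure)"
  have d: "(\<lambda>x. dist (x a) (x b)) \<in> borel_measurable ?P" if "a \<in> {1..n}" "b \<in> {1..n}" for a b
    using that by (intro borel_measurable_dist measurable_component_singleton)
  have opt: "{x \<in> space ?P. nn_opt n x i j} \<in> sets ?P" for j
  proof (cases "j \<in> {1..n} - {i}")
    case True
    then have "{x \<in> space ?P. nn_opt n x i j} = {x \<in> space ?P. \<forall>k\<in>{1..n} - {i}. dist (x i) (x j) \<le> dist (x i) (x k)}"
      by (auto simp: nn_opt_def)
    also have "\<dots> \<in> sets ?P"
      using True i d by (intro sets.sets_Collect_finite_All borel_measurable_le) auto
    finally show ?thesis .
  next
    case False
    then have "{x \<in> space ?P. nn_opt n x i j} = {}" by (auto simp: nn_opt_def)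
    then show ?thesis by (simp only: sets.empty_sets)
  qed
  have "{x \<in> space ?P. nn n x i = j} = {x \<in> space ?P. nn_opt n x i j \<and> (\<forall>k\<in>{..<j}. \<not> nn_opt n x i k)}"
    using nn_eq_iff[OF n] by auto
  also have "\<dots> \<in> sets ?P"
    by (intro sets.sets_Collect_conj sets.sets_Collect_finite_All sets.sets_Collect_neg opt) auto
  finally show ?thesis .
qed

section \<open>Labels generated from uniform variables\<close>

text \<open>The random index set has only finitely many values, so every function of it is simple,
  whatever \<open>Min\<close> is on the empty set.\<close>

lemma simple_function_Min:
  fixes R :: "nat \<Rightarrow> 'a \<Rightarrow> bool"
  assumes R: "\<And>k. k \<in> {1..K} \<Longrightarrow> {\<omega> \<in> space M. R k \<omega>} \<in> sets M"
  shows "simple_function M (\<lambda>\<omega>. Min {k \<in> {1..K}. R k \<omega>})"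
proof -
  let ?S = "\<lambda>\<omega>. {k \<in> {1..K}. R k \<omega>}"
  have "simple_function M ?S"
    unfolding simple_function_def
  proof
    have "?S ` space M \<subseteq> Pow {1..K}" by auto
    then show "finite (?S ` space M)" by (rule finite_subset) simp
    show "\<forall>S\<in>?S ` space M. ?S -` {S} \<inter> space M \<in> sets M"
    proof
      fix S assume "S \<in> ?S ` space M"
      then have S: "S \<subseteq> {1..K}" by blast
      have eq: "?S -` {S} \<inter> space M = {\<omega> \<in> space M. \<forall>k\<in>{1..K}. R k \<omega> = (k \<in> S)}"
        using S by blast
      have "{\<omega> \<in> space M. R k \<omega> = (k \<in> S)} \<in> sets M" if k: "k \<in> {1..K}" for k
        using R[OF k] sets.sets_Collect_neg[OF R[OF k]] by (cases "k \<in> S") simp_all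
      then show "?S -` {S} \<inter> space M \<in> sets M"
        unfolding eq by (intro sets.sets_Collect_finite_All) auto
    qed
  qed
  then show ?thesis by (rule simple_function_compose1)
qed

context pos_law
begin

text \<open>\<open>level_fun\<close> for the constant conditional probabilities \<open>p\<close>,
  that is, the quantile transform of the label law.\<close>

definition lev :: "real \<Rightarrow> nat" where
  "lev u = Min {k \<in> {1..K}. (\<Sum>j=1..k. p j) > u}"

lemma partial_sum_mono: "k \<le> l \<Longrightarrow> l \<le> K \<Longrightarrow> (\<Sum>j=1..k. p j) \<le> (\<Sum>j=1..l. p j)"
  using p_nonneg by (intro sum_mono2) auto

lemma lev_eq_iff:
  assumes u: "0 < u" "u < 1" and k: "k \<in> {1..K}"
  shows "lev u = k \<longleftrightarrow> (\<Sum>j=1..k-1. p j) \<le> u \<and> u < (\<Sum>j=1..k. p j)"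
proof -
  let ?S = "{k \<in> {1..K}. (\<Sum>j=1..k. p j) > u}"
  have "K \<in> ?S" using u(2) sum_p K_ge by (simp del: One_nat_def)
  then have S: "finite ?S" "?S \<noteq> {}" by auto
  have iff: "lev u = k \<longleftrightarrow> k \<in> ?S \<and> (\<forall>j\<in>?S. k \<le> j)"
    unfolding lev_def by (rule Min_eq_iff[OF S])
  show ?thesis
  proof
    assume "lev u = k"
    then have k': "k \<in> ?S" "\<forall>j\<in>?S. k \<le> j" using iff by auto
    have "(\<Sum>j=1..k-1. p j) \<le> u"
    proof (rule ccontr)
      assume c: "\<not> (\<Sum>j=1..k-1. p j) \<le> u"
      \<comment> \<open>For \<open>k = 1\<close> the sum is empty, and 0 does not exceed the
        positive \<open>u\<close>; so \<open>k - 1\<close> is a genuine level.\<close>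
      then have "k - 1 \<noteq> 0" using u(1) by (intro notI) simp
      then have "k - 1 \<in> ?S" using c k by auto
      then have "k \<le> k - 1" using k'(2) by blast
      then show False using k by auto
    qed
    then show "(\<Sum>j=1..k-1. p j) \<le> u \<and> u < (\<Sum>j=1..k. p j)" using k'(1) by simp
  next
    assume a: "(\<Sum>j=1..k-1. p j) \<le> u \<and> u < (\<Sum>j=1..k. p j)"
    have "k \<le> j" if j: "j \<in> ?S" for j
    proof (rule ccontr)
      assume "\<not> k \<le> j"
      then have "(\<Sum>i=1..j. p i) \<le> (\<Sum>i=1..k-1. p i)" using k by (intro partial_sum_mono) auto
      then show False using a j by simp
    qed
    then show "lev u = k" using iff a k by blast
  qed
qed

lemma lev_simple: "simple_function borel lev"
  unfolding lev_def by (rule simple_function_Min) simp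

lemma lev_event: "{u. lev u = k} \<in> sets borel"
  using simple_functionD(2)[OF lev_simple, of "{k}"] by (simp add: vimage_def)

lemma uniform_lev:
  assumes k: "k \<in> {1..K}"
  shows "measure (uniform_measure lborel {0<..<1}) {u. lev u = k} = p k"
proof -
  let ?a = "\<Sum>j=1..k-1. p j" and ?b = "\<Sum>j=1..k. p j"
  have ab: "?b = ?a + p k"
    using k sum.cl_ivl_Suc[of p 1 "k - 1"] by (cases k) auto
  have b1: "?b \<le> 1" using partial_sum_mono[of k K] k sum_p by (simp del: One_nat_def)
  have pk: "0 < p k" by (rule p_pos[OF k])
  have eq: "{0<..<1} \<inter> {u. lev u = k} = {u. 0 < u \<and> u < 1 \<and> ?a \<le> u \<and> u < ?b}"
    unfolding set_eq_iff
  proof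
    fix u
    have "0 < u \<Longrightarrow> u < 1 \<Longrightarrow> lev u = k \<longleftrightarrow> ?a \<le> u \<and> u < ?b" by (rule lev_eq_iff[OF _ _ k])
    then show "u \<in> {0<..<1} \<inter> {u. lev u = k} \<longleftrightarrow> u \<in> {u. 0 < u \<and> u < 1 \<and> ?a \<le> u \<and> u < ?b}"
      unfolding Int_iff mem_Collect_eq greaterThanLessThan_iff by blast
  qed
  have "measure lborel ({0<..<1} \<inter> {u. lev u = k}) = p k"
  \<comment> \<open>For \<open>k = 1\<close> the lower end is 0, which \<open>{0<..<1}\<close>
    excludes, so the interval is open; for larger \<open>k\<close> it is half-open. Its length is
    \<open>p k\<close> in both cases.\<close>
  proof (cases "k = 1")
    case True
    then have "{u. 0 < u \<and> u < 1 \<and> ?a \<le> u \<and> u < ?b} = {0<..<?b}" using b1 by auto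
    then show ?thesis unfolding eq using True pk by simp
  next
    case False
    have "0 < ?a"
    proof -
      have "p 1 \<le> ?a" using False k p_nonneg by (intro member_le_sum) auto
      moreover have "0 < p 1" using k by (intro p_pos) auto
      ultimately show ?thesis by linarith
    qed
    then have "{u. 0 < u \<and> u < 1 \<and> ?a \<le> u \<and> u < ?b} = {?a..<?b}" using b1 by auto
    then show ?thesis unfolding eq using ab pk by simp
  qed
  then show ?thesis using lev_event[of k] by (subst measure_uniform_measure) auto
qed

end

section \<open>The nearest neighbour experiment\<close>

locale nn_experiment = pos_law K p + prob_space M
  for K :: nat and p :: "nat \<Rightarrow> real" and M :: "'w measure" +
  fixes Xs :: "nat \<Rightarrow> 'w \<Rightarrow> 'h::{metric_space, second_countable_topology}"
    and Us :: "nat \<Rightarrow> 'w \<Rightarrow> real" and Q :: "nat \<Rightarrow> 'h \<Rightarrow> real" and \<mu> :: "'h measure"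
  assumes Xs_indep: "indep_vars (\<lambda>_. borel) Xs {1..}"
    and Xs_law: "1 \<le> i \<Longrightarrow> distr M borel (Xs i) = \<mu>"
    and Us_indep: "indep_vars (\<lambda>_. borel) Us {1..}"
    and Us_law: "1 \<le> i \<Longrightarrow> distr M borel (Us i) = uniform_measure lborel {0<..<1}"
    and Xs_Us_indep: "indep_rv M (PiM {1..} (\<lambda>_. borel)) (\<lambda>\<omega>. \<lambda>i\<in>{1..}. Xs i \<omega>)
      (PiM {1..} (\<lambda>_. borel)) (\<lambda>\<omega>. \<lambda>i\<in>{1..}. Us i \<omega>)"
    and dist_cont: "continuous_on UNIV (cdf (distr M borel (\<lambda>\<omega>. dist (Xs 1 \<omega>) (Xs 2 \<omega>))))"
    and Q_meas: "k \<in> {1..K} \<Longrightarrow> Q k \<in> borel_measurable borel"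
    and Q_const: "k \<in> {1..K} \<Longrightarrow> AE x in \<mu>. Q k x = p k"
begin

abbreviation "Ys i \<omega> \<equiv> level_fun K Q (Xs i \<omega>) (Us i \<omega>)"
abbreviation "Gr n \<omega> \<equiv> nn_graph n (\<lambda>i. Xs i \<omega>)"
abbreviation "Fn n \<equiv> sigma_first M Xs n"

lemma Xs_measurable: "1 \<le> i \<Longrightarrow> Xs i \<in> borel_measurable M"
  using Xs_indep by (auto simp: indep_vars_def2)

lemma Us_measurable: "1 \<le> i \<Longrightarrow> Us i \<in> borel_measurable M"
  using Us_indep by (auto simp: indep_vars_def2)

lemma first_measurable: "(\<lambda>\<omega>. \<lambda>i\<in>{1..n}. Xs i \<omega>) \<in> M \<rightarrow>\<^sub>M PiM {1..n} (\<lambda>_. borel)"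
  by (rule measurable_restrict) (auto intro: Xs_measurable)

lemma sets_Fn:
  "sets (Fn n) = {(\<lambda>\<omega>. \<lambda>i\<in>{1..n}. Xs i \<omega>) -` S \<inter> space M | S. S \<in> sets (PiM {1..n} (\<lambda>_. borel))}"
  unfolding sigma_first_def by (rule sets_vimage_algebra2) (use measurable_space[OF first_measurable] in auto)

lemma subalgebra_Fn: "subalgebra M (Fn n)"
  unfolding subalgebra_def
proof
  show "space (Fn n) = space M" by (simp add: sigma_first_def)
  show "sets (Fn n) \<subseteq> sets M" unfolding sets_Fn using measurable_sets[OF first_measurable] by blast
qed

lemma Gr_event:
  assumes n: "2 \<le> n"
  shows "{\<omega> \<in> space M. Gr n \<omega> = g} \<in> sets (Fn n)"
proof (cases "g \<in> extensional {1..n}")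
  case True
  let ?X = "\<lambda>\<omega>. \<lambda>i\<in>{1..n}. Xs i \<omega>"
  have e: "{\<omega> \<in> space (Fn n). nn n (\<lambda>i. Xs i \<omega>) i = g i} \<in> sets (Fn n)" if i: "i \<in> {1..n}" for i
  proof -
    let ?S = "{x \<in> space (PiM {1..n} (\<lambda>_. borel)). nn n x i = g i}"
    have "nn n (\<lambda>i. Xs i \<omega>) i = nn n (?X \<omega>) i" for \<omega> by (rule nn_cong) (use i in auto)
    then have "{\<omega> \<in> space (Fn n). nn n (\<lambda>i. Xs i \<omega>) i = g i} = ?X -` ?S \<inter> space M"
      using measurable_space[OF first_measurable[of n]] by (auto simp: sigma_first_def)
    then show ?thesis unfolding sets_Fn using nn_event_PiM[OF n i, of "g i"] by blast
  qed
  have "{\<omega> \<in> space M. Gr n \<omega> = g} = {\<omega> \<in> space (Fn n). \<forall>i\<in>{1..n}. nn n (\<lambda>i. Xs i \<omega>) i = g i}"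
    using True subalgebra_Fn[of n] by (auto simp: nn_graph_def extensional_def fun_eq_iff subalgebra_def)
  then show ?thesis using e by (simp only:) (intro sets.sets_Collect_finite_All, auto)
next
  case False
  then have "{\<omega> \<in> space M. Gr n \<omega> = g} = {}" by (auto simp: nn_graph_def)
  then show ?thesis by (simp only: sets.empty_sets)
qed

lemma Ys_simple: "1 \<le> i \<Longrightarrow> simple_function M (\<lambda>\<omega>. Ys i \<omega>)"
  unfolding level_fun_def
proof (rule simple_function_Min)
  fix k assume i: "1 \<le> i" and k: "k \<in> {1..K}"
  have "(\<lambda>\<omega>. \<Sum>j=1..k. Q j (Xs i \<omega>)) \<in> borel_measurable M"
    using k by (intro borel_measurable_sum measurable_compose[OF Xs_measurable[OF i] Q_meas]) auto
  then show "{\<omega> \<in> space M. Us i \<omega> < (\<Sum>j=1..k. Q j (Xs i \<omega>))} \<in> sets M"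
    by (rule borel_measurable_less[OF Us_measurable[OF i]])
qed

lemma prob_lev: "1 \<le> i \<Longrightarrow> k \<in> {1..K} \<Longrightarrow> prob (Us i -` {u. lev u = k} \<inter> space M) = p k"
  using uniform_lev[of k] by (simp add: Us_law[symmetric] measure_distr[OF Us_measurable lev_event])

lemma AE_Ys_lev: "1 \<le> i \<Longrightarrow> AE \<omega> in M. Ys i \<omega> = lev (Us i \<omega>)"
proof -
  assume i: "1 \<le> i"
  have "AE x in \<mu>. \<forall>k\<in>{1..K}. Q k x = p k" by (rule AE_finite_allI) (auto intro: Q_const)
  then have "AE x in distr M borel (Xs i). \<forall>k\<in>{1..K}. Q k x = p k" unfolding Xs_law[OF i] .
  then have "AE \<omega> in M. \<forall>k\<in>{1..K}. Q k (Xs i \<omega>) = p k"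
    by (rule AE_distrD[OF Xs_measurable[OF i]])
  then show ?thesis
  proof eventually_elim
    case (elim \<omega>)
    have "(\<Sum>j=1..k. Q j (Xs i \<omega>)) = (\<Sum>j=1..k. p j)" if "k \<in> {1..K}" for k
      using elim that by (intro sum.cong) auto
    then have "{k \<in> {1..K}. Us i \<omega> < (\<Sum>j=1..k. Q j (Xs i \<omega>))} = {k \<in> {1..K}. Us i \<omega> < (\<Sum>j=1..k. p j)}"
      by auto
    then show ?case unfolding level_fun_def lev_def by (rule arg_cong)
  qed
qed

lemma joint_lev:
  assumes n: "2 \<le> n" and A: "A \<in> sets (Fn n)" and y: "y \<in> labellings {1..n}"
  shows "prob (A \<inter> {\<omega> \<in> space M. \<forall>i\<in>{1..n}. lev (Us i \<omega>) = y i}) = wt {1..n} y * prob A"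
proof -
  let ?PX = "PiM {1..} (\<lambda>_. borel) :: (nat \<Rightarrow> 'h) measure" and ?PU = "PiM {1..} (\<lambda>_. borel) :: (nat \<Rightarrow> real) measure"
  let ?X = "\<lambda>\<omega>. \<lambda>i\<in>{1..}. Xs i \<omega>" and ?U = "\<lambda>\<omega>. \<lambda>i\<in>{1..}. Us i \<omega>"
  let ?E = "{\<omega> \<in> space M. \<forall>i\<in>{1..n}. lev (Us i \<omega>) = y i}"
  have rv: "?X \<in> M \<rightarrow>\<^sub>M ?PX" "?U \<in> M \<rightarrow>\<^sub>M ?PU"
    and ind: "indep_set {?X -` S \<inter> space M | S. S \<in> sets ?PX} {?U -` S \<inter> space M | S. S \<in> sets ?PU}"
    using Xs_Us_indep by (auto simp: indep_rv_def)
  obtain S where S: "S \<in> sets (PiM {1..n} (\<lambda>_. borel))" "A = (\<lambda>\<omega>. \<lambda>i\<in>{1..n}. Xs i \<omega>) -` S \<inter> space M"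
    using A unfolding sets_Fn by auto
  have r: "(\<lambda>z. restrict z {1..n}) \<in> ?PX \<rightarrow>\<^sub>M PiM {1..n} (\<lambda>_. borel)"
    by (rule measurable_restrict_subset) auto
  \<comment> \<open>Independence is given for the two whole sequences, so an event of the first
    \<open>n\<close> observations is pulled back along the restriction.\<close>
  have "A = ?X -` ((\<lambda>z. restrict z {1..n}) -` S \<inter> space ?PX) \<inter> space M"
  proof -
    have "restrict (?X \<omega>) {1..n} = (\<lambda>i\<in>{1..n}. Xs i \<omega>)" for \<omega> by (auto simp: fun_eq_iff)
    then show ?thesis unfolding S(2) using measurable_space[OF rv(1)] by auto
  qed
  then have A': "A \<in> {?X -` S \<inter> space M | S. S \<in> sets ?PX}" using measurable_sets[OF r S(1)] by blast
  have T: "{u \<in> space ?PU. \<forall>i\<in>{1..n}. lev (u i) = y i} \<in> sets ?PU"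
  proof (rule sets.sets_Collect_finite_All)
    fix i assume i: "i \<in> {1..n}"
    have "(\<lambda>u. u i) \<in> ?PU \<rightarrow>\<^sub>M borel" using i by (intro measurable_component_singleton) auto
    from measurable_sets[OF this lev_event[of "y i"]]
    show "{u \<in> space ?PU. lev (u i) = y i} \<in> sets ?PU" by (simp add: vimage_def Int_def conj_commute)
  qed simp
  have "?E = ?U -` {u \<in> space ?PU. \<forall>i\<in>{1..n}. lev (u i) = y i} \<inter> space M"
    using measurable_space[OF rv(2)] by auto
  then have E': "?E \<in> {?U -` S \<inter> space M | S. S \<in> sets ?PU}" using T by blast
  have "prob (A \<inter> ?E) = prob A * prob ?E" by (rule indep_setD[OF ind A' E'])
  also have "prob ?E = prob (\<Inter>i\<in>{1..n}. Us i -` {u. lev u = y i} \<inter> space M)"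
    by (rule arg_cong[where f = prob]) (use n in auto)
  also have "\<dots> = (\<Prod>i\<in>{1..n}. prob (Us i -` {u. lev u = y i} \<inter> space M))"
    by (rule indep_varsD[OF Us_indep]) (use n lev_event in auto)
  also have "\<dots> = wt {1..n} y"
    unfolding wt_def using labellings_range[OF y] by (intro prod.cong refl prob_lev) auto
  finally show ?thesis by simp
qed

lemma joint_Ys:
  assumes n: "2 \<le> n" and A: "A \<in> sets (Fn n)" and y: "y \<in> labellings {1..n}"
  shows "prob (A \<inter> {\<omega> \<in> space M. \<forall>i\<in>{1..n}. Ys i \<omega> = y i}) = wt {1..n} y * prob A"
proof -
  have AM: "A \<in> sets M" using A subalgebra_Fn[of n] by (auto simp: subalgebra_def)
  have "prob (A \<inter> {\<omega> \<in> space M. \<forall>i\<in>{1..n}. Ys i \<omega> = y i})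
      = prob (A \<inter> {\<omega> \<in> space M. \<forall>i\<in>{1..n}. lev (Us i \<omega>) = y i})"
  proof (rule finite_measure_eq_AE)
    have "AE \<omega> in M. \<forall>i\<in>{1..n}. Ys i \<omega> = lev (Us i \<omega>)"
      by (rule AE_finite_allI) (auto intro: AE_Ys_lev)
    then show "AE \<omega> in M. \<omega> \<in> A \<inter> {\<omega> \<in> space M. \<forall>i\<in>{1..n}. Ys i \<omega> = y i}
        \<longleftrightarrow> \<omega> \<in> A \<inter> {\<omega> \<in> space M. \<forall>i\<in>{1..n}. lev (Us i \<omega>) = y i}"
      by eventually_elim auto
    have "{\<omega> \<in> space M. Ys i \<omega> = y i} \<in> sets M" if "i \<in> {1..n}" for i
      using simple_functionD(2)[OF Ys_simple, of i "{y i}"] that by (simp add: vimage_def Int_def conj_commute)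
    then show "A \<inter> {\<omega> \<in> space M. \<forall>i\<in>{1..n}. Ys i \<omega> = y i} \<in> sets M"
      by (intro sets.Int AM sets.sets_Collect_finite_All) auto
    have "{\<omega> \<in> space M. lev (Us i \<omega>) = y i} \<in> sets M" if "i \<in> {1..n}" for i
      using measurable_sets[OF Us_measurable lev_event, of i "y i"] that by (simp add: vimage_def Int_def conj_commute)
    then show "A \<inter> {\<omega> \<in> space M. \<forall>i\<in>{1..n}. lev (Us i \<omega>) = y i} \<in> sets M"
      by (intro sets.Int AM sets.sets_Collect_finite_All) auto
  qed
  then show ?thesis by (simp only: joint_lev[OF n A y])
qed

text \<open>The rarity of shared neighbours is the only asymptotic hypothesis among those to be
  verified; the others concern a fixed \<open>n\<close> or a fixed label.\<close>

sublocale random_graphs K p M "\<lambda>n. sigma_first M Xs n" "\<lambda>n \<omega>. nn_graph n (\<lambda>i. Xs i \<omega>)"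
  "\<lambda>i \<omega>. level_fun K Q (Xs i \<omega>) (Us i \<omega>)"
proof
  show "(\<lambda>n. expectation (\<lambda>\<omega>. label_graph.collisions n (Gr n \<omega>) / (real n)\<^sup>2)) \<longlonglongrightarrow> 0"
  proof (rule Lim_transform_eventually[OF expected_collisions[OF Xs_indep Xs_law dist_cont]])
    show "\<forall>\<^sub>F n in sequentially. expectation (\<lambda>\<omega>. (\<Sum>i=1..n. \<Sum>j=1..n.
        of_bool (nn n (\<lambda>i. Xs i \<omega>) i = nn n (\<lambda>i. Xs i \<omega>) j)) / (real n)\<^sup>2)
      = expectation (\<lambda>\<omega>. label_graph.collisions n (Gr n \<omega>) / (real n)\<^sup>2)"
      using eventually_ge_at_top[of 2]
    proof eventually_elim
      case (elim n)
      have "label_graph.collisions n (Gr n \<omega>) = (\<Sum>i=1..n. \<Sum>j=1..n.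
          of_bool (nn n (\<lambda>i. Xs i \<omega>) i = nn n (\<lambda>i. Xs i \<omega>) j))" for \<omega>
        unfolding label_graph.collisions_def[OF label_graph_nn[OF elim]]
        by (intro sum.cong refl) (simp add: nn_graph_def)
      then show ?case by (simp only:)
    qed
  qed
qed (rule subalgebra_Fn nn_graph_in_graphs Gr_event Ys_simple joint_Ys; assumption)+

section \<open>The vector and the matrices of the statement as functions of graph and labels\<close>

lemma P_vec_carrier: "P_vec K n x y \<in> carrier_vec pdim"
  by (rule carrier_vecI) (simp add: P_vec_def vec_stack_def power2_eq_square)

lemma P_vec_eq_dev:
  assumes n: "2 \<le> n" and r: "r < pdim"
  shows "vec_index (P_vec K n (\<lambda>i. Xs i \<omega>) (\<lambda>i. Ys i \<omega>)) r = dev n (Gr n \<omega>) r (yv n \<omega>)"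
proof -
  interpret label_graph K p n "Gr n \<omega>" by (rule label_graph_nn[OF n])
  have "vec_index (P_vec K n (\<lambda>i. Xs i \<omega>) (\<lambda>i. Ys i \<omega>)) (pair_index K (row_ix r) (col_ix r)) = dev n (Gr n \<omega>) r (yv n \<omega>)"
    unfolding P_vec_index[OF ix_range[OF r]] dev_def pdev_def yv_def pfreq_nn_graph[OF n] p_hat_def q_hat_def ..
  then show ?thesis by (simp add: pair_index_ix)
qed

lemma Sigma_mat_carrier: "Sigma_mat M K Xs (\<lambda>i \<omega>. Ys i \<omega>) n \<omega> \<in> carrier_mat pdim pdim"
  by (simp add: Sigma_mat_def)

lemma Sigma_mat_eq:
  assumes n: "2 \<le> n" and rs: "r < pdim" "s < pdim"
  shows "Sigma_mat M K Xs (\<lambda>i \<omega>. Ys i \<omega>) n \<omega> $$ (r, s)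
    = cond_cov M (Fn n) (\<lambda>\<omega>. dev n (Gr n \<omega>) r (yv n \<omega>)) (\<lambda>\<omega>. dev n (Gr n \<omega>) s (yv n \<omega>)) \<omega>"
  using rs by (simp add: Sigma_mat_def P_vec_eq_dev[OF n])

lemma whp_Sigma_mat:
  assumes rs: "r < pdim" "s < pdim" and \<epsilon>: "0 < \<epsilon>"
  shows "whp (\<lambda>n \<omega>. \<bar>Sigma_mat M K Xs (\<lambda>i \<omega>. Ys i \<omega>) n \<omega> $$ (r, s) - sig (label_graph.mutual n (Gr n \<omega>)) r s\<bar> \<le> \<epsilon>)"
proof (rule whp_eventually_mono[OF whp_cond_cov[OF rs \<epsilon>]])
  show "\<forall>\<^sub>F n in sequentially. \<forall>\<omega>\<in>space M.
    \<bar>cond_cov M (Fn n) (\<lambda>\<omega>. dev n (Gr n \<omega>) r (yv n \<omega>)) (\<lambda>\<omega>. dev n (Gr n \<omega>) s (yv n \<omega>)) \<omega>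
      - sig (label_graph.mutual n (Gr n \<omega>)) r s\<bar> \<le> \<epsilon> \<longrightarrow>
    \<bar>Sigma_mat M K Xs (\<lambda>i \<omega>. Ys i \<omega>) n \<omega> $$ (r, s) - sig (label_graph.mutual n (Gr n \<omega>)) r s\<bar> \<le> \<epsilon>"
    using eventually_ge_at_top[of 2] by eventually_elim (simp only: Sigma_mat_eq[OF _ rs], blast)
qed

lemma Sigma_hat_carrier: "Sigma_hat K n x y \<in> carrier_mat pdim pdim"
  by (simp add: Sigma_hat_def)

lemma Sigma_hat_eq:
  assumes n: "2 \<le> n" and rs: "r < pdim" "s < pdim"
  shows "Sigma_hat K n (\<lambda>i. Xs i \<omega>) (\<lambda>i. Ys i \<omega>) $$ (r, s)
    = Sigma_formula (\<lambda>k. \<Sum>m=1..K. label_graph.pfreq n (Gr n \<omega>) k m (yv n \<omega>)) (label_graph.mutual n (Gr n \<omega>))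
      (row_ix r) (col_ix r) (row_ix s) (col_ix s)"
proof -
  have "p_hat K n (\<lambda>i. Xs i \<omega>) (\<lambda>i. Ys i \<omega>) = (\<lambda>k. \<Sum>m=1..K. label_graph.pfreq n (Gr n \<omega>) k m (yv n \<omega>))"
    unfolding p_hat_def[abs_def] yv_def pfreq_nn_graph[OF n] ..
  then show ?thesis
    using rs unfolding mutual_nn_graph[OF n] by (simp add: Sigma_hat_def row_ix_def col_ix_def)
qed

lemma whp_Sigma_hat:
  assumes rs: "r < pdim" "s < pdim" and \<epsilon>: "0 < \<epsilon>"
  shows "whp (\<lambda>n \<omega>. \<bar>Sigma_hat K n (\<lambda>i. Xs i \<omega>) (\<lambda>i. Ys i \<omega>) $$ (r, s) - sig (label_graph.mutual n (Gr n \<omega>)) r s\<bar> \<le> \<epsilon>)"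
proof (rule whp_eventually_mono[OF whp_Sigma_formula_plugin[OF rs \<epsilon>]])
  show "\<forall>\<^sub>F n in sequentially. \<forall>\<omega>\<in>space M.
    \<bar>Sigma_formula (\<lambda>k. \<Sum>m=1..K. label_graph.pfreq n (Gr n \<omega>) k m (yv n \<omega>)) (label_graph.mutual n (Gr n \<omega>))
      (row_ix r) (col_ix r) (row_ix s) (col_ix s) - sig (label_graph.mutual n (Gr n \<omega>)) r s\<bar> \<le> \<epsilon> \<longrightarrow>
    \<bar>Sigma_hat K n (\<lambda>i. Xs i \<omega>) (\<lambda>i. Ys i \<omega>) $$ (r, s) - sig (label_graph.mutual n (Gr n \<omega>)) r s\<bar> \<le> \<epsilon>"
    using eventually_ge_at_top[of 2] by eventually_elim (simp only: Sigma_hat_eq[OF _ rs], blast)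
qed

section \<open>The two limit statements for the sample\<close>

theorem covariance_formula:
  assumes "k1 \<in> {1..K-1}" "l1 \<in> {1..K-1}" "k2 \<in> {1..K-1}" "l2 \<in> {1..K-1}"
  shows "small_o_P M (\<lambda>n \<omega>. Sigma_mat M K Xs (\<lambda>i \<omega>. Ys i \<omega>) n \<omega> $$ (pair_index K k1 l1, pair_index K k2 l2)
    - Sigma_formula p (W_stat n (\<lambda>i. Xs i \<omega>)) k1 l1 k2 l2) (\<lambda>_. 1)"
proof (rule whp_small_o_P)
  fix \<epsilon> :: real assume \<epsilon>: "\<epsilon> > 0"
  let ?r = "pair_index K k1 l1" and ?s = "pair_index K k2 l2"
  have rs: "?r < pdim" "?s < pdim" using assms pair_index_inverse(1) by auto
  have ix: "row_ix ?r = k1" "col_ix ?r = l1" "row_ix ?s = k2" "col_ix ?s = l2"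
    unfolding row_ix_def col_ix_def using assms by (simp_all only: pair_index_inverse)
  show "whp (\<lambda>n \<omega>. \<bar>Sigma_mat M K Xs (\<lambda>i \<omega>. Ys i \<omega>) n \<omega> $$ (?r, ?s)
      - Sigma_formula p (W_stat n (\<lambda>i. Xs i \<omega>)) k1 l1 k2 l2\<bar> \<le> \<epsilon>)"
  proof (rule whp_eventually_mono[OF whp_Sigma_mat[OF rs \<epsilon>]])
    show "\<forall>\<^sub>F n in sequentially. \<forall>\<omega>\<in>space M.
      \<bar>Sigma_mat M K Xs (\<lambda>i \<omega>. Ys i \<omega>) n \<omega> $$ (?r, ?s) - sig (label_graph.mutual n (Gr n \<omega>)) ?r ?s\<bar> \<le> \<epsilon> \<longrightarrow>
      \<bar>Sigma_mat M K Xs (\<lambda>i \<omega>. Ys i \<omega>) n \<omega> $$ (?r, ?s) - Sigma_formula p (W_stat n (\<lambda>i. Xs i \<omega>)) k1 l1 k2 l2\<bar> \<le> \<epsilon>"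
      using eventually_ge_at_top[of 2] by eventually_elim (simp only: sig_def ix mutual_nn_graph, blast)
  qed
qed

theorem chi_squared_limits:
  assumes L: "small_o_P M (\<lambda>n \<omega>. real (max_indeg n (\<lambda>i. Xs i \<omega>))) (\<lambda>n. real n powr (1/4))"
    and b: "0 < b" and W: "(\<lambda>n. prob {\<omega> \<in> space M. W_stat n (\<lambda>i. Xs i \<omega>) \<le> 1 - b}) \<longlonglongrightarrow> 1"
  defines "P \<equiv> \<lambda>n \<omega>. P_vec K n (\<lambda>i. Xs i \<omega>) (\<lambda>i. Ys i \<omega>)"
    and "S \<equiv> Sigma_mat M K Xs (\<lambda>i \<omega>. Ys i \<omega>)"
    and "Sh \<equiv> \<lambda>n \<omega>. Sigma_hat K n (\<lambda>i. Xs i \<omega>) (\<lambda>i. Ys i \<omega>)"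
  shows "(\<lambda>n. prob {\<omega> \<in> space M. invertible_mat (S n \<omega>)}) \<longlonglongrightarrow> 1"
    and "weak_conv_m (\<lambda>n. distr M borel (\<lambda>\<omega>. inv_quad_form (S n \<omega>) (P n \<omega>))) (chi_squared pdim)"
    and "weak_conv_m (\<lambda>n. distr M borel (\<lambda>\<omega>. inv_quad_form (Sh n \<omega>) (P n \<omega>))) (chi_squared pdim)"
proof -
  have mutual_m: "(\<lambda>\<omega>. label_graph.mutual n (Gr n \<omega>)) \<in> borel_measurable M" if "2 \<le> n" for n
    by (rule borel_measurable_stat[OF that, of "\<lambda>g _. label_graph.mutual n g"])
  have w: "whp (\<lambda>n \<omega>. W_stat n (\<lambda>i. Xs i \<omega>) \<le> 1 - b)"
  proof (rule prob_tendsto_1_whp[OF W])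
    show "\<forall>\<^sub>F n in sequentially. {\<omega> \<in> space M. W_stat n (\<lambda>i. Xs i \<omega>) \<le> 1 - b} \<in> sets M"
      using eventually_ge_at_top[of 2]
    proof eventually_elim
      case (elim n)
      show ?case
        using borel_measurable_le[OF mutual_m[OF elim] borel_measurable_const[of "1 - b"]]
        by (simp only: mutual_nn_graph[OF elim])
    qed
  qed
  have w: "whp (\<lambda>n \<omega>. label_graph.mutual n (Gr n \<omega>) \<le> 1 - b)"
    by (rule whp_eventually_mono[OF w])
      (use eventually_ge_at_top[of 2] in eventually_elim, simp only: mutual_nn_graph, blast)
  have Lm: "(\<lambda>\<omega>. real (max_indeg n (\<lambda>i. Xs i \<omega>))) \<in> borel_measurable M" if n: "2 \<le> n" for n
  proof -
    have "max_indeg n (\<lambda>i. Xs i \<omega>) = Max ((\<lambda>i. card {j \<in> {1..n}. Gr n \<omega> j = i}) ` {1..n})" for \<omega>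
    proof -
      have "{j \<in> {1..n}. Gr n \<omega> j = i} = {j \<in> {1..n}. nn n (\<lambda>i. Xs i \<omega>) j = i}" for i
        by (auto simp: nn_graph_def)
      then show ?thesis unfolding max_indeg_def by (simp only:)
    qed
    then show ?thesis
      using borel_measurable_stat[OF n, of "\<lambda>g _. real (Max ((\<lambda>i. card {j \<in> {1..n}. g j = i}) ` {1..n}))"]
      by (simp only:)
  qed
  have L': "whp (\<lambda>n \<omega>. real (max_indeg n (\<lambda>i. Xs i \<omega>)) \<le> \<epsilon> * real n powr (1/4))" if \<epsilon>: "0 < \<epsilon>" for \<epsilon>
  proof -
    have "\<forall>\<^sub>F n in sequentially. (\<lambda>\<omega>. real (max_indeg n (\<lambda>i. Xs i \<omega>))) \<in> borel_measurable M"
      using eventually_ge_at_top[of 2] by eventually_elim (rule Lm)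
    from small_o_P_whp[OF L \<epsilon> this] show ?thesis by simp
  qed
  note star = card_star_nn_graph
  have Sm: "(\<lambda>\<omega>. S n \<omega> $$ (r, s)) \<in> borel_measurable M" if n: "2 \<le> n" and rs: "r < pdim" "s < pdim" for n r s
    unfolding S_def Sigma_mat_eq[OF n rs] cond_cov_def by (rule borel_measurable_cond_exp2)
  have Shm: "(\<lambda>\<omega>. Sh n \<omega> $$ (r, s)) \<in> borel_measurable M" if n: "2 \<le> n" and rs: "r < pdim" "s < pdim" for n r s
    unfolding Sh_def Sigma_hat_eq[OF n rs]
    by (rule borel_measurable_stat[OF n, of "\<lambda>g y. Sigma_formula (\<lambda>k. \<Sum>m=1..K. label_graph.pfreq n g k m y)
      (label_graph.mutual n g) (row_ix r) (col_ix r) (row_ix s) (col_ix s)"])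
  note lim = chi_squared_limit[where v = P and L = "\<lambda>n \<omega>. max_indeg n (\<lambda>i. Xs i \<omega>)", OF b w]
  show "(\<lambda>n. prob {\<omega> \<in> space M. invertible_mat (S n \<omega>)}) \<longlonglongrightarrow> 1"
    by (rule lim(1)[where A = S])
      (simp_all only: L' star Sm, simp_all only: S_def P_def Sigma_mat_carrier P_vec_carrier whp_Sigma_mat P_vec_eq_dev)
  show "weak_conv_m (\<lambda>n. distr M borel (\<lambda>\<omega>. inv_quad_form (S n \<omega>) (P n \<omega>))) (chi_squared pdim)"
    by (rule lim(2)[where A = S])
      (simp_all only: L' star Sm, simp_all only: S_def P_def Sigma_mat_carrier P_vec_carrier whp_Sigma_mat P_vec_eq_dev)
  show "weak_conv_m (\<lambda>n. distr M borel (\<lambda>\<omega>. inv_quad_form (Sh n \<omega>) (P n \<omega>))) (chi_squared pdim)"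
    by (rule lim(2)[where A = Sh])
      (simp_all only: L' star Shm, simp_all only: Sh_def P_def Sigma_hat_carrier P_vec_carrier whp_Sigma_hat P_vec_eq_dev)
qed

end

text \<open>By independence \<open>Q\<close> and the constant have the same integral over every
  Borel set under the law of \<open>X\<close>, and densities are unique almost everywhere.\<close>

lemma cond_prob_const_of_indep:
  fixes X :: "'v \<Rightarrow> 'h::topological_space"
  assumes M: "prob_space M" and X: "X \<in> M \<rightarrow>\<^sub>M borel" and indep: "indep_rv M borel X (count_space {1..K}) Y"
    and Q_meas: "Q \<in> borel_measurable borel" and Q01: "\<And>x. 0 \<le> Q x" "\<And>x. Q x \<le> 1"
    and k: "k \<in> {1..K}"
    and cond: "\<And>A. A \<in> sets borel \<Longrightarrow> measure M {\<omega> \<in> space M. Y \<omega> = k \<and> X \<omega> \<in> A}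
      = set_lebesgue_integral (distr M borel X) A Q"
  shows "AE x in distr M borel X. Q x = measure M {\<omega> \<in> space M. Y \<omega> = k}"
proof -
  interpret M: prob_space M by fact
  interpret D: prob_space "distr M borel X" by (rule M.prob_space_distr[OF X])
  show ?thesis
  proof (rule density_unique_real)
    show "integrable (distr M borel X) Q"
      by (rule D.integrable_const_bound[of _ 1]) (use Q01 Q_meas in auto)
    fix A assume "A \<in> sets (distr M borel X)"
    then have A: "A \<in> sets borel" by simp
    have "set_lebesgue_integral (distr M borel X) A Q = M.prob ((X -` A \<inter> space M) \<inter> (Y -` {k} \<inter> space M))"
      unfolding cond[OF A, symmetric] by (rule arg_cong[where f = M.prob]) auto
    also have "\<dots> = M.prob (X -` A \<inter> space M) * M.prob (Y -` {k} \<inter> space M)"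
    proof (rule M.indep_setD)
      show "M.indep_set {X -` S \<inter> space M | S. S \<in> sets borel} {Y -` S \<inter> space M | S. S \<in> sets (count_space {1..K})}"
        using indep by (simp add: indep_rv_def)
      show "X -` A \<inter> space M \<in> {X -` S \<inter> space M | S. S \<in> sets borel}" using A by blast
      show "Y -` {k} \<inter> space M \<in> {Y -` S \<inter> space M | S. S \<in> sets (count_space {1..K})}"
        by (rule CollectI, rule exI[of _ "{k}"]) (use k in auto)
    qed
    also have "Y -` {k} \<inter> space M = {\<omega> \<in> space M. Y \<omega> = k}" by auto
    also have "M.prob (X -` A \<inter> space M) * M.prob {\<omega> \<in> space M. Y \<omega> = k}
        = set_lebesgue_integral (distr M borel X) A (\<lambda>_. M.prob {\<omega> \<in> space M. Y \<omega> = k})"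
      using A by (simp add: set_lebesgue_integral_def measure_distr[OF X A])
    finally show "set_lebesgue_integral (distr M borel X) A Q
        = set_lebesgue_integral (distr M borel X) A (\<lambda>_. M.prob {\<omega> \<in> space M. Y \<omega> = k})" .
  qed simp
qed

text \<open>The covariance matrix is random, so its invertibility for large \<open>n\<close> takes
  the form of a probability tending to one. On the exceptional event \<open>inv_quad_form\<close> is
  0, which affects no weak limit.\<close>

theorem theorem4:
  fixes M\<^sub>0 :: "'v measure"
    and X :: "'v \<Rightarrow> 'h::{metric_space, second_countable_topology}"
    and Y :: "'v \<Rightarrow> nat"
    and K :: nat
    and p :: "nat \<Rightarrow> real"
    and Q :: "nat \<Rightarrow> 'h \<Rightarrow> real"
    and M :: "'w measure"
    and Xs :: "nat \<Rightarrow> 'w \<Rightarrow> 'h"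
    and Us :: "nat \<Rightarrow> 'w \<Rightarrow> real"
    and Ys :: "nat \<Rightarrow> 'w \<Rightarrow> nat"
    and P :: "nat \<Rightarrow> 'w \<Rightarrow> real Matrix.vec"
    and \<Sigma> :: "nat \<Rightarrow> 'w \<Rightarrow> real mat"
    and \<Sigma>h :: "nat \<Rightarrow> 'w \<Rightarrow> real mat"
    and W :: "nat \<Rightarrow> 'w \<Rightarrow> real"
    and L :: "nat \<Rightarrow> 'w \<Rightarrow> nat"
  assumes prob_M\<^sub>0: "prob_space M\<^sub>0"
    and X_rv: "X \<in> measurable M\<^sub>0 borel"
    and K_ge: "K \<ge> 2"
    and Y_rv: "Y \<in> measurable M\<^sub>0 (count_space {1..K})"
    and p_def: "\<And>k. p k = measure M\<^sub>0 {\<omega> \<in> space M\<^sub>0. Y \<omega> = k}"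
    and p_pos: "\<And>k. k \<in> {1..K} \<Longrightarrow> p k > 0"
    and Q_meas: "\<And>k. k \<in> {1..K} \<Longrightarrow> Q k \<in> borel_measurable borel"
    and Q_nonneg: "\<And>k x. k \<in> {1..K} \<Longrightarrow> Q k x \<ge> 0"
    and Q_sum: "\<And>x. (\<Sum>k=1..K. Q k x) = 1"
    and Q_cond: "\<And>k A. k \<in> {1..K} \<Longrightarrow> A \<in> sets borel \<Longrightarrow>
        measure M\<^sub>0 {\<omega> \<in> space M\<^sub>0. Y \<omega> = k \<and> X \<omega> \<in> A}
          = set_lebesgue_integral (distr M\<^sub>0 borel X) A (Q k)"
    and prob_M: "prob_space M"
    and Xs_indep: "prob_space.indep_vars M (\<lambda>_. borel) Xs {1..}"
    and Xs_law: "\<And>i. i \<ge> 1 \<Longrightarrow> distr M borel (Xs i) = distr M\<^sub>0 borel X"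
    and Us_indep: "prob_space.indep_vars M (\<lambda>_. borel) Us {1..}"
    and Us_law: "\<And>i. i \<ge> 1 \<Longrightarrow> distr M borel (Us i) = uniform_measure lborel {0<..<1}"
    and Xs_Us_indep:
      "indep_rv M (PiM {1..} (\<lambda>_. borel)) (\<lambda>\<omega>. \<lambda>i\<in>{1..}. Xs i \<omega>)
                  (PiM {1..} (\<lambda>_. borel)) (\<lambda>\<omega>. \<lambda>i\<in>{1..}. Us i \<omega>)"
    and Ys_def: "\<And>i \<omega>. Ys i \<omega> = level_fun K Q (Xs i \<omega>) (Us i \<omega>)"
    and dist_cont: "continuous_on UNIV (cdf (distr M borel (\<lambda>\<omega>. dist (Xs 1 \<omega>) (Xs 2 \<omega>))))"
    and P_def: "\<And>n \<omega>. P n \<omega> = P_vec K n (\<lambda>i. Xs i \<omega>) (\<lambda>i. Ys i \<omega>)"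
    and \<Sigma>_def: "\<And>n \<omega>. \<Sigma> n \<omega> = Sigma_mat M K Xs Ys n \<omega>"
    and \<Sigma>h_def: "\<And>n \<omega>. \<Sigma>h n \<omega> = Sigma_hat K n (\<lambda>i. Xs i \<omega>) (\<lambda>i. Ys i \<omega>)"
    and W_def: "\<And>n \<omega>. W n \<omega> = W_stat n (\<lambda>i. Xs i \<omega>)"
    and L_def: "\<And>n \<omega>. L n \<omega> = max_indeg n (\<lambda>i. Xs i \<omega>)"
    and X_Y_indep: "indep_rv M\<^sub>0 borel X (count_space {1..K}) Y"
  shows
    "((AE u in lborel. 0 < u \<and> u < 1 \<longrightarrow>
          small_o_P M
            (\<lambda>n \<omega>. real (level_fun K Q (Xs (nn n (\<lambda>i. Xs i \<omega>) 1) \<omega>) u)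
                    - real (level_fun K Q (Xs 1 \<omega>) u))
            (\<lambda>_. 1)) \<or>
      (\<forall>k\<in>{1..K}. AE x in distr M\<^sub>0 borel X. isCont (Q k) x)
        \<longrightarrow> (\<forall>k1\<in>{1..K-1}. \<forall>l1\<in>{1..K-1}. \<forall>k2\<in>{1..K-1}. \<forall>l2\<in>{1..K-1}.
              small_o_P M
                (\<lambda>n \<omega>. \<Sigma> n \<omega> $$ (pair_index K k1 l1, pair_index K k2 l2)
                        - Sigma_formula p (W n \<omega>) k1 l1 k2 l2)
                (\<lambda>_. 1)))
     \<and>
     (small_o_P M (\<lambda>n \<omega>. real (L n \<omega>)) (\<lambda>n. real n powr (1/4)) \<and>
      (\<exists>b>0. (\<lambda>n. measure M {\<omega> \<in> space M. W n \<omega> \<le> 1 - b}) \<longlonglongrightarrow> 1)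
        \<longrightarrow> (\<lambda>n. measure M {\<omega> \<in> space M. invertible_mat (\<Sigma> n \<omega>)}) \<longlonglongrightarrow> 1
          \<and> weak_conv_m (\<lambda>n. distr M borel (\<lambda>\<omega>. inv_quad_form (\<Sigma> n \<omega>) (P n \<omega>)))
                (chi_squared ((K - 1)\<^sup>2))
          \<and> weak_conv_m (\<lambda>n. distr M borel (\<lambda>\<omega>. inv_quad_form (\<Sigma>h n \<omega>) (P n \<omega>)))
                (chi_squared ((K - 1)\<^sup>2)))"
proof -
  interpret M0: prob_space M\<^sub>0 by (rule prob_M\<^sub>0)
  interpret M: prob_space M by (rule prob_M)
  have sum_p: "(\<Sum>k=1..K. p k) = 1"
  proof -
    have "(\<Sum>k=1..K. p k) = M0.prob (\<Union>k\<in>{1..K}. {\<omega> \<in> space M\<^sub>0. Y \<omega> = k})"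
      unfolding p_def
    proof (rule M0.finite_measure_finite_Union[symmetric])
      show "(\<lambda>k. {\<omega> \<in> space M\<^sub>0. Y \<omega> = k}) ` {1..K} \<subseteq> M0.events"
      proof (rule image_subsetI)
        fix k assume "k \<in> {1..K}"
        then have "{k} \<in> sets (count_space {1..K})" by simp
        from measurable_sets[OF Y_rv this]
        show "{\<omega> \<in> space M\<^sub>0. Y \<omega> = k} \<in> M0.events" by (simp add: vimage_def Int_def conj_commute)
      qed
    qed (auto simp: disjoint_family_on_def)
    also have "(\<Union>k\<in>{1..K}. {\<omega> \<in> space M\<^sub>0. Y \<omega> = k}) = space M\<^sub>0"
      using measurable_space[OF Y_rv] by auto
    finally show ?thesis by (simp only: M0.prob_space)
  qed
  have Q_le: "Q k x \<le> 1" if "k \<in> {1..K}" for k x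
    unfolding Q_sum[of x, symmetric] by (rule member_le_sum[OF that]) (auto intro: Q_nonneg)
  interpret E: nn_experiment K p M Xs Us Q "distr M\<^sub>0 borel X"
  proof
    show "AE x in distr M\<^sub>0 borel X. Q k x = p k" if k: "k \<in> {1..K}" for k
      unfolding p_def
      by (rule cond_prob_const_of_indep[OF prob_M\<^sub>0 X_rv X_Y_indep Q_meas[OF k] Q_nonneg[OF k] Q_le[OF k] k Q_cond[OF k]])
  qed (fact p_pos K_ge sum_p Xs_indep Xs_law Us_indep Us_law Xs_Us_indep dist_cont Q_meas less_imp_le[OF p_pos])+
  have Ys_eq: "Ys = (\<lambda>i \<omega>. level_fun K Q (Xs i \<omega>) (Us i \<omega>))"
    by (intro ext) (rule Ys_def)
  have \<Sigma>_eq: "\<Sigma> = Sigma_mat M K Xs (\<lambda>i \<omega>. level_fun K Q (Xs i \<omega>) (Us i \<omega>))"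
    unfolding Ys_eq[symmetric] by (intro ext) (rule \<Sigma>_def)
  have P_eq: "P = (\<lambda>n \<omega>. P_vec K n (\<lambda>i. Xs i \<omega>) (\<lambda>i. level_fun K Q (Xs i \<omega>) (Us i \<omega>)))"
    by (intro ext) (simp only: P_def Ys_def)
  have \<Sigma>h_eq: "\<Sigma>h = (\<lambda>n \<omega>. Sigma_hat K n (\<lambda>i. Xs i \<omega>) (\<lambda>i. level_fun K Q (Xs i \<omega>) (Us i \<omega>)))"
    by (intro ext) (simp only: \<Sigma>h_def Ys_def)
  show ?thesis
  proof (intro conjI impI ballI, goal_cases)
    case (1 k1 l1 k2 l2)
    then show ?case
      unfolding \<Sigma>_eq W_def by (intro E.covariance_formula)
  next
    case 2
    then obtain b where "0 < b" "(\<lambda>n. M.prob {\<omega> \<in> space M. W n \<omega> \<le> 1 - b}) \<longlonglongrightarrow> 1" by blast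
    with 2 show ?case
      unfolding \<Sigma>_eq W_def L_def by (intro E.chi_squared_limits(1)) auto
  next
    case 3
    then obtain b where "0 < b" "(\<lambda>n. M.prob {\<omega> \<in> space M. W n \<omega> \<le> 1 - b}) \<longlonglongrightarrow> 1" by blast
    with 3 show ?case
      unfolding \<Sigma>_eq P_eq W_def L_def by (intro E.chi_squared_limits(2)) auto
  next
    case 4
    then obtain b where "0 < b" "(\<lambda>n. M.prob {\<omega> \<in> space M. W n \<omega> \<le> 1 - b}) \<longlonglongrightarrow> 1" by blast
    with 4 show ?case
      unfolding \<Sigma>h_eq P_eq W_def L_def by (intro E.chi_squared_limits(3)) auto
  qed
qed

end
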